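(* Every $2$-rose graph other than $R(3,4)$ and $R(3,5)$ is determined by its Laplacian spectrum. Each of $R(3,4)$ and $R(3,5)$ has exactly one Laplacian cospectral mate (up to isomorphism).
   Context: Graphs are finite, simple and undirected. A $2$-rose graph is a graph consisting of two cycles sharing exactly one vertex; equivalently, a connected graph with one vertex of degree $4$ and all other vertices of degree $2$. For $\ell\ge3$, $R(3,\ell)$ denotes the $2$-rose graph whose two cycles are a triangle and a cycle of length $\ell$. The Laplacian spectrum of a graph is the multiset of eigenvalues of $L=D-A$, where $A$ is the adjacency matrix and $D$ the diagonal degree matrix. A graph is determined by its Laplacian spectrum if every graph with the same Laplacian spectrum is isomorphic to it; a Laplacian cospectral mate of $G$ is a graph not isomorphic to $G$ with the same Laplacian spectrum. *)

theory Defs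
  imports "Jordan_Normal_Form.Char_Poly"
begin

type_synonym 'a ugraph = "'a set \<times> 'a set set"

abbreviation verts :: "'a ugraph \<Rightarrow> 'a set" where
  "verts \<equiv> fst"

abbreviation edges :: "'a ugraph \<Rightarrow> 'a set set" where
  "edges \<equiv> snd"

definition simple_graph :: "'a ugraph \<Rightarrow> bool" where
  "simple_graph G \<longleftrightarrow> finite (verts G) \<and> (\<forall>e\<in>edges G. e \<subseteq> verts G \<and> card e = 2)"

definition graph_iso :: "'a ugraph \<Rightarrow> 'b ugraph \<Rightarrow> bool" where
  "graph_iso G H \<longleftrightarrow> (\<exists>f. bij_betw f (verts G) (verts H) \<and>
     (\<forall>u\<in>verts G. \<forall>v\<in>verts G. {u, v} \<in> edges G \<longleftrightarrow> {f u, f v} \<in> edges H))"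

definition cycle_of :: "'a list \<Rightarrow> 'a ugraph" where
  "cycle_of xs = (set xs, {{xs ! i, xs ! (Suc i mod length xs)} | i. i < length xs})"

definition graph_union :: "'a ugraph \<Rightarrow> 'a ugraph \<Rightarrow> 'a ugraph" where
  "graph_union G H = (verts G \<union> verts H, edges G \<union> edges H)"

definition two_rose :: "'a ugraph \<Rightarrow> bool" where
  "two_rose G \<longleftrightarrow> (\<exists>xs ys v. distinct xs \<and> distinct ys \<and> length xs \<ge> 3 \<and> length ys \<ge> 3 \<and>
     set xs \<inter> set ys = {v} \<and> G = graph_union (cycle_of xs) (cycle_of ys))"

text \<open>A concrete copy of $R(k,l)$, meaningful for $k, l \ge 3$; the shared vertex is 0.\<close>

definition rose :: "nat \<Rightarrow> nat \<Rightarrow> nat ugraph" where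
  "rose k l = graph_union (cycle_of [0..<k]) (cycle_of (0 # [k..<k + l - 1]))"

definition degree_mat :: "'a ugraph \<Rightarrow> 'a list \<Rightarrow> complex mat" where
  "degree_mat G vs = mat (length vs) (length vs)
     (\<lambda>(i, j). if i = j then of_nat (card {e \<in> edges G. vs ! i \<in> e}) else 0)"

definition adjacency_mat :: "'a ugraph \<Rightarrow> 'a list \<Rightarrow> complex mat" where
  "adjacency_mat G vs = mat (length vs) (length vs)
     (\<lambda>(i, j). if {vs ! i, vs ! j} \<in> edges G then 1 else 0)"

definition laplacian_mat :: "'a ugraph \<Rightarrow> 'a list \<Rightarrow> complex mat" where
  "laplacian_mat G vs = degree_mat G vs - adjacency_mat G vs"

text \<open>The eigenvalues are counted with multiplicity as roots of the characteristic polynomial.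
  The choice of vertex enumeration is immaterial, see \<open>laplacian_spectrum_eq\<close> below.\<close>

definition laplacian_spectrum :: "'a ugraph \<Rightarrow> complex multiset" where
  "laplacian_spectrum G =
     proots (char_poly (laplacian_mat G (SOME vs. distinct vs \<and> set vs = verts G)))"

text \<open>The extra type argument is the vertex type of the competing graphs, since HOL cannot
  quantify over types inside a formula.\<close>

definition determined_by_laplacian_spectrum :: "'b itself \<Rightarrow> 'a ugraph \<Rightarrow> bool" where
  "determined_by_laplacian_spectrum T G \<longleftrightarrow>
     (\<forall>H :: 'b ugraph. simple_graph H \<and> laplacian_spectrum H = laplacian_spectrum G \<longrightarrow>
        graph_iso H G)"

definition laplacian_cospectral_mate :: "'a ugraph \<Rightarrow> 'b ugraph \<Rightarrow> bool" where
  "laplacian_cospectral_mate G H \<longleftrightarrow>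
     simple_graph H \<and> \<not> graph_iso H G \<and> laplacian_spectrum H = laplacian_spectrum G"

lemma simple_graph_cycle_of:
  assumes "distinct xs" "length xs \<ge> 3"
  shows "simple_graph (cycle_of xs)"
proof -
  have "{xs ! i, xs ! (Suc i mod length xs)} \<subseteq> set xs \<and>
        card {xs ! i, xs ! (Suc i mod length xs)} = 2" if i: "i < length xs" for i
  proof -
    have lt: "Suc i mod length xs < length xs" using i by (intro mod_less_divisor) linarith
    have "i \<noteq> Suc i mod length xs"
      using i assms(2) by (cases "Suc i = length xs") auto
    then have "xs ! i \<noteq> xs ! (Suc i mod length xs)"
      using assms(1) i lt nth_eq_iff_index_eq by blast
    then show ?thesis using i lt by simp
  qed
  then show ?thesis by (auto simp: simple_graph_def cycle_of_def)
qed

lemma two_rose_simple_graph: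
  assumes "two_rose G"
  shows "simple_graph G"
proof -
  obtain xs ys where "simple_graph (cycle_of xs)" "simple_graph (cycle_of ys)"
    "G = graph_union (cycle_of xs) (cycle_of ys)"
    using assms simple_graph_cycle_of unfolding two_rose_def by blast
  then show ?thesis
    by (auto simp: graph_union_def simple_graph_def)
qed

lemma two_rose_rose:
  assumes "k \<ge> 3" "l \<ge> 3"
  shows "two_rose (rose k l)"
  unfolding two_rose_def rose_def
  by (rule exI[of _ "[0..<k]"], rule exI[of _ "0 # [k..<k + l - 1]"], rule exI[of _ 0])
     (use assms in auto)

lemma laplacian_spectrum_eq:
  assumes vs: "distinct vs" "set vs = verts G"
  shows "laplacian_spectrum G = proots (char_poly (laplacian_mat G vs))"
proof -
  define ws where "ws = (SOME ws. distinct ws \<and> set ws = verts G)"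
  have ws: "distinct ws" "set ws = verts G"
    using someI[of "\<lambda>ws. distinct ws \<and> set ws = verts G" vs] vs unfolding ws_def by auto
  define n where "n = length vs"
  have n: "length ws = n"
    using vs ws unfolding n_def by (metis distinct_card)
  define P :: "complex mat" where "P = mat n n (\<lambda>(i, j). if ws ! i = vs ! j then 1 else 0)"
  define Q :: "complex mat" where "Q = mat n n (\<lambda>(i, j). if vs ! i = ws ! j then 1 else 0)"
  have ex1: "\<exists>k<n. ws ! i = vs ! k" if "i < n" for i
    using that vs ws n n_def by (metis in_set_conv_nth)
  have ex2: "\<exists>k<n. vs ! i = ws ! k" if "i < n" for i
    using that vs ws n n_def by (metis in_set_conv_nth)
  have eqv: "vs ! i = vs ! j \<longleftrightarrow> i = j" if "i < n" "j < n" for i j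
    using that vs n_def nth_eq_iff_index_eq by blast
  have eqw: "ws ! i = ws ! j \<longleftrightarrow> i = j" if "i < n" "j < n" for i j
    using that ws n nth_eq_iff_index_eq by blast
  have sumP: "(\<Sum>k = 0..<n. (if ws ! i = vs ! k then 1 else 0) * f k) = f k0"
    if "k0 < n" "ws ! i = vs ! k0" for i k0 and f :: "nat \<Rightarrow> complex"
  proof -
    have "(\<Sum>k = 0..<n. (if ws ! i = vs ! k then 1 else 0) * f k) =
          (\<Sum>k = 0..<n. if k = k0 then f k else 0)"
      using that eqv by (intro sum.cong) auto
    then show ?thesis using that by simp
  qed
  have sumQ: "(\<Sum>k = 0..<n. (if vs ! i = ws ! k then 1 else 0) * f k) = f k0"
    if "k0 < n" "vs ! i = ws ! k0" for i k0 and f :: "nat \<Rightarrow> complex"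
  proof -
    have "(\<Sum>k = 0..<n. (if vs ! i = ws ! k then 1 else 0) * f k) =
          (\<Sum>k = 0..<n. if k = k0 then f k else 0)"
      using that eqw by (intro sum.cong) auto
    then show ?thesis using that by simp
  qed
  have carr: "P \<in> carrier_mat n n" "Q \<in> carrier_mat n n"
    by (auto simp: P_def Q_def)
  have carrL: "laplacian_mat G vs \<in> carrier_mat n n" "laplacian_mat G ws \<in> carrier_mat n n"
    by (auto simp: laplacian_mat_def degree_mat_def adjacency_mat_def n n_def[symmetric])
  have PQ: "P * Q = 1\<^sub>m n"
  proof (rule eq_matI)
    fix i j assume "i < dim_row (1\<^sub>m n :: complex mat)" "j < dim_col (1\<^sub>m n :: complex mat)"
    then have ij: "i < n" "j < n" by auto
    obtain k where k: "k < n" "ws ! i = vs ! k" using ex1 ij by blast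
    have "(P * Q) $$ (i, j) = (\<Sum>t = 0..<n. (if ws ! i = vs ! t then 1 else 0) *
            (if vs ! t = ws ! j then 1 else 0))"
      using ij by (simp add: P_def Q_def scalar_prod_def)
    also have "\<dots> = (if vs ! k = ws ! j then 1 else 0)"
      by (rule sumP[OF k])
    also have "\<dots> = 1\<^sub>m n $$ (i, j)"
      using ij eqw[OF ij] by (simp add: k(2)[symmetric])
    finally show "(P * Q) $$ (i, j) = 1\<^sub>m n $$ (i, j)" .
  qed (auto simp: P_def Q_def)
  have QP: "Q * P = 1\<^sub>m n"
  proof (rule eq_matI)
    fix i j assume "i < dim_row (1\<^sub>m n :: complex mat)" "j < dim_col (1\<^sub>m n :: complex mat)"
    then have ij: "i < n" "j < n" by auto
    obtain k where k: "k < n" "vs ! i = ws ! k" using ex2 ij by blast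
    have "(Q * P) $$ (i, j) = (\<Sum>t = 0..<n. (if vs ! i = ws ! t then 1 else 0) *
            (if ws ! t = vs ! j then 1 else 0))"
      using ij by (simp add: P_def Q_def scalar_prod_def)
    also have "\<dots> = (if ws ! k = vs ! j then 1 else 0)"
      by (rule sumQ[OF k])
    also have "\<dots> = 1\<^sub>m n $$ (i, j)"
      using ij eqv[OF ij] by (simp add: k(2)[symmetric])
    finally show "(Q * P) $$ (i, j) = 1\<^sub>m n $$ (i, j)" .
  qed (auto simp: P_def Q_def)
  have "laplacian_mat G ws * P = P * laplacian_mat G vs"
  proof (rule eq_matI)
    fix i j assume "i < dim_row (P * laplacian_mat G vs)" "j < dim_col (P * laplacian_mat G vs)"
    then have ij: "i < n" "j < n" using carr carrL by auto
    obtain k where k: "k < n" "ws ! i = vs ! k" using ex1 ij by blast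
    obtain m where m: "m < n" "vs ! j = ws ! m" using ex2 ij by blast
    have "(laplacian_mat G ws * P) $$ (i, j) =
          (\<Sum>t = 0..<n. laplacian_mat G ws $$ (i, t) * (if ws ! t = vs ! j then 1 else 0))"
      using ij carrL(2) by (simp add: P_def scalar_prod_def)
    also have "\<dots> = (\<Sum>t = 0..<n. (if vs ! j = ws ! t then 1 else 0) * laplacian_mat G ws $$ (i, t))"
      by (intro sum.cong) auto
    also have "\<dots> = laplacian_mat G ws $$ (i, m)"
      using sumQ[OF m] .
    also have "\<dots> = laplacian_mat G vs $$ (k, j)"
    proof -
      have "i = m \<longleftrightarrow> k = j"
        using eqv[OF k(1) ij(2)] eqw[OF ij(1) m(1)] k(2) m(2) by argo
      then show ?thesis
        using ij k(1) m(1)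
        by (simp add: laplacian_mat_def degree_mat_def adjacency_mat_def n n_def[symmetric]
            k(2) m(2)[symmetric])
    qed
    also have "\<dots> = (P * laplacian_mat G vs) $$ (i, j)"
      using ij carrL(1) sumP[OF k, of "\<lambda>t. laplacian_mat G vs $$ (t, j)"]
      by (simp add: P_def scalar_prod_def)
    finally show "(laplacian_mat G ws * P) $$ (i, j) = (P * laplacian_mat G vs) $$ (i, j)" .
  qed (use carr carrL in auto)
  then have "P * laplacian_mat G vs * Q = laplacian_mat G ws * P * Q"
    by simp
  also have "\<dots> = laplacian_mat G ws * (P * Q)"
    by (rule assoc_mult_mat[OF carrL(2) carr])
  also have "\<dots> = laplacian_mat G ws"
    unfolding PQ by (rule right_mult_one_mat[OF carrL(2)])
  finally have sim: "laplacian_mat G ws = P * laplacian_mat G vs * Q"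
    by (rule sym)
  have "similar_mat (laplacian_mat G ws) (laplacian_mat G vs)"
    by (rule similar_matI[OF _ PQ QP sim]) (simp add: carr carrL)
  then show ?thesis
    unfolding laplacian_spectrum_def ws_def[symmetric] by (simp only: char_poly_similar)
qed

end

theory Submission
  imports Defs "Jordan_Normal_Form.Schur_Decomposition"
begin

text \<open>
  Let \<open>H\<close> be cospectral to \<open>R(k, l)\<close>. Two kinds of spectral invariants are used: the traces of
  \<open>L, L\<^sup>2, L\<^sup>3, L\<^sup>4\<close>, and the determinant \<open>\<tau>\<close> of \<open>L\<close> with one vertex deleted, which up to the factor
  \<open>\<plusminus>n\<close> is the linear coefficient of the characteristic polynomial. For \<open>R(k, l)\<close> one has \<open>\<tau> = k l\<close>;
  as this is nonzero, \<open>H\<close> is connected. The first two traces say that the deviations \<open>d - 2\<close> of the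
  degrees of \<open>H\<close> have sum 2 and square sum 4. So either one degree is 4 and the others are 2, in
  which case \<open>H\<close> is a two-rose \<open>R(k', l')\<close> with \<open>k' + l' = k + l\<close> and \<open>k' l' = k l\<close>, or the degrees are
  \<open>3, 3, 3, 1, 2, \<dots>, 2\<close>.

  In the second case the third trace shows that \<open>H\<close> has one triangle less than \<open>R(k, l)\<close>, so \<open>k = 3\<close>,
  and for \<open>l \<ge> 4\<close> the graph \<open>H\<close> is triangle-free. The fourth trace then gives
  \<open>c(H) = c(R(3, l)) + (5 - s) / 2\<close>, where \<open>c\<close> counts 4-cycles and \<open>s \<le> 2\<close> is the number of edges
  between vertices of degree 3 minus the number of edges from the vertex of degree 1 to those. So
  \<open>H\<close> has two 4-cycles. If they are disjoint, the only edges that carry a flow of a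
  harmonic function modulo 3 lie on them, and since 4 is invertible modulo 3 such a function is
  constant; this contradicts \<open>\<tau> = 3 l\<close>. If they meet, their union is \<open>K\<^sub>2\<^sub>,\<^sub>3\<close> or a ladder with two
  squares, and parity of \<open>s\<close> forces the pendant vertex to sit directly on it, so that \<open>l = 4\<close> or
  \<open>l = 5\<close>.
\<close>

section \<open>Neighbourhoods, degrees and connectedness\<close>

definition nbrs :: "'a ugraph \<Rightarrow> 'a \<Rightarrow> 'a set" where
  "nbrs G u = {w. {u, w} \<in> edges G}"

definition deg :: "'a ugraph \<Rightarrow> 'a \<Rightarrow> nat" where
  "deg G u = card (nbrs G u)"

lemma nbrs_commute: "w \<in> nbrs G u \<longleftrightarrow> u \<in> nbrs G w"
  by (simp add: nbrs_def insert_commute)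

lemma nbrs_sym: "w \<in> nbrs G u \<Longrightarrow> u \<in> nbrs G w"
  by (simp add: nbrs_commute)

lemma finite_verts: "simple_graph G \<Longrightarrow> finite (verts G)"
  by (simp add: simple_graph_def)

lemma finite_edges:
  assumes "simple_graph G"
  shows "finite (edges G)"
  by (rule finite_subset[of _ "Pow (verts G)"]) (use assms in \<open>auto simp: simple_graph_def\<close>)

lemma nbrs_subset_verts: "simple_graph G \<Longrightarrow> nbrs G u \<subseteq> verts G"
  unfolding simple_graph_def nbrs_def by fastforce

lemma finite_nbrs: "simple_graph G \<Longrightarrow> finite (nbrs G u)"
  using finite_subset[OF nbrs_subset_verts finite_verts] .

lemma not_self_nbr: "simple_graph G \<Longrightarrow> u \<notin> nbrs G u"
  unfolding simple_graph_def nbrs_def by force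

lemma nbr_neq: "simple_graph G \<Longrightarrow> w \<in> nbrs G u \<Longrightarrow> w \<noteq> u"
  using not_self_nbr by metis

lemma in_verts_if_nbr:
  assumes "simple_graph G" "w \<in> nbrs G u"
  shows "u \<in> verts G" "w \<in> verts G"
  using assms nbrs_subset_verts nbrs_commute by fast+

lemma simple_graph_edgeE:
  assumes "simple_graph G" "e \<in> edges G"
  obtains u w where "e = {u, w}" "w \<in> nbrs G u"
proof -
  have "card e = 2" using assms by (simp add: simple_graph_def)
  then obtain u w where "e = {u, w}" by (auto simp: card_2_iff)
  then show thesis using that assms(2) by (simp add: nbrs_def)
qed

lemma nbrs_eqI:
  assumes "simple_graph G" "S \<subseteq> nbrs G u" "deg G u \<le> card S"
  shows "nbrs G u = S"
  using assms card_seteq[of "nbrs G u" S] finite_nbrs[of G u] by (simp add: deg_def)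

lemma card_incident_edges:
  assumes "simple_graph G"
  shows "card {e \<in> edges G. u \<in> e} = deg G u"
proof -
  have "{e \<in> edges G. u \<in> e} = (\<lambda>w. {u, w}) ` nbrs G u"
  proof (intro equalityI subsetI)
    fix e assume "e \<in> {e \<in> edges G. u \<in> e}"
    then have e: "e \<in> edges G" "u \<in> e" by auto
    then obtain w where "e = {u, w}" by (metis simple_graph_edgeE[OF assms] insertE insert_commute singletonD)
    then show "e \<in> (\<lambda>w. {u, w}) ` nbrs G u" using e(1) by (simp add: nbrs_def)
  qed (auto simp: nbrs_def)
  moreover have "inj_on (\<lambda>w. {u, w}) (nbrs G u)"
    by (auto simp: inj_on_def doubleton_eq_iff)
  ultimately show ?thesis by (simp add: deg_def card_image)
qed

lemma sum_deg:
  assumes "simple_graph G"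
  shows "(\<Sum>u\<in>verts G. deg G u) = 2 * card (edges G)"
proof -
  note fin = finite_verts[OF assms] finite_edges[OF assms]
  have "(\<Sum>u\<in>verts G. deg G u) = (\<Sum>u\<in>verts G. \<Sum>e\<in>edges G. if u \<in> e then 1 else 0)"
    using fin by (simp add: card_incident_edges[OF assms, symmetric] sum.If_cases Collect_conj_eq)
  also have "\<dots> = (\<Sum>e\<in>edges G. \<Sum>u\<in>verts G. if u \<in> e then 1 else 0)"
    by (rule sum.swap)
  also have "\<dots> = (\<Sum>e\<in>edges G. 2)"
  proof (rule sum.cong[OF refl])
    fix e assume "e \<in> edges G"
    then have "verts G \<inter> e = e" "card e = 2" using assms by (auto simp: simple_graph_def)
    then show "(\<Sum>u\<in>verts G. if u \<in> e then 1 else 0) = (2::nat)"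
      using fin by (simp add: sum.If_cases)
  qed
  finally show ?thesis by simp
qed

definition graph_connected :: "'a ugraph \<Rightarrow> bool" where
  "graph_connected G \<longleftrightarrow> (\<forall>S. S \<subseteq> verts G \<and> S \<noteq> {} \<and> (\<forall>u\<in>S. nbrs G u \<subseteq> S) \<longrightarrow> S = verts G)"

lemma graph_connectedD:
  assumes "graph_connected G" "S \<subseteq> verts G" "S \<noteq> {}" "\<And>u. u \<in> S \<Longrightarrow> nbrs G u \<subseteq> S"
  shows "S = verts G"
  using assms unfolding graph_connected_def by blast

lemma graph_connected_deg_pos:
  assumes G: "simple_graph G" "graph_connected G" and "card (verts G) \<ge> 2" "u \<in> verts G"
  shows "deg G u \<ge> 1"
proof (rule ccontr)
  assume "\<not> deg G u \<ge> 1"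
  then have "nbrs G u = {}" using finite_nbrs[OF G(1), of u] by (simp add: deg_def not_less_eq_eq)
  then have "{u} = verts G" using graph_connectedD[OF G(2), of "{u}"] assms(4) by simp
  from arg_cong[OF this, of card] show False using assms(3) by simp
qed

section \<open>Isomorphisms\<close>

lemma graph_iso_sym:
  assumes "graph_iso G H"
  shows "graph_iso H G"
proof -
  obtain f where f: "bij_betw f (verts G) (verts H)"
    and edge_iff: "\<And>u v. u \<in> verts G \<Longrightarrow> v \<in> verts G \<Longrightarrow> {u, v} \<in> edges G \<longleftrightarrow> {f u, f v} \<in> edges H"
    using assms unfolding graph_iso_def by blast
  let ?g = "inv_into (verts G) f"
  have g: "bij_betw ?g (verts H) (verts G)" using f by (rule bij_betw_inv_into)
  have "{u, v} \<in> edges H \<longleftrightarrow> {?g u, ?g v} \<in> edges G" if "u \<in> verts H" "v \<in> verts H" for u v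
  proof -
    have "?g u \<in> verts G" "?g v \<in> verts G" using g that by (auto simp: bij_betw_def)
    then show ?thesis using edge_iff[of "?g u" "?g v"] f that by (simp add: bij_betw_inv_into_right)
  qed
  then show ?thesis using g unfolding graph_iso_def by blast
qed

lemma graph_iso_trans:
  assumes "graph_iso G H" "graph_iso H K"
  shows "graph_iso G K"
proof -
  obtain f where f: "bij_betw f (verts G) (verts H)"
    and f_iff: "\<And>u v. u \<in> verts G \<Longrightarrow> v \<in> verts G \<Longrightarrow> {u, v} \<in> edges G \<longleftrightarrow> {f u, f v} \<in> edges H"
    using assms unfolding graph_iso_def by blast
  obtain g where g: "bij_betw g (verts H) (verts K)"
    and g_iff: "\<And>u v. u \<in> verts H \<Longrightarrow> v \<in> verts H \<Longrightarrow> {u, v} \<in> edges H \<longleftrightarrow> {g u, g v} \<in> edges K"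
    using assms unfolding graph_iso_def by blast
  have "bij_betw (g \<circ> f) (verts G) (verts K)" using f g by (rule bij_betw_trans)
  moreover have "{u, v} \<in> edges G \<longleftrightarrow> {(g \<circ> f) u, (g \<circ> f) v} \<in> edges K"
    if "u \<in> verts G" "v \<in> verts G" for u v
  proof -
    have "f u \<in> verts H" "f v \<in> verts H" using f that by (auto simp: bij_betw_def)
    then show ?thesis using f_iff[OF that] g_iff[of "f u" "f v"] by simp
  qed
  ultimately show ?thesis unfolding graph_iso_def by blast
qed

lemma graph_iso_card_verts: "graph_iso G H \<Longrightarrow> card (verts G) = card (verts H)"
  unfolding graph_iso_def using bij_betw_same_card by blast

lemma graph_iso_degE:
  assumes "graph_iso G H" and G: "simple_graph G" and H: "simple_graph H"
  obtains f where "bij_betw f (verts G) (verts H)"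
    "\<And>u v. u \<in> verts G \<Longrightarrow> v \<in> verts G \<Longrightarrow> {u, v} \<in> edges G \<longleftrightarrow> {f u, f v} \<in> edges H"
    "\<And>u. u \<in> verts G \<Longrightarrow> deg H (f u) = deg G u"
proof -
  obtain f where f: "bij_betw f (verts G) (verts H)"
    and edge_iff: "\<And>u v. u \<in> verts G \<Longrightarrow> v \<in> verts G \<Longrightarrow> {u, v} \<in> edges G \<longleftrightarrow> {f u, f v} \<in> edges H"
    using assms unfolding graph_iso_def by blast
  have deg_eq: "deg H (f u) = deg G u" if u: "u \<in> verts G" for u
  proof -
    have nbr_iff: "f w \<in> nbrs H (f u) \<longleftrightarrow> w \<in> nbrs G u" if "w \<in> verts G" for w
      using edge_iff[OF u that] by (simp add: nbrs_def)
    have "nbrs H (f u) \<subseteq> f ` verts G" using nbrs_subset_verts[OF H] f by (simp add: bij_betw_def)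
    then have "nbrs H (f u) = f ` nbrs G u"
      using nbr_iff nbrs_subset_verts[OF G, of u] by (force simp: subset_iff)
    moreover have "inj_on f (nbrs G u)"
      using bij_betw_imp_inj_on[OF f] nbrs_subset_verts[OF G] by (rule inj_on_subset)
    ultimately show ?thesis by (simp add: deg_def card_image)
  qed
  show thesis by (rule that[OF f]) (simp_all add: edge_iff deg_eq)
qed

lemma graph_iso_image:
  assumes "inj_on f (verts G)" "\<And>e. e \<in> edges G \<Longrightarrow> e \<subseteq> verts G"
  shows "graph_iso G (f ` verts G, (`) f ` edges G)"
  unfolding graph_iso_def
proof (intro exI[of _ f] conjI ballI)
  show "bij_betw f (verts G) (verts (f ` verts G, (`) f ` edges G))"
    using assms(1) by (simp add: bij_betw_def)
  fix u v assume uv: "u \<in> verts G" "v \<in> verts G"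
  show "{u, v} \<in> edges G \<longleftrightarrow> {f u, f v} \<in> edges (f ` verts G, (`) f ` edges G)"
  proof
    assume "{f u, f v} \<in> edges (f ` verts G, (`) f ` edges G)"
    then obtain e where e: "e \<in> edges G" "f ` {u, v} = f ` e" by auto
    then have "{u, v} = e" using inj_on_image_eq_iff[OF assms(1), of "{u, v}" e] assms(2)[OF e(1)] uv by auto
    then show "{u, v} \<in> edges G" using e by simp
  qed (auto simp: image_iff intro!: bexI[of _ "{u, v}"])
qed

text \<open>The image of a degree-saturated embedding is closed under taking neighbours.\<close>

lemma graph_iso_if_saturated_embedding:
  assumes G: "simple_graph G" "verts G \<noteq> {}" and H: "simple_graph H" "graph_connected H"
    and f: "inj_on f (verts G)" "f ` verts G \<subseteq> verts H" "\<And>e. e \<in> edges G \<Longrightarrow> f ` e \<in> edges H"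
    and deg_le: "\<And>u. u \<in> verts G \<Longrightarrow> deg H (f u) \<le> deg G u"
  shows "graph_iso G H"
proof -
  have nbrs_image: "nbrs H (f u) = f ` nbrs G u" if u: "u \<in> verts G" for u
  proof (rule nbrs_eqI[OF H(1)])
    show "f ` nbrs G u \<subseteq> nbrs H (f u)" using f(3) by (force simp: nbrs_def)
    have "inj_on f (nbrs G u)" using f(1) nbrs_subset_verts[OF G(1)] by (rule inj_on_subset)
    then show "deg H (f u) \<le> card (f ` nbrs G u)" using deg_le[OF u] by (simp add: deg_def card_image)
  qed
  have "f ` verts G = verts H"
  proof (rule graph_connectedD[OF H(2)])
    fix v assume "v \<in> f ` verts G"
    then show "nbrs H v \<subseteq> f ` verts G" using nbrs_image nbrs_subset_verts[OF G(1)] by blast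
  qed (use G f in auto)
  then have "bij_betw f (verts G) (verts H)" using f(1) by (simp add: bij_betw_def)
  moreover have "{u, v} \<in> edges G \<longleftrightarrow> {f u, f v} \<in> edges H" if "u \<in> verts G" "v \<in> verts G" for u v
  proof -
    have "f v \<in> f ` nbrs G u \<longleftrightarrow> v \<in> nbrs G u"
      using inj_on_image_mem_iff[OF f(1) that(2) nbrs_subset_verts[OF G(1)]] .
    then show ?thesis using nbrs_image[OF that(1)] by (auto simp: nbrs_def)
  qed
  ultimately show ?thesis unfolding graph_iso_def by blast
qed

lemma graph_iso_laplacian_spectrum:
  assumes iso: "graph_iso G H" and G: "simple_graph G" and H: "simple_graph H"
  shows "laplacian_spectrum G = laplacian_spectrum H"
proof -
  obtain f where f: "bij_betw f (verts G) (verts H)"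
    and edge_iff: "\<And>u v. u \<in> verts G \<Longrightarrow> v \<in> verts G \<Longrightarrow> {u, v} \<in> edges G \<longleftrightarrow> {f u, f v} \<in> edges H"
    and deg_eq: "\<And>u. u \<in> verts G \<Longrightarrow> deg H (f u) = deg G u"
    using graph_iso_degE[OF iso G H] by blast
  obtain vs where vs: "distinct vs" "set vs = verts G"
    using finite_distinct_list[OF finite_verts[OF G]] by blast
  have ws: "distinct (map f vs)" "set (map f vs) = verts H"
    using vs f by (auto simp: distinct_map bij_betw_def)
  have "laplacian_mat G vs = laplacian_mat H (map f vs)"
  proof (rule eq_matI)
    fix i j assume "i < dim_row (laplacian_mat H (map f vs))" "j < dim_col (laplacian_mat H (map f vs))"
    then have ij: "i < length vs" "j < length vs"
      by (auto simp: laplacian_mat_def degree_mat_def adjacency_mat_def)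
    then have "vs ! i \<in> verts G" "vs ! j \<in> verts G" by (simp_all add: vs(2)[symmetric])
    then show "laplacian_mat G vs $$ (i, j) = laplacian_mat H (map f vs) $$ (i, j)"
      using ij edge_iff deg_eq
      by (simp add: laplacian_mat_def degree_mat_def adjacency_mat_def
          card_incident_edges[OF G] card_incident_edges[OF H])
  qed (auto simp: laplacian_mat_def degree_mat_def adjacency_mat_def)
  then show ?thesis using laplacian_spectrum_eq[OF vs] laplacian_spectrum_eq[OF ws] by simp
qed

section \<open>Traces of powers\<close>

definition mtrace :: "'a :: comm_ring_1 mat \<Rightarrow> 'a" where
  "mtrace A = (\<Sum>i<dim_row A. A $$ (i, i))"

lemma mtrace_mult_comm:
  assumes "A \<in> carrier_mat n m" "B \<in> carrier_mat m n"
  shows "mtrace (A * B) = mtrace (B * A)"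
proof -
  have "mtrace (A * B) = (\<Sum>i<n. \<Sum>j<m. A $$ (i, j) * B $$ (j, i))"
    using assms by (auto simp: mtrace_def scalar_prod_def lessThan_atLeast0 intro!: sum.cong)
  also have "\<dots> = (\<Sum>j<m. \<Sum>i<n. A $$ (i, j) * B $$ (j, i))"
    by (rule sum.swap)
  also have "\<dots> = mtrace (B * A)"
    using assms by (auto simp: mtrace_def scalar_prod_def lessThan_atLeast0 mult.commute intro!: sum.cong)
  finally show ?thesis .
qed

lemma mtrace_similar:
  assumes "similar_mat_wit A B P Q"
  shows "mtrace A = mtrace B"
proof -
  define n where "n = dim_row A"
  note wit = similar_mat_witD[OF n_def assms]
  have "mtrace A = mtrace (P * (B * Q))"
    using wit assoc_mult_mat[of P n n B n Q n] by simp
  also have "\<dots> = mtrace (B * Q * P)"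
    using wit by (intro mtrace_mult_comm[of _ n n]) auto
  also have "B * Q * P = B"
    using wit assoc_mult_mat[of B n n Q n P n] by simp
  finally show ?thesis .
qed

lemma upper_triangular_mult:
  fixes A B :: "'a :: semiring_0 mat"
  assumes A: "A \<in> carrier_mat n n" "upper_triangular A"
    and B: "B \<in> carrier_mat n n" "upper_triangular B"
  shows "upper_triangular (A * B)"
    and "i < n \<Longrightarrow> (A * B) $$ (i, i) = A $$ (i, i) * B $$ (i, i)"
proof -
  have entry: "(A * B) $$ (i, j) = (\<Sum>t<n. A $$ (i, t) * B $$ (t, j))" if "i < n" "j < n" for i j
    using that A B by (simp add: scalar_prod_def lessThan_atLeast0)
  have zero: "A $$ (i, t) * B $$ (t, j) = 0" if "i < n" "t < n" "t < i \<or> j < t" for i j t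
    using that A B by (auto simp: upper_triangular_def)
  show "upper_triangular (A * B)"
  proof (rule upper_triangularI)
    fix i j assume "j < i" "i < dim_row (A * B)"
    then have ij: "j < i" "i < n" "j < n" using A by auto
    then have "A $$ (i, t) * B $$ (t, j) = 0" if "t < n" for t
      using zero[OF ij(2) that, of j] by linarith
    then show "(A * B) $$ (i, j) = 0" unfolding entry[OF ij(2,3)] by (intro sum.neutral) auto
  qed
  assume i: "i < n"
  have "A $$ (i, t) * B $$ (t, i) = 0" if "t < n" "t \<noteq> i" for t
    using zero[OF i that(1), of i] that(2) by linarith
  then have "(A * B) $$ (i, i) = (\<Sum>t\<in>{i}. A $$ (i, t) * B $$ (t, i))"
    unfolding entry[OF i i] using i by (intro sum.mono_neutral_right) auto
  then show "(A * B) $$ (i, i) = A $$ (i, i) * B $$ (i, i)" by simp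
qed

lemma upper_triangular_pow:
  fixes A :: "'a :: comm_semiring_1 mat"
  assumes A: "A \<in> carrier_mat n n" "upper_triangular A"
  shows "upper_triangular (A ^\<^sub>m k)" "i < n \<Longrightarrow> (A ^\<^sub>m k) $$ (i, i) = A $$ (i, i) ^ k"
proof (induction k)
  case (Suc k)
  note pow = upper_triangular_mult[OF pow_carrier_mat[OF A(1)] Suc.IH(1) A]
  { case 1 show ?case using pow(1) by simp }
  { case 2 then show ?case using pow(2) Suc.IH(2) by (simp add: mult.commute) }
qed (use A in auto)

lemma mtrace_pow_eq_power_sum:
  fixes A :: "complex mat"
  assumes A: "A \<in> carrier_mat n n" and es: "char_poly A = (\<Prod>e\<leftarrow>es. [:- e, 1:])"
  shows "mtrace (A ^\<^sub>m k) = (\<Sum>e\<leftarrow>es. e ^ k)"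
proof -
  obtain B P Q where "schur_decomposition A es = (B, P, Q)" by (cases "schur_decomposition A es")
  from schur_decomposition[OF A es this]
  have sim: "similar_mat_wit A B P Q" and ut: "upper_triangular B" and diag: "diag_mat B = es" by auto
  have B: "B \<in> carrier_mat n n" using similar_mat_witD2[OF A sim] by simp
  have "mtrace (A ^\<^sub>m k) = mtrace (B ^\<^sub>m k)"
    by (rule mtrace_similar[OF similar_mat_wit_pow[OF sim]])
  also have "\<dots> = (\<Sum>i<n. B $$ (i, i) ^ k)"
    using upper_triangular_pow(2)[OF B ut] B by (simp add: mtrace_def)
  also have "\<dots> = (\<Sum>e\<leftarrow>es. e ^ k)"
    using B unfolding diag[symmetric] diag_mat_def
    by (simp add: interv_sum_list_conv_sum_set_nat lessThan_atLeast0 comp_def)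
  finally show ?thesis .
qed

lemma mtrace_pow_cong:
  fixes A B :: "complex mat"
  assumes A: "A \<in> carrier_mat n n" and B: "B \<in> carrier_mat m m" and "char_poly A = char_poly B"
  shows "mtrace (A ^\<^sub>m k) = mtrace (B ^\<^sub>m k)"
proof -
  obtain es where es: "char_poly A = (\<Prod>e\<leftarrow>es. [:- e, 1:])"
    using char_poly_factorized[OF A] by blast
  then have "char_poly B = (\<Prod>e\<leftarrow>es. [:- e, 1:])" using assms(3) by simp
  then show ?thesis using mtrace_pow_eq_power_sum[OF A es] mtrace_pow_eq_power_sum[OF B] by simp
qed

lemma proots_eq_imp_char_poly_eq:
  fixes A B :: "complex mat"
  assumes "A \<in> carrier_mat n n" "B \<in> carrier_mat m m" "proots (char_poly A) = proots (char_poly B)"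
  shows "char_poly A = char_poly B"
proof -
  have split: "char_poly M = (\<Prod>x\<in>#proots (char_poly M). [:- x, 1:])"
    if M: "M \<in> carrier_mat k k" for M :: "complex mat" and k
  proof -
    have monic: "lead_coeff (char_poly M) = 1" using degree_monic_char_poly[OF M] by simp
    then have "char_poly M \<noteq> 0" by auto
    from alg_closed_imp_factorization[OF this]
    obtain R where "char_poly M = (\<Prod>x\<in>#R. [:- x, 1:])" by (auto simp: monic)
    moreover have "proots (\<Prod>x\<in>#R. [:- x, 1:]) = R"
      using proots_prod_mset[of "image_mset (\<lambda>x. [:- x, 1:]) R"]
      by (auto simp: image_iff multiset.map_comp comp_def)
    ultimately show ?thesis by simp
  qed
  show ?thesis using split[OF assms(1)] split[OF assms(2)] assms(3) by simp
qed

section \<open>The Laplacian as a function on pairs of vertices\<close>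

definition lap :: "'a ugraph \<Rightarrow> 'a \<Rightarrow> 'a \<Rightarrow> int" where
  "lap G u w = (if u = w then int (deg G u) else 0) - (if w \<in> nbrs G u then 1 else 0)"

primrec lap_pow :: "'a ugraph \<Rightarrow> nat \<Rightarrow> 'a \<Rightarrow> 'a \<Rightarrow> int" where
  "lap_pow G 0 u w = (if u = w then 1 else 0)"
| "lap_pow G (Suc k) u w = (\<Sum>z\<in>verts G. lap_pow G k u z * lap G z w)"

definition lap_moment :: "'a ugraph \<Rightarrow> nat \<Rightarrow> int" where
  "lap_moment G k = (\<Sum>u\<in>verts G. lap_pow G k u u)"

definition mat_on :: "'a list \<Rightarrow> ('a \<Rightarrow> 'a \<Rightarrow> int) \<Rightarrow> 'r :: comm_ring_1 mat" where
  "mat_on vs f = mat (length vs) (length vs) (\<lambda>(i, j). of_int (f (vs ! i) (vs ! j)))"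

lemma mat_on_carrier [simp]: "mat_on vs f \<in> carrier_mat (length vs) (length vs)"
  "dim_row (mat_on vs f) = length vs" "dim_col (mat_on vs f) = length vs"
  by (auto simp: mat_on_def)

lemma mat_on_cong:
  assumes "\<And>u w. u \<in> set vs \<Longrightarrow> w \<in> set vs \<Longrightarrow> f u w = g u w"
  shows "mat_on vs f = mat_on vs g"
  using assms by (intro eq_matI) (auto simp: mat_on_def)

lemma sum_nth_distinct:
  assumes "distinct vs"
  shows "(\<Sum>i<length vs. f (vs ! i)) = (\<Sum>v\<in>set vs. f v)"
  using assms sum.distinct_set_conv_list[of vs f]
  by (simp add: sum_list_sum_nth lessThan_atLeast0)

lemma mat_on_mult:
  assumes "distinct vs"
  shows "mat_on vs f * mat_on vs g = mat_on vs (\<lambda>u w. \<Sum>z\<in>set vs. f u z * g z w)"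
  by (rule eq_matI)
    (auto simp: mat_on_def scalar_prod_def lessThan_atLeast0[symmetric]
      sum_nth_distinct[OF assms, symmetric])

lemma mat_on_Kronecker:
  assumes "distinct vs"
  shows "mat_on vs (\<lambda>u w. if u = w then d else 0) = of_int d \<cdot>\<^sub>m 1\<^sub>m (length vs)"
  using assms by (intro eq_matI) (auto simp: mat_on_def nth_eq_iff_index_eq)

lemma mtrace_mat_on:
  assumes "distinct vs"
  shows "mtrace (mat_on vs f) = of_int (\<Sum>u\<in>set vs. f u u)"
  by (simp add: mtrace_def mat_on_def sum_nth_distinct[OF assms, symmetric])

lemma mat_on_lap_pow:
  assumes "distinct vs" "set vs = verts G"
  shows "mat_on vs (lap G) ^\<^sub>m k = mat_on vs (lap_pow G k)"
proof (induction k)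
  case 0
  show ?case using assms(1) by (intro eq_matI) (auto simp: mat_on_def nth_eq_iff_index_eq)
next
  case (Suc k)
  then show ?case using assms by (simp add: mat_on_mult)
qed

lemma det_mat_on_of_int: "det (mat_on vs f :: 'r :: comm_ring_1 mat) = of_int (det (mat_on vs f :: int mat))"
proof -
  have "mat_on vs f = map_mat (of_int :: int \<Rightarrow> 'r) (mat_on vs f)"
    by (intro eq_matI) (auto simp: mat_on_def)
  then show ?thesis by (metis of_int_hom.hom_det)
qed

lemma laplacian_mat_eq_mat_on:
  assumes "simple_graph G" "distinct vs"
  shows "laplacian_mat G vs = mat_on vs (lap G)"
  using assms(2) card_incident_edges[OF assms(1)]
  by (intro eq_matI)
    (auto simp: laplacian_mat_def degree_mat_def adjacency_mat_def mat_on_def lap_def nbrs_def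
      nth_eq_iff_index_eq)

definition cospectral :: "'a ugraph \<Rightarrow> 'b ugraph \<Rightarrow> bool" where
  "cospectral G H \<longleftrightarrow> simple_graph G \<and> simple_graph H \<and> laplacian_spectrum G = laplacian_spectrum H"

lemma cospectral_char_poly_eq:
  assumes "cospectral G H"
    and vs: "distinct vs" "set vs = verts G" and ws: "distinct ws" "set ws = verts H"
  shows "char_poly (mat_on vs (lap G) :: complex mat) = char_poly (mat_on ws (lap H))"
    and "length vs = length ws"
proof -
  let ?A = "mat_on vs (lap G) :: complex mat" and ?B = "mat_on ws (lap H) :: complex mat"
  have G: "simple_graph G" and H: "simple_graph H" and spec: "laplacian_spectrum G = laplacian_spectrum H"
    using assms(1) by (auto simp: cospectral_def)
  have "proots (char_poly ?A) = proots (char_poly ?B)"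
    using spec unfolding laplacian_spectrum_eq[OF vs] laplacian_spectrum_eq[OF ws]
      laplacian_mat_eq_mat_on[OF G vs(1)] laplacian_mat_eq_mat_on[OF H ws(1)] .
  then show char_poly: "char_poly ?A = char_poly ?B"
    by (rule proots_eq_imp_char_poly_eq[rotated 2]) (rule mat_on_carrier)+
  show "length vs = length ws"
    using degree_monic_char_poly[of ?A "length vs"] degree_monic_char_poly[of ?B "length ws"]
    by (simp add: char_poly)
qed

lemma cospectral_enumerationsE:
  assumes "cospectral G H"
  obtains vs ws where "distinct vs" "set vs = verts G" "distinct ws" "set ws = verts H"
  using assms finite_distinct_list[OF finite_verts[of G]] finite_distinct_list[OF finite_verts[of H]]
  unfolding cospectral_def by blast

lemma cospectral_card_verts:
  assumes "cospectral G H"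
  shows "card (verts G) = card (verts H)"
  by (rule cospectral_enumerationsE[OF assms])
    (metis cospectral_char_poly_eq(2)[OF assms] distinct_card)

lemma cospectral_lap_moment:
  assumes cosp: "cospectral G H"
  shows "lap_moment G k = lap_moment H k"
proof -
  obtain vs ws where vs: "distinct vs" "set vs = verts G" and ws: "distinct ws" "set ws = verts H"
    using cospectral_enumerationsE[OF cosp] .
  have "mtrace (mat_on vs (lap G) ^\<^sub>m k) = mtrace (mat_on ws (lap H) ^\<^sub>m k :: complex mat)"
    using mtrace_pow_cong[OF mat_on_carrier(1) mat_on_carrier(1) cospectral_char_poly_eq(1)[OF cosp vs ws]] .
  then show ?thesis
    unfolding mat_on_lap_pow[OF vs] mat_on_lap_pow[OF ws] mtrace_mat_on[OF vs(1)] mtrace_mat_on[OF ws(1)]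
      of_int_eq_iff lap_moment_def vs(2) ws(2) .
qed

lemma cospectral_if_intertwining:
  fixes p q :: "'a \<Rightarrow> 'a \<Rightarrow> int" and d :: int
  assumes G: "simple_graph G" and H: "simple_graph H" and "verts H = verts G" and d: "d \<noteq> 0"
    and intertwining: "\<And>u w. u \<in> verts G \<Longrightarrow> w \<in> verts G \<Longrightarrow>
      (\<Sum>z\<in>verts G. lap G u z * p z w) = (\<Sum>z\<in>verts G. p u z * lap H z w)"
    and inverse: "\<And>u w. u \<in> verts G \<Longrightarrow> w \<in> verts G \<Longrightarrow>
      (\<Sum>z\<in>verts G. p u z * q z w) = (if u = w then d else 0)"
  shows "cospectral G H"
proof -
  obtain vs where vs: "distinct vs" "set vs = verts G"
    using finite_distinct_list[OF finite_verts[OF G]] by blast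
  let ?n = "length vs" and ?A = "mat_on vs (lap G) :: complex mat" and ?B = "mat_on vs (lap H) :: complex mat"
  define P :: "complex mat" where "P = mat_on vs p"
  define Q :: "complex mat" where "Q = (1 / of_int d) \<cdot>\<^sub>m mat_on vs q"
  have carrier: "?A \<in> carrier_mat ?n ?n" "?B \<in> carrier_mat ?n ?n" "P \<in> carrier_mat ?n ?n" "Q \<in> carrier_mat ?n ?n"
    by (auto simp: P_def Q_def)
  have AP: "?A * P = P * ?B"
    unfolding P_def mat_on_mult[OF vs(1)] vs(2) by (intro mat_on_cong) (simp only: vs(2) intertwining)
  have "P * mat_on vs q = mat_on vs (\<lambda>u w. if u = w then d else 0)"
    unfolding P_def mat_on_mult[OF vs(1)] vs(2) by (intro mat_on_cong) (simp only: vs(2) inverse)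
  then have PQ: "P * Q = 1\<^sub>m ?n"
    unfolding Q_def mat_on_Kronecker[OF vs(1)] using d carrier(3)
    by (subst mult_smult_distrib[of _ ?n ?n _ ?n]) (auto intro!: eq_matI)
  have QP: "Q * P = 1\<^sub>m ?n" by (rule mat_mult_left_right_inverse[OF carrier(3,4) PQ])
  have "?A = ?A * (P * Q)" using PQ carrier(1) by simp
  also have "\<dots> = P * ?B * Q" unfolding AP[symmetric] by (rule assoc_mult_mat[OF carrier(1,3,4), symmetric])
  finally have conj: "?A = P * ?B * Q" .
  have "similar_mat ?A ?B" by (rule similar_matI[OF _ PQ QP conj]) (simp add: carrier)
  then have "char_poly ?A = char_poly ?B" by (rule char_poly_similar)
  then show ?thesis
    using G H vs laplacian_spectrum_eq[of vs G] laplacian_spectrum_eq[of vs H] assms(3)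
      laplacian_mat_eq_mat_on[OF G vs(1)] laplacian_mat_eq_mat_on[OF H vs(1)]
    by (simp add: cospectral_def)
qed

lemma lap_commute: "lap G u w = lap G w u"
  by (auto simp: lap_def nbrs_commute)

lemma sum_lap_mult:
  fixes f :: "'a \<Rightarrow> 'r :: comm_ring_1"
  assumes "simple_graph G" "u \<in> verts G"
  shows "(\<Sum>w\<in>verts G. of_int (lap G u w) * f w) = of_nat (deg G u) * f u - (\<Sum>w\<in>nbrs G u. f w)"
proof -
  have "(\<Sum>w\<in>verts G. of_int (lap G u w) * f w)
    = (\<Sum>w\<in>verts G. (if w = u then of_nat (deg G u) * f w else 0) - (if w \<in> nbrs G u then f w else 0))"
    by (intro sum.cong) (auto simp: lap_def algebra_simps)
  then show ?thesis
    using assms finite_verts[OF assms(1)] nbrs_subset_verts[OF assms(1), of u]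
    by (simp add: sum_subtractf sum.If_cases Int_absorb1)
qed

lemma sum_lap:
  assumes "simple_graph G" "u \<in> verts G"
  shows "(\<Sum>w\<in>verts G. lap G u w) = 0"
  using sum_lap_mult[OF assms, of "\<lambda>_. 1 :: int"] by (simp add: deg_def)

lemma lap_pow_1: "simple_graph G \<Longrightarrow> u \<in> verts G \<Longrightarrow> lap_pow G 1 u w = lap G u w"
  using finite_verts[of G] by (simp add: if_distrib[of "\<lambda>x. x * _"] cong: if_cong)

lemma lap_pow_add:
  assumes "simple_graph G" "w \<in> verts G"
  shows "lap_pow G (i + j) u w = (\<Sum>z\<in>verts G. lap_pow G i u z * lap_pow G j z w)"
  using assms(2)
proof (induction j arbitrary: w)
  case 0
  then show ?case using finite_verts[OF assms(1)] by (simp add: if_distrib[of "\<lambda>x. _ * x"] cong: if_cong)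
next
  case (Suc j)
  have "lap_pow G (i + Suc j) u w = (\<Sum>y\<in>verts G. \<Sum>z\<in>verts G. lap_pow G i u z * lap_pow G j z y * lap G y w)"
    using Suc.IH by (simp add: sum_distrib_right)
  also have "\<dots> = (\<Sum>z\<in>verts G. lap_pow G i u z * lap_pow G (Suc j) z w)"
    by (subst sum.swap) (simp add: sum_distrib_left mult.assoc)
  finally show ?case .
qed

definition codeg :: "'a ugraph \<Rightarrow> 'a \<Rightarrow> 'a \<Rightarrow> nat" where
  "codeg G u w = card (nbrs G u \<inter> nbrs G w)"

lemma codeg_commute: "codeg G u w = codeg G w u"
  by (simp add: codeg_def Int_commute)

lemma codeg_self: "codeg G u u = deg G u"
  by (simp add: codeg_def deg_def)

lemma lap_pow_2:
  assumes G: "simple_graph G" and u: "u \<in> verts G"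
  shows "lap_pow G 2 u w = int (codeg G u w) + (if u = w then int (deg G u) ^ 2 else 0)
    - (if w \<in> nbrs G u then int (deg G u) + int (deg G w) else 0)"
proof -
  have sum_nbrs: "(\<Sum>z\<in>nbrs G u. lap G z w) = (if w \<in> nbrs G u then int (deg G w) else 0) - int (codeg G u w)"
    using finite_nbrs[OF G, of u]
    by (simp add: lap_def sum_subtractf sum.If_cases codeg_def Int_def nbrs_commute[of w])
  have "lap_pow G 2 u w = (\<Sum>z\<in>verts G. lap_pow G 1 u z * lap G z w)" by (simp add: numeral_2_eq_2)
  also have "\<dots> = (\<Sum>z\<in>verts G. of_int (lap G u z) * lap G z w)" using lap_pow_1[OF G u] by simp
  also have "\<dots> = int (deg G u) * lap G u w - (\<Sum>z\<in>nbrs G u. lap G z w)"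
    unfolding sum_lap_mult[OF G u] by simp
  finally show ?thesis unfolding sum_nbrs by (auto simp: lap_def power2_eq_square algebra_simps split: if_splits)
qed

lemma sum_nbrs_swap:
  fixes f :: "'a \<Rightarrow> 'a \<Rightarrow> 'r :: comm_monoid_add"
  assumes "simple_graph G"
  shows "(\<Sum>u\<in>verts G. \<Sum>w\<in>nbrs G u. f u w) = (\<Sum>w\<in>verts G. \<Sum>u\<in>nbrs G w. f u w)"
proof -
  have restrict: "(\<Sum>w\<in>nbrs G u. g w) = (\<Sum>w\<in>verts G. if w \<in> nbrs G u then g w else 0)" for u and g :: "'a \<Rightarrow> 'r"
    using finite_verts[OF assms] nbrs_subset_verts[OF assms, of u] by (simp add: sum.If_cases Int_absorb1)
  show ?thesis unfolding restrict by (subst sum.swap) (simp add: nbrs_commute)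
qed

lemma sum_nbrs_snd:
  fixes f :: "'a \<Rightarrow> int"
  assumes "simple_graph G"
  shows "(\<Sum>u\<in>verts G. \<Sum>w\<in>nbrs G u. f w) = (\<Sum>u\<in>verts G. int (deg G u) * f u)"
  by (subst sum_nbrs_swap[OF assms]) (simp add: deg_def)

lemma sum_codeg:
  assumes G: "simple_graph G"
  shows "(\<Sum>u\<in>verts G. \<Sum>w\<in>verts G. int (codeg G u w)) = (\<Sum>u\<in>verts G. int (deg G u) ^ 2)"
proof -
  have "(\<Sum>w\<in>verts G. int (codeg G u w)) = (\<Sum>z\<in>nbrs G u. int (deg G z))" for u
  proof -
    have "(\<Sum>w\<in>verts G. int (codeg G u w)) = (\<Sum>w\<in>verts G. \<Sum>z\<in>nbrs G u. if w \<in> nbrs G z then 1 else 0)"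
      using finite_nbrs[OF G, of u] by (simp add: codeg_def sum.If_cases Int_def nbrs_commute)
    also have "\<dots> = (\<Sum>z\<in>nbrs G u. \<Sum>w\<in>verts G. if w \<in> nbrs G z then 1 else 0)" by (rule sum.swap)
    finally show ?thesis
      using finite_verts[OF G] nbrs_subset_verts[OF G] by (simp add: sum.If_cases deg_def Int_absorb1)
  qed
  then show ?thesis by (simp add: sum_nbrs_snd[OF G] power2_eq_square)
qed

section \<open>Triangles and 4-cycles\<close>

text \<open>Ordered tuples: each triangle is counted 6 times and each 4-cycle 8 times.\<close>

definition triangles :: "'a ugraph \<Rightarrow> ('a \<times> 'a \<times> 'a) set" where
  "triangles G = {(u, w, z). w \<in> nbrs G u \<and> z \<in> nbrs G u \<and> z \<in> nbrs G w}"

definition four_cycles :: "'a ugraph \<Rightarrow> ('a \<times> 'a \<times> 'a \<times> 'a) set" where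
  "four_cycles G = {(u, x, w, y). u \<noteq> w \<and> x \<noteq> y \<and>
     x \<in> nbrs G u \<and> x \<in> nbrs G w \<and> y \<in> nbrs G u \<and> y \<in> nbrs G w}"

lemma triangles_eq_Sigma:
  assumes "simple_graph G"
  shows "triangles G = Sigma (verts G) (\<lambda>u. Sigma (nbrs G u) (\<lambda>w. nbrs G u \<inter> nbrs G w))"
  using in_verts_if_nbr[OF assms] by (auto simp: triangles_def)

lemma finite_triangles: "simple_graph G \<Longrightarrow> finite (triangles G)"
  by (simp add: triangles_eq_Sigma finite_verts finite_nbrs finite_SigmaI)

lemma sum_triangles:
  fixes f :: "'a \<Rightarrow> 'a \<Rightarrow> int"
  assumes G: "simple_graph G"
  shows "(\<Sum>(u, w, z)\<in>triangles G. f u w) = (\<Sum>u\<in>verts G. \<Sum>w\<in>nbrs G u. int (codeg G u w) * f u w)"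
proof -
  have "(\<Sum>(u, w, z)\<in>triangles G. f u w)
    = (\<Sum>u\<in>verts G. \<Sum>(w, z)\<in>Sigma (nbrs G u) (\<lambda>w. nbrs G u \<inter> nbrs G w). f u w)"
    unfolding triangles_eq_Sigma[OF G] using finite_verts[OF G] finite_nbrs[OF G] by (subst sum.Sigma) auto
  also have "\<dots> = (\<Sum>u\<in>verts G. \<Sum>w\<in>nbrs G u. \<Sum>z\<in>nbrs G u \<inter> nbrs G w. f u w)"
    using finite_nbrs[OF G] by (intro sum.cong[OF refl] sum.Sigma[symmetric]) auto
  finally show ?thesis by (simp add: codeg_def)
qed

lemma card_four_cycles:
  assumes G: "simple_graph G"
  shows "int (card (four_cycles G)) =
    (\<Sum>u\<in>verts G. \<Sum>w\<in>verts G - {u}. int (codeg G u w) * (int (codeg G u w) - 1))"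
proof -
  define D where "D u w = Sigma (nbrs G u \<inter> nbrs G w) (\<lambda>x. nbrs G u \<inter> nbrs G w - {x})" for u w
  have fin_D: "finite (D u w)" for u w unfolding D_def using finite_nbrs[OF G] by blast
  have card_D: "int (card (D u w)) = int (codeg G u w) * (int (codeg G u w) - 1)" for u w
  proof -
    let ?N = "nbrs G u \<inter> nbrs G w"
    have fin: "finite ?N" using finite_nbrs[OF G] by blast
    have "int (card (?N - {x})) = int (card ?N) - 1" if "x \<in> ?N" for x
      using card.remove[OF fin that] by simp
    then show ?thesis unfolding D_def codeg_def using fin by auto
  qed
  have "bij_betw (\<lambda>(u, x, w, y). (u, w, x, y)) (four_cycles G)
      (Sigma (verts G) (\<lambda>u. Sigma (verts G - {u}) (D u)))"
    by (rule bij_betwI[where g = "\<lambda>(u, w, x, y). (u, x, w, y)"])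
      (use in_verts_if_nbr[OF G] in \<open>auto simp: four_cycles_def D_def\<close>)
  from bij_betw_same_card[OF this]
  have "card (four_cycles G) = (\<Sum>u\<in>verts G. \<Sum>w\<in>verts G - {u}. card (D u w))"
    using finite_verts[OF G] fin_D by (simp add: card_SigmaI)
  then show ?thesis by (simp add: card_D)
qed

section \<open>Laplacian moments\<close>

lemma lap_moment_1:
  assumes "simple_graph G"
  shows "lap_moment G 1 = (\<Sum>u\<in>verts G. int (deg G u))"
  using lap_pow_1[OF assms] not_self_nbr[OF assms] unfolding lap_moment_def by (simp only: lap_def) simp

lemma lap_moment_2:
  assumes "simple_graph G"
  shows "lap_moment G 2 = (\<Sum>u\<in>verts G. int (deg G u) ^ 2 + int (deg G u))"
  unfolding lap_moment_def
  using not_self_nbr[OF assms] by (intro sum.cong) (simp_all add: lap_pow_2[OF assms] codeg_self)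

lemma lap_moment_3:
  assumes G: "simple_graph G"
  shows "lap_moment G 3 =
    (\<Sum>u\<in>verts G. int (deg G u) ^ 3 + 3 * int (deg G u) ^ 2) - int (card (triangles G))"
proof -
  let ?d = "\<lambda>u. int (deg G u)"
  have "lap_pow G 3 u u = ?d u ^ 3 + 2 * ?d u ^ 2 + (\<Sum>w\<in>nbrs G u. ?d w) - (\<Sum>w\<in>nbrs G u. int (codeg G u w))"
    if u: "u \<in> verts G" for u
  proof -
    have "lap_pow G 3 u u = (\<Sum>w\<in>verts G. of_int (lap G u w) * lap_pow G 2 u w)"
      by (simp add: eval_nat_numeral lap_commute mult.commute)
    also have "\<dots> = ?d u * lap_pow G 2 u u - (\<Sum>w\<in>nbrs G u. lap_pow G 2 u w)"
      unfolding sum_lap_mult[OF G u] by simp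
    also have "(\<Sum>w\<in>nbrs G u. lap_pow G 2 u w) = (\<Sum>w\<in>nbrs G u. int (codeg G u w) - (?d u + ?d w))"
      using not_self_nbr[OF G, of u] by (intro sum.cong) (auto simp: lap_pow_2[OF G u])
    finally show ?thesis
      using not_self_nbr[OF G, of u]
      by (simp add: lap_pow_2[OF G u] codeg_self sum_subtractf sum.distrib power2_eq_square power3_eq_cube
          algebra_simps deg_def)
  qed
  then have "lap_moment G 3 = (\<Sum>u\<in>verts G. ?d u ^ 3 + 2 * ?d u ^ 2)
    + (\<Sum>u\<in>verts G. \<Sum>w\<in>nbrs G u. ?d w) - (\<Sum>u\<in>verts G. \<Sum>w\<in>nbrs G u. int (codeg G u w))"
    by (simp add: lap_moment_def sum.distrib sum_subtractf)
  then show ?thesis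
    using sum_triangles[OF G, of "\<lambda>_ _. 1"]
    by (simp add: sum_nbrs_snd[OF G] sum.distrib power2_eq_square case_prod_beta sum_distrib_left[symmetric])
qed

definition deviation_form :: "'a ugraph \<Rightarrow> int" where
  "deviation_form G = (\<Sum>u\<in>verts G. \<Sum>w\<in>nbrs G u. (int (deg G u) - 2) * (int (deg G w) - 2))"

lemma sum_nbrs_deg_add_squared:
  assumes G: "simple_graph G"
  shows "(\<Sum>u\<in>verts G. \<Sum>w\<in>nbrs G u. (int (deg G u) + int (deg G w)) ^ 2) =
    (\<Sum>u\<in>verts G. 2 * int (deg G u) ^ 3 + 8 * int (deg G u) ^ 2 - 8 * int (deg G u)) + 2 * deviation_form G"
proof -
  let ?d = "\<lambda>u. int (deg G u)"
  have "(\<Sum>u\<in>verts G. \<Sum>w\<in>nbrs G u. (?d u + ?d w) ^ 2) = (\<Sum>u\<in>verts G. \<Sum>w\<in>nbrs G u.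
      (?d u ^ 2 + 4 * ?d u - 8) + (?d w ^ 2 + 4 * ?d w) + 2 * ((?d u - 2) * (?d w - 2)))"
    by (intro sum.cong refl) (simp add: power2_eq_square algebra_simps)
  also have "\<dots> = (\<Sum>u\<in>verts G. ?d u * (?d u ^ 2 + 4 * ?d u - 8))
      + (\<Sum>u\<in>verts G. ?d u * (?d u ^ 2 + 4 * ?d u)) + 2 * deviation_form G"
    unfolding deviation_form_def sum_distrib_left sum_nbrs_snd[OF G, of "\<lambda>w. ?d w ^ 2 + 4 * ?d w", symmetric]
    by (simp add: sum.distrib deg_def)
  also have "(\<Sum>u\<in>verts G. ?d u * (?d u ^ 2 + 4 * ?d u - 8)) + (\<Sum>u\<in>verts G. ?d u * (?d u ^ 2 + 4 * ?d u))
    = (\<Sum>u\<in>verts G. 2 * ?d u ^ 3 + 8 * ?d u ^ 2 - 8 * ?d u)"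
    unfolding sum.distrib[symmetric]
    by (intro sum.cong refl) (simp add: power2_eq_square power3_eq_cube algebra_simps)
  finally show ?thesis .
qed

lemma sum_lap_pow_2_squared:
  assumes G: "simple_graph G" and u: "u \<in> verts G"
  shows "(\<Sum>w\<in>verts G. lap_pow G 2 u w ^ 2) = int (deg G u) ^ 4 + 2 * int (deg G u) ^ 3
    + int (deg G u) ^ 2 - int (deg G u) + (\<Sum>w\<in>verts G. int (codeg G u w))
    + (\<Sum>w\<in>verts G - {u}. int (codeg G u w) * (int (codeg G u w) - 1))
    - 2 * (\<Sum>w\<in>nbrs G u. int (codeg G u w) * (int (deg G u) + int (deg G w)))
    + (\<Sum>w\<in>nbrs G u. (int (deg G u) + int (deg G w)) ^ 2)"
proof -
  let ?d = "\<lambda>u. int (deg G u)" and ?c = "\<lambda>w. int (codeg G u w)"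
  let ?g = "\<lambda>w. (?d u + ?d w) ^ 2 - 2 * (?c w * (?d u + ?d w))"
  have "lap_pow G 2 u w ^ 2 = ?c w * (?c w - 1) + ?c w + (if w = u then ?d u ^ 4 + 2 * ?d u ^ 3 else 0)
    + (if w \<in> nbrs G u then ?g w else 0)" for w
    using not_self_nbr[OF G, of u]
    by (auto simp: lap_pow_2[OF G u] codeg_self power2_eq_square power3_eq_cube power4_eq_xxxx algebra_simps)
  then have "(\<Sum>w\<in>verts G. lap_pow G 2 u w ^ 2) = (\<Sum>w\<in>verts G. ?c w * (?c w - 1)) + (\<Sum>w\<in>verts G. ?c w)
    + (\<Sum>w\<in>verts G. if w = u then ?d u ^ 4 + 2 * ?d u ^ 3 else 0) + (\<Sum>w\<in>verts G. if w \<in> nbrs G u then ?g w else 0)"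
    by (simp only: sum.distrib)
  also have "(\<Sum>w\<in>verts G. if w = u then ?d u ^ 4 + 2 * ?d u ^ 3 else 0) = ?d u ^ 4 + 2 * ?d u ^ 3"
    using finite_verts[OF G] u by simp
  also have "(\<Sum>w\<in>verts G. if w \<in> nbrs G u then ?g w else 0) = (\<Sum>w\<in>nbrs G u. ?g w)"
    using finite_verts[OF G] nbrs_subset_verts[OF G, of u] by (simp add: sum.If_cases Int_absorb1)
  also have "(\<Sum>w\<in>verts G. ?c w * (?c w - 1)) = ?d u * (?d u - 1) + (\<Sum>w\<in>verts G - {u}. ?c w * (?c w - 1))"
    using sum.remove[OF finite_verts[OF G] u, of "\<lambda>w. ?c w * (?c w - 1)"] by (simp add: codeg_self)
  finally show ?thesis
    by (simp add: sum_subtractf sum_distrib_left[symmetric] power2_eq_square algebra_simps)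
qed

lemma lap_moment_4:
  assumes G: "simple_graph G"
  shows "lap_moment G 4 =
    (\<Sum>u\<in>verts G. int (deg G u) ^ 4 + 4 * int (deg G u) ^ 3 + 10 * int (deg G u) ^ 2 - 9 * int (deg G u))
    + int (card (four_cycles G)) - 2 * (\<Sum>(u, w, z)\<in>triangles G. int (deg G u) + int (deg G w))
    + 2 * deviation_form G"
proof -
  have "lap_pow G 4 u u = (\<Sum>w\<in>verts G. lap_pow G 2 u w ^ 2)" if u: "u \<in> verts G" for u
  proof -
    have "lap_pow G 4 u u = (\<Sum>w\<in>verts G. lap_pow G 2 u w * lap_pow G 2 w u)"
      using lap_pow_add[OF G u, of 2 2] by simp
    moreover have "lap_pow G 2 w u = lap_pow G 2 u w" if "w \<in> verts G" for w
      using lap_pow_2[OF G u] lap_pow_2[OF G that] codeg_commute nbrs_commute by (smt (verit))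
    ultimately show ?thesis by (simp add: power2_eq_square)
  qed
  then have "lap_moment G 4 = (\<Sum>u\<in>verts G. \<Sum>w\<in>verts G. lap_pow G 2 u w ^ 2)"
    by (simp add: lap_moment_def)
  also have "\<dots> = (\<Sum>u\<in>verts G. int (deg G u) ^ 4 + 4 * int (deg G u) ^ 3 + 10 * int (deg G u) ^ 2 - 9 * int (deg G u))
    + int (card (four_cycles G)) - 2 * (\<Sum>(u, w, z)\<in>triangles G. int (deg G u) + int (deg G w))
    + 2 * deviation_form G"
    by (simp add: sum_lap_pow_2_squared[OF G] sum.distrib sum_subtractf sum_distrib_left[symmetric]
        sum_codeg[OF G] card_four_cycles[OF G] sum_triangles[OF G] sum_nbrs_deg_add_squared[OF G])
  finally show ?thesis .
qed

section \<open>The tree number\<close>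

lemma det_sum_rows_in_first:
  fixes A :: "'a :: comm_ring_1 mat"
  assumes A: "A \<in> carrier_mat n n"
  shows "det (mat n n (\<lambda>(i, j). if i = 0 then \<Sum>t<n. A $$ (t, j) else A $$ (i, j))) = det A" (is "det ?S = _")
proof -
  define R :: "'a mat" where "R = mat n n (\<lambda>(i, j). if i = 0 \<or> i = j then 1 else 0)"
  have R: "R \<in> carrier_mat n n" by (simp add: R_def)
  have "R * A = ?S"
  proof (rule eq_matI)
    fix i j assume "i < dim_row ?S" "j < dim_col ?S"
    then have ij: "i < n" "j < n" by auto
    then have "(R * A) $$ (i, j) = (\<Sum>t<n. (if i = 0 \<or> i = t then 1 else 0) * A $$ (t, j))"
      using A by (simp add: R_def scalar_prod_def lessThan_atLeast0)
    also have "\<dots> = ?S $$ (i, j)"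
      using ij by (auto simp: if_distrib[of "\<lambda>x. x * _"] cong: if_cong)
    finally show "(R * A) $$ (i, j) = ?S $$ (i, j)" .
  qed (use A R in auto)
  moreover have "det R = 1"
    using det_upper_triangular[OF _ R]
    by (auto simp: upper_triangular_def R_def diag_mat_def intro!: prod_list_neutral)
  ultimately show ?thesis using det_mult[OF R A] by simp
qed

lemma det_sum_cols_in_first:
  fixes A :: "'a :: comm_ring_1 mat"
  assumes A: "A \<in> carrier_mat n n"
  shows "det (mat n n (\<lambda>(i, j). if j = 0 then \<Sum>t<n. A $$ (i, t) else A $$ (i, j))) = det A" (is "det ?S = _")
proof -
  have "transpose_mat ?S = mat n n (\<lambda>(i, j). if i = 0 then \<Sum>t<n. A\<^sup>T $$ (t, j) else A\<^sup>T $$ (i, j))"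
    using A by (intro eq_matI) auto
  then show ?thesis
    using det_sum_rows_in_first[of "A\<^sup>T" n] det_transpose[of ?S n] det_transpose[OF A] A by simp
qed

text \<open>The rows of \<open>X - A\<close> sum to the row \<open>X, \<dots>, X\<close>.\<close>

lemma char_poly_zero_col_sums:
  fixes A :: "'a :: comm_ring_1 mat"
  assumes A: "A \<in> carrier_mat n n" and n: "0 < n" and col: "\<And>j. j < n \<Longrightarrow> (\<Sum>i<n. A $$ (i, j)) = 0"
  shows "char_poly A = [:0, 1:] * det (mat n n (\<lambda>(i, j). if i = 0 then 1 else char_poly_matrix A $$ (i, j)))"
    (is "_ = _ * det ?M")
proof -
  let ?X = "[:0, 1:] :: 'a poly" and ?CP = "char_poly_matrix A"
  have CP: "?CP \<in> carrier_mat n n" using A by simp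
  have "(\<Sum>i<n. ?CP $$ (i, j)) = ?X" if j: "j < n" for j
  proof -
    have "(\<Sum>i<n. ?CP $$ (i, j)) = (\<Sum>i<n. (if i = j then ?X else 0) - [:A $$ (i, j):])"
      using A j by (intro sum.cong) (auto simp: char_poly_matrix_def)
    also have "\<dots> = ?X - [:\<Sum>i<n. A $$ (i, j):]"
      using j by (simp add: sum_subtractf sum_to_poly)
    finally show ?thesis using col[OF j] by simp
  qed
  then have "mat n n (\<lambda>(i, j). if i = 0 then \<Sum>t<n. ?CP $$ (t, j) else ?CP $$ (i, j)) = multrow 0 ?X ?M"
    using CP by (intro eq_matI) auto
  then show ?thesis
    using det_sum_rows_in_first[OF CP] det_multrow[OF n, of ?M ?X] by (simp add: char_poly_def)
qed

lemma coeff_1_char_poly_zero_sums: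
  fixes A :: "'a :: idom mat"
  assumes A: "A \<in> carrier_mat (Suc m) (Suc m)"
    and row: "\<And>i. i < Suc m \<Longrightarrow> (\<Sum>j<Suc m. A $$ (i, j)) = 0"
    and col: "\<And>j. j < Suc m \<Longrightarrow> (\<Sum>i<Suc m. A $$ (i, j)) = 0"
  shows "coeff (char_poly A) 1 = of_nat (Suc m) * (- 1) ^ m * det (mat_delete A 0 0)"
proof -
  let ?n = "Suc m"
  define M where "M = mat ?n ?n (\<lambda>(i, j). if i = 0 then 1 else char_poly_matrix A $$ (i, j))"
  define M0 where "M0 = mat ?n ?n (\<lambda>(i, j). if i = 0 then 1 else - A $$ (i, j))"
  define S where "S = mat ?n ?n (\<lambda>(i, j). if j = 0 then \<Sum>t<?n. M0 $$ (i, t) else M0 $$ (i, j))"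
  have carrier: "M \<in> carrier_mat ?n ?n" "M0 \<in> carrier_mat ?n ?n" "S \<in> carrier_mat ?n ?n"
    by (simp_all add: M_def M0_def S_def)
  have "coeff (char_poly A) 1 = poly (det M) 0"
    using char_poly_zero_col_sums[OF A _ col] by (simp add: M_def poly_0_coeff_0)
  also have "\<dots> = det M0"
    using A carrier by (intro poly_det_cong[of _ ?n]) (auto simp: M_def M0_def char_poly_matrix_def)
  also have "\<dots> = det S" unfolding S_def by (rule det_sum_cols_in_first[OF carrier(2), symmetric])
  also have "\<dots> = (\<Sum>i<?n. S $$ (i, 0) * cofactor S i 0)"
    by (rule laplace_expansion_column[OF carrier(3)]) simp
  also have "\<dots> = (\<Sum>i<?n. if i = 0 then of_nat ?n * cofactor S i 0 else 0)"
  proof (rule sum.cong[OF refl])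
    fix i assume i: "i \<in> {..<?n}"
    have "(\<Sum>t<?n. M0 $$ (i, t)) = (if i = 0 then of_nat ?n else - (\<Sum>t<?n. A $$ (i, t)))"
      using i by (auto simp: M0_def sum_negf simp del: sum.lessThan_Suc)
    then show "S $$ (i, 0) * cofactor S i 0 = (if i = 0 then of_nat ?n * cofactor S i 0 else 0)"
      using i row[of i] by (simp add: S_def del: sum.lessThan_Suc)
  qed
  also have "\<dots> = of_nat ?n * cofactor S 0 0" by (simp del: sum.lessThan_Suc of_nat_Suc)
  also have "mat_delete S 0 0 = - 1 \<cdot>\<^sub>m mat_delete A 0 0"
    using A by (intro eq_matI) (auto simp: mat_delete_def S_def M0_def)
  then have "cofactor S 0 0 = (- 1) ^ m * det (mat_delete A 0 0)"
    using A by (simp add: cofactor_def mat_delete_def)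
  finally show ?thesis by (simp only: mult.assoc)
qed

text \<open>By the matrix-tree theorem this is the number of spanning trees.\<close>

definition tree_number :: "'a ugraph \<Rightarrow> int" where
  "tree_number G = det (mat_on (tl (SOME vs. distinct vs \<and> set vs = verts G)) (lap G))"

lemma coeff_1_char_poly_lap:
  assumes G: "simple_graph G" and vs: "distinct (v # us)" "set (v # us) = verts G"
  shows "coeff (char_poly (mat_on (v # us) (lap G) :: complex mat)) 1
    = of_nat (card (verts G)) * (- 1) ^ length us * of_int (det (mat_on us (lap G) :: int mat))"
proof -
  let ?A = "mat_on (v # us) (lap G) :: complex mat" and ?n = "Suc (length us)"
  have row: "(\<Sum>j<?n. ?A $$ (i, j)) = 0" if "i < ?n" for i
  proof -
    have "(v # us) ! i \<in> verts G" using that unfolding vs(2)[symmetric] by (intro nth_mem) simp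
    from sum_lap[OF G this] have "(\<Sum>j<length (v # us). lap G ((v # us) ! i) ((v # us) ! j)) = 0"
      using sum_nth_distinct[OF vs(1), of "lap G ((v # us) ! i)"] vs(2) by simp
    then show ?thesis using that
      by (simp add: mat_on_def del: of_int_sum sum.lessThan_Suc add: of_int_sum[symmetric])
  qed
  have col: "(\<Sum>i<?n. ?A $$ (i, j)) = 0" if "j < ?n" for j
  proof -
    have "(\<Sum>i<?n. ?A $$ (i, j)) = (\<Sum>i<?n. ?A $$ (j, i))"
      using that by (intro sum.cong) (auto simp: mat_on_def lap_commute[of G "(v # us) ! j"])
    then show ?thesis using row[OF that] by simp
  qed
  have "mat_delete ?A 0 0 = mat_on us (lap G)"
    by (intro eq_matI) (auto simp: mat_delete_def mat_on_def)
  moreover have "card (verts G) = ?n" using distinct_card[OF vs(1)] vs(2) by simp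
  ultimately show ?thesis
    using coeff_1_char_poly_zero_sums[OF _ row col] mat_on_carrier(1)[of "v # us" "lap G"]
      det_mat_on_of_int[of us "lap G", where ?'r = complex] by simp
qed

lemma cospectral_reduced_det_eq:
  assumes cosp: "cospectral G H"
    and vs: "distinct (v # us)" "set (v # us) = verts G" and ws: "distinct (w # ws)" "set (w # ws) = verts H"
  shows "det (mat_on us (lap G) :: int mat) = det (mat_on ws (lap H))"
proof -
  have "simple_graph G" "simple_graph H" using cosp by (auto simp: cospectral_def)
  note coeff = coeff_1_char_poly_lap[OF this(1) vs] coeff_1_char_poly_lap[OF this(2) ws]
  have "card (verts G) \<noteq> 0" using vs by (metis List.finite_set card_eq_0_iff list.set_intros(1) empty_iff)
  then show ?thesis
    using coeff cospectral_char_poly_eq[OF cosp vs ws] cospectral_card_verts[OF cosp] by simp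
qed

lemma tree_number_eq:
  assumes G: "simple_graph G" and vs: "distinct (v # us)" "set (v # us) = verts G"
  shows "tree_number G = det (mat_on us (lap G))"
proof -
  define ws where "ws = (SOME ws. distinct ws \<and> set ws = verts G)"
  have ws: "distinct ws \<and> set ws = verts G" unfolding ws_def by (rule someI[of _ "v # us"]) (use vs in simp)
  then obtain w ws' where "ws = w # ws'" using vs by (cases ws) auto
  then show ?thesis
    using cospectral_reduced_det_eq[of G G w ws' v us] G vs ws
    by (simp add: tree_number_def cospectral_def flip: ws_def)
qed

lemma enumeration_from_vertexE:
  assumes "simple_graph G" "v \<in> verts G"
  obtains us where "distinct (v # us)" "set (v # us) = verts G"
proof -
  obtain us where "distinct us" "set us = verts G - {v}"
    using finite_distinct_list[of "verts G - {v}"] finite_verts[OF assms(1)] by auto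
  then show thesis using that[of us] assms(2) by auto
qed

lemma cospectral_tree_number:
  assumes cosp: "cospectral G H" and ne: "verts G \<noteq> {}"
  shows "tree_number G = tree_number H"
proof -
  have G: "simple_graph G" and H: "simple_graph H" using cosp by (auto simp: cospectral_def)
  have "verts H \<noteq> {}" using cospectral_card_verts[OF cosp] ne finite_verts[OF G] by auto
  then obtain v w where "v \<in> verts G" "w \<in> verts H" using ne by blast
  then obtain us ws where "distinct (v # us)" "set (v # us) = verts G" "distinct (w # ws)" "set (w # ws) = verts H"
    using enumeration_from_vertexE[OF G] enumeration_from_vertexE[OF H] by metis
  then show ?thesis using tree_number_eq[OF G] tree_number_eq[OF H] cospectral_reduced_det_eq[OF cosp] by metis
qed

section \<open>Harmonic functions\<close>

definition harmonic :: "'a ugraph \<Rightarrow> ('a \<Rightarrow> 'r :: comm_ring_1) \<Rightarrow> bool" where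
  "harmonic G f \<longleftrightarrow> (\<forall>u\<in>verts G. (\<Sum>w\<in>nbrs G u. f w - f u) = 0)"

lemma harmonic_iff_sum_lap:
  assumes "simple_graph G"
  shows "harmonic G f \<longleftrightarrow> (\<forall>u\<in>verts G. (\<Sum>w\<in>verts G. of_int (lap G u w) * f w) = 0)"
  unfolding harmonic_def using sum_lap_mult[OF assms, of _ f] by (auto simp: sum_subtractf deg_def)

lemma sum_sum_lap:
  assumes "simple_graph G"
  shows "(\<Sum>u\<in>verts G. \<Sum>w\<in>verts G. of_int (lap G u w) * f w :: 'r :: comm_ring_1) = 0"
proof -
  have "(\<Sum>u\<in>verts G. \<Sum>w\<in>verts G. of_int (lap G u w) * f w)
    = (\<Sum>w\<in>verts G. of_int (\<Sum>u\<in>verts G. lap G w u) * f w)"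
    by (subst sum.swap) (simp add: sum_distrib_right lap_commute[of G _ w for w])
  then show ?thesis using sum_lap[OF assms] by simp
qed

text \<open>Harmonicity at a single vertex follows from harmonicity at all others.\<close>

lemma harmonic_iff_mult_mat_vec:
  fixes f :: "'a \<Rightarrow> 'r :: comm_ring_1"
  assumes G: "simple_graph G" and vs: "distinct (v # us)" "set (v # us) = verts G" and "f v = 0"
  shows "harmonic G f \<longleftrightarrow> mat_on us (lap G) *\<^sub>v vec (length us) (\<lambda>i. f (us ! i)) = 0\<^sub>v (length us)"
proof -
  let ?Lf = "\<lambda>u. \<Sum>w\<in>verts G. of_int (lap G u w) * f w"
  have v: "v \<in> verts G" and us: "set us = verts G - {v}" using vs by auto
  have "(mat_on us (lap G) *\<^sub>v vec (length us) (\<lambda>i. f (us ! i))) $ i = ?Lf (us ! i)" if i: "i < length us" for i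
  proof -
    have "(mat_on us (lap G) *\<^sub>v vec (length us) (\<lambda>i. f (us ! i))) $ i
      = (\<Sum>j<length us. of_int (lap G (us ! i) (us ! j)) * f (us ! j))"
      using i by (simp add: mat_on_def scalar_prod_def lessThan_atLeast0)
    also have "\<dots> = (\<Sum>w\<in>verts G - {v}. of_int (lap G (us ! i) w) * f w)"
      using sum_nth_distinct[of us "\<lambda>w. of_int (lap G (us ! i) w) * f w"] vs(1) us by simp
    also have "\<dots> = ?Lf (us ! i)"
      using sum.remove[OF finite_verts[OF G] v, of "\<lambda>w. of_int (lap G (us ! i) w) * f w"] \<open>f v = 0\<close> by simp
    finally show ?thesis .
  qed
  then have "mat_on us (lap G) *\<^sub>v vec (length us) (\<lambda>i. f (us ! i)) = 0\<^sub>v (length us) \<longleftrightarrow> (\<forall>u\<in>set us. ?Lf u = 0)"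
    by (auto simp: vec_eq_iff all_set_conv_all_nth)
  also have "\<dots> \<longleftrightarrow> (\<forall>u\<in>verts G. ?Lf u = 0)"
  proof -
    have "?Lf v + (\<Sum>u\<in>verts G - {v}. ?Lf u) = 0"
      using sum_sum_lap[OF G, of f] sum.remove[OF finite_verts[OF G] v, of ?Lf] by simp
    then show ?thesis unfolding us by (auto intro: sum.neutral)
  qed
  finally show ?thesis unfolding harmonic_iff_sum_lap[OF G] ..
qed

lemma carrier_vec_eq_vec_nthE:
  fixes x :: "'r :: zero vec"
  assumes "distinct us" "x \<in> carrier_vec (length us)"
  obtains f where "x = vec (length us) (\<lambda>i. f (us ! i))" "\<forall>u. u \<notin> set us \<longrightarrow> f u = 0"
proof
  define f where "f u = (if u \<in> set us then x $ the_inv_into {..<length us} ((!) us) u else 0)" for u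
  have inj: "inj_on ((!) us) {..<length us}" using assms(1) by (auto simp: inj_on_def nth_eq_iff_index_eq)
  have "f (us ! i) = x $ i" if "i < length us" for i
    using that the_inv_into_f_f[OF inj, of i] by (simp add: f_def)
  then show "x = vec (length us) (\<lambda>i. f (us ! i))" using assms(2) by (intro eq_vecI) auto
  show "\<forall>u. u \<notin> set us \<longrightarrow> f u = 0" by (simp add: f_def)
qed

lemma tree_number_eq_0_iff:
  assumes G: "simple_graph G" and v: "v \<in> verts G"
  shows "(of_int (tree_number G) :: 'k :: field) = 0 \<longleftrightarrow>
    (\<exists>f :: 'a \<Rightarrow> 'k. harmonic G f \<and> f v = 0 \<and> (\<exists>u\<in>verts G. f u \<noteq> 0))"
proof -
  obtain us where vs: "distinct (v # us)" "set (v # us) = verts G"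
    using enumeration_from_vertexE[OF G v] .
  let ?n = "length us" and ?A = "mat_on us (lap G) :: 'k mat"
  let ?vec = "\<lambda>f :: 'a \<Rightarrow> 'k. vec ?n (\<lambda>i. f (us ! i))"
  have vec_eq_0: "?vec f = 0\<^sub>v ?n \<longleftrightarrow> (\<forall>u\<in>verts G. f u = 0)" if "f v = 0" for f
    using that unfolding vs(2)[symmetric] by (auto simp: vec_eq_iff all_set_conv_all_nth)
  have "of_int (tree_number G) = det ?A"
    unfolding tree_number_eq[OF G vs] by (rule det_mat_on_of_int[symmetric])
  then have "(of_int (tree_number G) :: 'k) = 0 \<longleftrightarrow> (\<exists>x. x \<in> carrier_vec ?n \<and> x \<noteq> 0\<^sub>v ?n \<and> ?A *\<^sub>v x = 0\<^sub>v ?n)"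
    using det_0_iff_vec_prod_zero_field[of ?A ?n] by simp
  also have "\<dots> \<longleftrightarrow> (\<exists>f. f v = 0 \<and> ?vec f \<noteq> 0\<^sub>v ?n \<and> ?A *\<^sub>v ?vec f = 0\<^sub>v ?n)"
  proof
    assume "\<exists>x. x \<in> carrier_vec ?n \<and> x \<noteq> 0\<^sub>v ?n \<and> ?A *\<^sub>v x = 0\<^sub>v ?n"
    then obtain x where x: "x \<in> carrier_vec ?n" "x \<noteq> 0\<^sub>v ?n" "?A *\<^sub>v x = 0\<^sub>v ?n" by blast
    have us: "distinct us" "v \<notin> set us" using vs(1) by auto
    obtain f where "x = ?vec f" "\<forall>u. u \<notin> set us \<longrightarrow> f u = 0"
      using carrier_vec_eq_vec_nthE[OF us(1) x(1)] .
    then show "\<exists>f. f v = 0 \<and> ?vec f \<noteq> 0\<^sub>v ?n \<and> ?A *\<^sub>v ?vec f = 0\<^sub>v ?n"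
      using us(2) x(2,3) by (intro exI[of _ f]) simp
  next
    assume "\<exists>f. f v = 0 \<and> ?vec f \<noteq> 0\<^sub>v ?n \<and> ?A *\<^sub>v ?vec f = 0\<^sub>v ?n"
    then obtain f where "?vec f \<noteq> 0\<^sub>v ?n" "?A *\<^sub>v ?vec f = 0\<^sub>v ?n" by blast
    then show "\<exists>x. x \<in> carrier_vec ?n \<and> x \<noteq> 0\<^sub>v ?n \<and> ?A *\<^sub>v x = 0\<^sub>v ?n"
      by (intro exI[of _ "?vec f"]) simp
  qed
  also have "\<dots> \<longleftrightarrow> (\<exists>f :: 'a \<Rightarrow> 'k. harmonic G f \<and> f v = 0 \<and> (\<exists>u\<in>verts G. f u \<noteq> 0))"
  proof (intro arg_cong[where f = Ex] ext)
    fix f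
    show "(f v = 0 \<and> ?vec f \<noteq> 0\<^sub>v ?n \<and> ?A *\<^sub>v ?vec f = 0\<^sub>v ?n) \<longleftrightarrow>
        (harmonic G f \<and> f v = 0 \<and> (\<exists>u\<in>verts G. f u \<noteq> 0))"
      using vec_eq_0[of f] harmonic_iff_mult_mat_vec[OF G vs, of f] by auto
  qed
  finally show ?thesis .
qed

text \<open>On a disconnected graph the indicator function of a component is harmonic.\<close>

lemma graph_connected_if_tree_number_neq_0:
  assumes G: "simple_graph G" and "tree_number G \<noteq> 0"
  shows "graph_connected G"
  unfolding graph_connected_def
proof (intro allI impI, elim conjE, rule ccontr)
  fix S assume S: "S \<subseteq> verts G" "S \<noteq> {}" "\<forall>u\<in>S. nbrs G u \<subseteq> S" and "S \<noteq> verts G"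
  then obtain v where v: "v \<in> verts G" "v \<notin> S" by blast
  let ?f = "\<lambda>u. if u \<in> S then 1 else 0 :: rat"
  have "w \<in> S \<longleftrightarrow> u \<in> S" if "w \<in> nbrs G u" for u w using S(3) that nbrs_commute[of w G u] by blast
  then have "harmonic G ?f" unfolding harmonic_def by (intro ballI sum.neutral) auto
  moreover have "\<exists>u\<in>verts G. ?f u \<noteq> 0" using S(1,2) by force
  ultimately have "(of_int (tree_number G) :: rat) = 0"
    unfolding tree_number_eq_0_iff[OF G v(1)] using v(2) by (intro exI[of _ ?f]) simp
  then show False using assms(2) by simp
qed

section \<open>Cycles\<close>

lemma verts_cycle_of [simp]: "verts (cycle_of xs) = set xs"
  by (simp add: cycle_of_def)

lemma edges_cycle_of: "edges (cycle_of xs) = (\<lambda>(u, w). {u, w}) ` set (zip xs (rotate1 xs))"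
proof -
  have "set (zip xs (rotate1 xs)) = (\<lambda>i. (xs ! i, xs ! (Suc i mod length xs))) ` {..<length xs}"
    by (auto simp: set_zip nth_rotate1)
  then show ?thesis by (auto simp: cycle_of_def image_image)
qed

lemma edges_cycle_of_subset:
  assumes "e \<in> edges (cycle_of xs)"
  shows "e \<subseteq> set xs"
proof -
  obtain u w where "e = {u, w}" "(u, w) \<in> set (zip xs (rotate1 xs))"
    using assms by (auto simp: edges_cycle_of)
  then show ?thesis using set_zip_leftD[of u w] set_zip_rightD[of u w] by fastforce
qed

lemma zip_rotate1:
  assumes "length xs = length ys"
  shows "zip (rotate1 xs) (rotate1 ys) = rotate1 (zip xs ys)"
  using assms by (cases xs; cases ys) simp_all

lemma cycle_of_rotate: "cycle_of (rotate n xs) = cycle_of xs"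
proof (induction n)
  case (Suc n)
  have "cycle_of (rotate1 ys) = cycle_of ys" for ys :: "'a list"
    by (rule prod_eqI) (simp_all add: edges_cycle_of zip_rotate1)
  then show ?case using Suc by simp
qed simp

lemma cycle_of_start_atE:
  assumes "v \<in> set xs" "distinct xs"
  obtains vs where "cycle_of (v # vs) = cycle_of xs" "distinct (v # vs)" "length (v # vs) = length xs"
    "set (v # vs) = set xs"
proof -
  obtain ps qs where xs: "xs = ps @ v # qs" using split_list[OF assms(1)] by blast
  then have "v # qs @ ps = rotate (length ps) xs" by (simp add: rotate_append)
  then show thesis using that[of "qs @ ps"] cycle_of_rotate[of "length ps" xs] assms(2) xs by auto
qed

lemma cycle_of_map: "cycle_of (map f xs) = (f ` verts (cycle_of xs), (`) f ` edges (cycle_of xs))"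
  by (rule prod_eqI) (simp_all add: edges_cycle_of rotate1_map zip_map_map image_image case_prod_beta)

lemma nbrs_cycle_of_Cons:
  assumes "distinct (v # vs)" "vs \<noteq> []"
  shows "nbrs (cycle_of (v # vs)) v = {hd vs, last vs}"
proof -
  have v: "v \<notin> set vs" using assms(1) by simp
  have "zip (v # vs) (vs @ [v]) = (v, hd vs) # zip vs (tl vs @ [v])"
    using assms(2) by (cases vs) simp_all
  then have succ: "(v, w) \<in> set (zip (v # vs) (vs @ [v])) \<longleftrightarrow> w = hd vs" for w
    using v by (auto dest: set_zip_leftD)
  have "zip (v # vs) (vs @ [v]) = zip ((v # butlast vs) @ [last vs]) (vs @ [v])"
    using assms(2) by simp
  also have "\<dots> = zip (v # butlast vs) vs @ [(last vs, v)]"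
    using assms(2) by (subst zip_append) simp_all
  finally have pred: "(w, v) \<in> set (zip (v # vs) (vs @ [v])) \<longleftrightarrow> w = last vs" for w
    using v by (auto dest: set_zip_rightD)
  have "w \<in> nbrs (cycle_of (v # vs)) v \<longleftrightarrow> w = hd vs \<or> w = last vs" for w
  proof -
    have "w \<in> nbrs (cycle_of (v # vs)) v \<longleftrightarrow>
        (v, w) \<in> set (zip (v # vs) (vs @ [v])) \<or> (w, v) \<in> set (zip (v # vs) (vs @ [v]))"
      unfolding nbrs_def edges_cycle_of by (auto simp: image_iff doubleton_eq_iff)
    then show ?thesis using succ pred by blast
  qed
  then show ?thesis by blast
qed

lemma deg_cycle_of:
  assumes "distinct xs" "length xs \<ge> 3" "u \<in> set xs"
  shows "deg (cycle_of xs) u = 2"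
proof -
  obtain us where us: "cycle_of (u # us) = cycle_of xs" "distinct (u # us)" "length (u # us) = length xs"
    using cycle_of_start_atE[OF assms(3,1)] by blast
  then have len: "length us \<ge> 2" using assms(2) by simp
  then have "hd us \<noteq> last us"
    using us(2) by (cases us rule: list.exhaust[case_product list.exhaust]) auto
  moreover have "nbrs (cycle_of xs) u = {hd us, last us}"
    unfolding us(1)[symmetric] by (rule nbrs_cycle_of_Cons[OF us(2)]) (use len in auto)
  ultimately show ?thesis by (simp add: deg_def)
qed

lemma nbrs_graph_union: "nbrs (graph_union G H) u = nbrs G u \<union> nbrs H u"
  by (auto simp: nbrs_def graph_union_def)

lemma deg_graph_union_cycles:
  assumes xs: "distinct xs" "length xs \<ge> 3" and ys: "distinct ys" "length ys \<ge> 3"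
    and common: "set xs \<inter> set ys = {v}" and u: "u \<in> set xs \<union> set ys"
  shows "deg (graph_union (cycle_of xs) (cycle_of ys)) u = (if u = v then 4 else 2)"
proof -
  let ?X = "nbrs (cycle_of xs) u" and ?Y = "nbrs (cycle_of ys) u"
  note X = simple_graph_cycle_of[OF xs] and Y = simple_graph_cycle_of[OF ys]
  have sub: "?X \<subseteq> set xs" "?Y \<subseteq> set ys" using nbrs_subset_verts[OF X] nbrs_subset_verts[OF Y] by auto
  have deg: "deg (graph_union (cycle_of xs) (cycle_of ys)) u = card (?X \<union> ?Y)"
    by (simp add: deg_def nbrs_graph_union)
  show ?thesis
  proof (cases "u = v")
    case True
    then have "u \<in> set xs" "u \<in> set ys" using common by auto
    moreover have "?X \<inter> ?Y \<subseteq> {u}" using sub common True by blast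
    then have "?X \<inter> ?Y = {}" using not_self_nbr[OF X, of u] by blast
    ultimately show ?thesis
      using deg_cycle_of[OF xs] deg_cycle_of[OF ys] True deg finite_nbrs[OF X] finite_nbrs[OF Y]
      by (simp add: card_Un_disjoint deg_def)
  next
    case False
    then consider "u \<in> set xs" "u \<notin> set ys" | "u \<in> set ys" "u \<notin> set xs" using u common by blast
    then have "?X = {} \<and> card ?Y = 2 \<or> ?Y = {} \<and> card ?X = 2"
      using in_verts_if_nbr(1)[OF X] in_verts_if_nbr(1)[OF Y] deg_cycle_of[OF xs] deg_cycle_of[OF ys]
      by cases (auto simp: deg_def)
    then show ?thesis using deg False by auto
  qed
qed

section \<open>Roses\<close>

lemma verts_rose:
  assumes "k \<ge> 3" "l \<ge> 3"
  shows "verts (rose k l) = {0..<k + l - 1}"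
  using assms by (auto simp: rose_def graph_union_def)

lemma simple_graph_rose:
  assumes "k \<ge> 3" "l \<ge> 3"
  shows "simple_graph (rose k l)"
  using two_rose_simple_graph[OF two_rose_rose[OF assms]] .

lemma deg_rose:
  assumes "k \<ge> 3" "l \<ge> 3" "u < k + l - 1"
  shows "deg (rose k l) u = (if u = 0 then 4 else 2)"
  unfolding rose_def by (rule deg_graph_union_cycles) (use assms in auto)

lemma sum_deg_rose:
  fixes f :: "int \<Rightarrow> int"
  assumes kl: "k \<ge> 3" "l \<ge> 3"
  shows "(\<Sum>u\<in>verts (rose k l). f (int (deg (rose k l) u))) = f 4 + (int k + int l - 2) * f 2"
proof -
  have "(\<Sum>u\<in>verts (rose k l). f (int (deg (rose k l) u))) = (\<Sum>u\<in>{0..<k + l - 1}. if u = 0 then f 4 else f 2)"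
    unfolding verts_rose[OF kl] by (intro sum.cong) (auto simp: deg_rose[OF kl])
  also have "\<dots> = f 4 + (\<Sum>u\<in>{1..<k + l - 1}. f 2)"
    using kl by (simp add: sum.atLeast_Suc_lessThan)
  finally show ?thesis using kl by (simp add: of_nat_diff)
qed

lemma deviation_form_rose:
  assumes kl: "k \<ge> 3" "l \<ge> 3"
  shows "deviation_form (rose k l) = 0"
  unfolding deviation_form_def
proof (intro sum.neutral ballI)
  fix u w assume "u \<in> verts (rose k l)" "w \<in> nbrs (rose k l) u"
  then have "u < k + l - 1" "w < k + l - 1" "w \<noteq> u"
    using in_verts_if_nbr[OF simple_graph_rose[OF kl]] nbr_neq[OF simple_graph_rose[OF kl]]
    by (auto simp: verts_rose[OF kl])
  then show "(int (deg (rose k l) u) - 2) * (int (deg (rose k l) w) - 2) = 0"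
    by (simp add: deg_rose[OF kl])
qed

lemma edges_rose:
  assumes kl: "k \<ge> 3" "l \<ge> 3"
  shows "edges (rose k l) = (\<lambda>i. {i, Suc i}) ` {i. Suc i < k + l - 1 \<and> Suc i \<noteq> k}
    \<union> {{0, k - 1}, {0, k}, {0, k + l - 2}}"
proof -
  have cyclic_pairs: "(\<lambda>(u, w). {u, w}) ` set (zip [m..<Suc n] ([Suc m..<Suc n] @ [x]))
      = insert {x, n} ((\<lambda>i. {i, Suc i}) ` {m..<n})" if "m \<le> n" for m n x :: nat
  proof -
    have "zip [m..<Suc n] ([Suc m..<Suc n] @ [x]) = zip [m..<n] (map Suc [m..<n]) @ [(n, x)]"
      unfolding upt_Suc_append[OF that] map_Suc_upt[symmetric] by simp
    also have "set \<dots> = insert (n, x) ((\<lambda>i. (i, Suc i)) ` {m..<n})"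
      by (simp add: zip_map2 zip_same_conv_map image_image)
    finally show ?thesis by (simp add: image_image insert_commute)
  qed
  obtain k' where k': "k = Suc k'" using kl by (cases k) auto
  obtain n where n: "k + l - 1 = Suc n" "k \<le> n" using kl by (cases "k + l - 1") auto
  have "edges (cycle_of [0..<k]) = insert {0, k'} ((\<lambda>i. {i, Suc i}) ` {0..<k'})"
    using cyclic_pairs[of 0 k' 0] by (simp add: edges_cycle_of upt_conv_Cons[of 0 "Suc k'"] k' del: upt_Suc)
  moreover have "edges (cycle_of (0 # [k..<k + l - 1])) = {{0, k}, {0, n}} \<union> (\<lambda>i. {i, Suc i}) ` {k..<n}"
    using cyclic_pairs[of k n 0] n by (simp add: edges_cycle_of upt_conv_Cons[of k "Suc n"] del: upt_Suc)
  ultimately have "edges (rose k l) = (\<lambda>i. {i, Suc i}) ` ({0..<k'} \<union> {k..<n}) \<union> {{0, k'}, {0, k}, {0, n}}"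
    unfolding rose_def graph_union_def by (simp add: image_Un Un_ac insert_commute)
  also have "{0..<k'} \<union> {k..<n} = {i. Suc i < k + l - 1 \<and> Suc i \<noteq> k}"
    using n k' by auto
  finally show ?thesis using n k' by simp
qed

lemma nbrs_rose:
  assumes "k \<ge> 3" "l \<ge> 3"
  shows "w \<in> nbrs (rose k l) u \<longleftrightarrow>
    w = Suc u \<and> w < k + l - 1 \<and> w \<noteq> k \<or> u = Suc w \<and> u < k + l - 1 \<and> u \<noteq> k \<or>
    u = 0 \<and> w \<in> {k - 1, k, k + l - 2} \<or> w = 0 \<and> u \<in> {k - 1, k, k + l - 2}"
proof -
  have consecutive: "{u, w} \<in> (\<lambda>i. {i, Suc i}) ` S \<longleftrightarrow> w = Suc u \<and> u \<in> S \<or> u = Suc w \<and> w \<in> S" for S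
    unfolding image_iff doubleton_eq_iff by auto
  show ?thesis
    unfolding nbrs_def mem_Collect_eq edges_rose[OF assms] Un_iff consecutive insert_iff empty_iff doubleton_eq_iff
    by metis
qed

lemma graph_iso_rose:
  assumes "distinct (v # as @ bs)"
  shows "graph_iso (rose (Suc (length as)) (Suc (length bs))) (graph_union (cycle_of (v # as)) (cycle_of (v # bs)))"
    (is "graph_iso (rose ?k ?l) ?G")
proof -
  define f where "f = (!) (v # as @ bs)"
  have "map f ([0..<?k] @ [?k..<?k + length bs]) = (v # as) @ bs"
    using map_nth[of "v # as @ bs"] upt_add_eq_append[of 0 ?k "length bs"] by (simp add: f_def del: upt_Suc)
  then have "map f [0..<?k] = v # as \<and> map f [?k..<?k + length bs] = bs"
    unfolding map_append by (subst (asm) append_eq_append_conv) (simp_all del: upt_Suc)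
  then have left: "map f [0..<?k] = v # as" and right: "map f (0 # [?k..<?k + ?l - 1]) = v # bs"
    by (simp_all add: f_def del: upt_Suc)
  have "?G = graph_union (cycle_of (map f [0..<?k])) (cycle_of (map f (0 # [?k..<?k + ?l - 1])))"
    unfolding left right ..
  also have "\<dots> = (f ` verts (rose ?k ?l), (`) f ` edges (rose ?k ?l))"
    unfolding cycle_of_map by (simp add: rose_def graph_union_def image_Un)
  finally have "?G = (f ` verts (rose ?k ?l), (`) f ` edges (rose ?k ?l))" .
  moreover have verts: "verts (rose ?k ?l) = {..<length (v # as @ bs)}"
    by (auto simp: rose_def graph_union_def)
  moreover have "inj_on f (verts (rose ?k ?l))"
    using assms unfolding verts f_def by (rule inj_on_nth) auto
  moreover have "e \<subseteq> verts (rose ?k ?l)" if "e \<in> edges (rose ?k ?l)" for e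
    using that unfolding rose_def graph_union_def by (auto dest!: edges_cycle_of_subset simp del: upt_Suc)
  ultimately show ?thesis using graph_iso_image[of f "rose ?k ?l"] by simp
qed

lemma graph_union_cycles_iso_rose:
  assumes "distinct xs" "distinct ys" and common: "set xs \<inter> set ys = {v}"
  shows "graph_iso (graph_union (cycle_of xs) (cycle_of ys)) (rose (length xs) (length ys))"
proof -
  have "v \<in> set xs" "v \<in> set ys" using common by auto
  then obtain as bs where as: "cycle_of (v # as) = cycle_of xs" "distinct (v # as)" "length (v # as) = length xs"
      "set (v # as) = set xs"
    and bs: "cycle_of (v # bs) = cycle_of ys" "distinct (v # bs)" "length (v # bs) = length ys"
      "set (v # bs) = set ys"
    using cycle_of_start_atE[of v xs] cycle_of_start_atE[of v ys] assms(1,2) by metis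
  have "set as \<inter> set bs \<subseteq> {v}" unfolding common[symmetric] as(4)[symmetric] bs(4)[symmetric] by auto
  then have "distinct (v # as @ bs)" using as(2) bs(2) by auto
  from graph_iso_sym[OF graph_iso_rose[OF this]] show ?thesis
    using as(1,3) bs(1,3) by simp
qed

lemma two_rose_iso_roseE:
  assumes "two_rose G"
  obtains k l where "3 \<le> k" "k \<le> l" "graph_iso G (rose k l)"
proof -
  obtain xs ys v where xs: "distinct xs" "length xs \<ge> 3" and ys: "distinct ys" "length ys \<ge> 3"
    and common: "set xs \<inter> set ys = {v}" and G: "G = graph_union (cycle_of xs) (cycle_of ys)"
    using assms unfolding two_rose_def by blast
  have "graph_iso G (rose (length xs) (length ys))"
    unfolding G by (rule graph_union_cycles_iso_rose[OF xs(1) ys(1) common])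
  moreover have "G = graph_union (cycle_of ys) (cycle_of xs)" unfolding G graph_union_def by (simp add: Un_commute)
  then have "graph_iso G (rose (length ys) (length xs))"
    using graph_union_cycles_iso_rose[OF ys(1) xs(1), of v] common by (simp add: Int_commute)
  ultimately show thesis
    using that[of "length xs" "length ys"] that[of "length ys" "length xs"] xs(2) ys(2) by linarith
qed

lemma nbrs_rose_centre:
  assumes "k \<ge> 3" "l \<ge> 3"
  shows "nbrs (rose k l) 0 = {1, k - 1, k, k + l - 2}"
  using assms by (auto simp: nbrs_rose)

lemma nbrs_rose_off_centre:
  assumes "k \<ge> 3" "l \<ge> 3" "0 < u" "0 < w"
  shows "w \<in> nbrs (rose k l) u \<longleftrightarrow>
    w = Suc u \<and> w < k + l - 1 \<and> w \<noteq> k \<or> u = Suc w \<and> u < k + l - 1 \<and> u \<noteq> k"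
  using assms(3,4) nbrs_rose[OF assms(1,2), of w u] by simp

definition orderings :: "'a \<Rightarrow> 'a \<Rightarrow> 'a \<Rightarrow> ('a \<times> 'a \<times> 'a) set" where
  "orderings a b c = {(a, b, c), (a, c, b), (b, a, c), (b, c, a), (c, a, b), (c, b, a)}"

lemma mem_orderings_iff:
  assumes "distinct [a, b, c]"
  shows "(u, w, z) \<in> orderings a b c \<longleftrightarrow> {u, w, z} = {a, b, c}"
proof
  assume eq: "{u, w, z} = {a, b, c}"
  then have "u \<in> {a, b, c}" "w \<in> {a, b, c}" "z \<in> {a, b, c}" by blast+
  moreover have "distinct [u, w, z]"
    using assms eq by (intro card_distinct) (metis distinct_card list.simps(15) empty_set length_Cons)
  ultimately show "(u, w, z) \<in> orderings a b c" unfolding orderings_def by auto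
qed (auto simp: orderings_def)

lemma card_orderings: "distinct [a, b, c] \<Longrightarrow> card (orderings a b c) = 6"
  by (simp add: orderings_def)

lemma orderings_subset_triangles:
  assumes "w \<in> nbrs G u" "z \<in> nbrs G u" "z \<in> nbrs G w"
  shows "orderings u w z \<subseteq> triangles G"
  using assms assms[THEN nbrs_sym] by (auto simp: orderings_def triangles_def)

lemma triangle_rose_at_centre_cases:
  assumes kl: "k \<ge> 3" "l \<ge> 3"
    and nbrs: "u \<in> nbrs (rose k l) 0" "w \<in> nbrs (rose k l) 0" "w \<in> nbrs (rose k l) u"
  shows "k = 3 \<and> {0, u, w} = {0, 1, 2} \<or> l = 3 \<and> {0, u, w} = {0, k, Suc k}"
proof -
  have u: "u \<in> {1, k - 1, k, k + l - 2}" and w: "w \<in> {1, k - 1, k, k + l - 2}"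
    using nbrs(1,2) unfolding nbrs_rose_centre[OF kl] .
  then have "0 < u" "0 < w" using kl by auto
  then consider "w = Suc u" "w \<noteq> k" | "u = Suc w" "u \<noteq> k"
    using nbrs(3) nbrs_rose_off_centre[OF kl, of u w] by auto
  then show ?thesis
  proof cases
    case 1
    then have "u = 1 \<and> k = 3 \<or> u = k \<and> l = 3" using u w kl by auto
    then show ?thesis using 1 by auto
  next
    case 2
    then have "w = 1 \<and> k = 3 \<or> w = k \<and> l = 3" using u w kl by auto
    then show ?thesis using 2 by (auto simp: insert_commute)
  qed
qed

text \<open>Among three distinct positive numbers some two are not consecutive, so a triangle contains the centre.\<close>

lemma triangle_rose_cases:
  assumes kl: "k \<ge> 3" "l \<ge> 3" and triangle: "(u, w, z) \<in> triangles (rose k l)"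
  shows "k = 3 \<and> {u, w, z} = {0, 1, 2} \<or> l = 3 \<and> {u, w, z} = {0, k, Suc k}"
proof -
  let ?N = "nbrs (rose k l)"
  note at_centre = triangle_rose_at_centre_cases[OF kl] and N = nbrs_rose_off_centre[OF kl]
  have adj: "w \<in> ?N u" "z \<in> ?N u" "z \<in> ?N w" using triangle by (auto simp: triangles_def)
  note adj_sym = adj[THEN nbrs_sym]
  have "u = 0 \<or> w = 0 \<or> z = 0"
  proof (rule ccontr)
    assume "\<not> ?thesis"
    then have "w = Suc u \<or> u = Suc w" "z = Suc u \<or> u = Suc z" "z = Suc w \<or> w = Suc z"
      using adj N[of u w] N[of u z] N[of w z] by auto
    then show False by linarith
  qed
  then consider "u = 0" | "w = 0" | "z = 0" by blast
  then show ?thesis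
  proof cases
    case 1
    then show ?thesis using at_centre[of w z] adj by simp
  next
    case 2
    then show ?thesis using at_centre[of u z] adj adj_sym by (simp add: insert_commute)
  next
    case 3
    then show ?thesis using at_centre[of u w] adj adj_sym by (simp add: insert_commute)
  qed
qed

lemma triangles_rose:
  assumes kl: "k \<ge> 3" "l \<ge> 3"
  shows "triangles (rose k l) =
    (if k = 3 then orderings 0 1 2 else {}) \<union> (if l = 3 then orderings 0 k (Suc k) else {})" (is "_ = ?R")
proof
  have "distinct [0, 1, 2 :: nat]" "distinct [0, k, Suc k]" using kl by auto
  note mem = this[THEN mem_orderings_iff]
  show "triangles (rose k l) \<subseteq> ?R"
  proof
    fix t assume "t \<in> triangles (rose k l)"
    moreover obtain u w z where "t = (u, w, z)" by (cases t)
    ultimately have "k = 3 \<and> t \<in> orderings 0 1 2 \<or> l = 3 \<and> t \<in> orderings 0 k (Suc k)"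
      using triangle_rose_cases[OF kl, of u w z] by (simp only: mem)
    then show "t \<in> ?R" by auto
  qed
  have "orderings 0 1 2 \<subseteq> triangles (rose k l)" if "k = 3"
    using that kl nbrs_rose_off_centre[OF kl, of 1 2]
    by (intro orderings_subset_triangles) (simp_all add: nbrs_rose_centre)
  moreover have "orderings 0 k (Suc k) \<subseteq> triangles (rose k l)" if "l = 3"
    using that kl nbrs_rose_off_centre[OF kl, of k "Suc k"]
    by (intro orderings_subset_triangles) (simp_all add: nbrs_rose_centre)
  ultimately show "?R \<subseteq> triangles (rose k l)" by (cases "k = 3"; cases "l = 3") simp_all
qed

section \<open>The tree number of a rose\<close>

lemma det_tridiagonal:
  fixes p b c :: "nat \<Rightarrow> 'k :: field"
  assumes p: "\<And>i. p i \<noteq> 0"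
  shows "det (mat n n (\<lambda>(i, j). if i = j then p i + (case i of 0 \<Rightarrow> 0 | Suc t \<Rightarrow> b t * c t / p t)
    else if j = Suc i then b i else if i = Suc j then c j else 0)) = (\<Prod>i<n. p i)" (is "det ?A = _")
proof -
  define L where "L = mat n n (\<lambda>(i, t). if i = t then 1 else if i = Suc t then c t / p t else 0)"
  define U where "U = mat n n (\<lambda>(t, j). if t = j then p t else if j = Suc t then b t else 0)"
  have carrier: "L \<in> carrier_mat n n" "U \<in> carrier_mat n n" by (simp_all add: L_def U_def)
  have "L * U = ?A"
  proof (rule eq_matI)
    fix i j assume "i < dim_row ?A" "j < dim_col ?A"
    then have ij: "i < n" "j < n" by auto
    have "(L * U) $$ (i, j) = (\<Sum>t<n. L $$ (i, t) * U $$ (t, j))"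
      using ij carrier by (simp add: scalar_prod_def lessThan_atLeast0)
    also have "\<dots> = (\<Sum>t<n. (if t = i then U $$ (t, j) else 0) + (if i = Suc t then c t / p t * U $$ (t, j) else 0))"
      using ij by (intro sum.cong) (auto simp: L_def)
    also have "\<dots> = U $$ (i, j) + (case i of 0 \<Rightarrow> 0 | Suc t \<Rightarrow> c t / p t * U $$ (t, j))"
      using ij by (simp add: sum.distrib split: nat.split)
    also have "\<dots> = ?A $$ (i, j)"
      using ij p by (auto simp: U_def split: nat.split)
    finally show "(L * U) $$ (i, j) = ?A $$ (i, j)" .
  qed (use carrier in auto)
  moreover have "det L = 1"
    using det_lower_triangular[OF _ carrier(1)] by (auto simp: L_def diag_mat_def intro!: prod_list_neutral)
  moreover have "det U = (\<Prod>i<n. p i)"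
    using det_upper_triangular[OF _ carrier(2)]
    by (simp add: upper_triangular_def U_def diag_mat_def prod.distinct_set_conv_list[symmetric] lessThan_atLeast0
        cong: map_cong)
  ultimately show ?thesis using det_mult[OF carrier] by simp
qed

definition path_pivot :: "nat \<Rightarrow> rat" where
  "path_pivot i = (of_nat i + 2) / (of_nat i + 1)"

lemma path_pivot_pos: "path_pivot i > 0"
  by (simp add: path_pivot_def add_nonneg_pos)

lemma path_pivot_0: "path_pivot 0 = 2"
  by (simp add: path_pivot_def)

lemma path_pivot_Suc: "path_pivot (Suc i) + 1 / path_pivot i = 2"
proof -
  have "of_nat i + 1 > (0 :: rat)" "of_nat i + 2 > (0 :: rat)" by (simp_all add: add_nonneg_pos)
  then show ?thesis by (simp add: path_pivot_def divide_simps add.commute)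
qed

lemma prod_path_pivot: "(\<Prod>i<n. path_pivot i) = of_nat (Suc n)"
proof (induction n)
  case (Suc n)
  have "of_nat n + 1 > (0 :: rat)" by (simp add: add_nonneg_pos)
  then show ?case using Suc by (simp add: path_pivot_def add.commute)
qed simp

text \<open>With the centre deleted, the Laplacian of a rose is tridiagonal with two blocks, one for each cycle.\<close>

definition rose_pivot :: "nat \<Rightarrow> nat \<Rightarrow> rat" where
  "rose_pivot a i = path_pivot (if i < a then i else i - a)"

lemma rose_pivot_block_start: "i = 0 \<or> i = a \<Longrightarrow> rose_pivot a i = 2"
  by (auto simp: rose_pivot_def path_pivot_0)

lemma rose_pivot_Suc:
  assumes "Suc i \<noteq> a"
  shows "rose_pivot a (Suc i) + 1 / rose_pivot a i = 2"
proof (cases "Suc i < a")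
  case True
  then show ?thesis using path_pivot_Suc[of i] by (simp add: rose_pivot_def)
next
  case False
  then have "a \<le> i" using assms by simp
  then show ?thesis using path_pivot_Suc[of "i - a"] by (simp add: rose_pivot_def Suc_diff_le)
qed

lemma prod_rose_pivot: "(\<Prod>i<a + b. rose_pivot a i) = of_nat (Suc a * Suc b)"
proof -
  have "(\<Prod>i<a + b. rose_pivot a i) = (\<Prod>i<a. path_pivot i) * (\<Prod>i<b. path_pivot i)"
    using prod.atLeastLessThan_concat[of 0 a "a + b" "rose_pivot a"]
      prod.shift_bounds_nat_ivl[of "rose_pivot a" 0 a b]
    by (simp add: rose_pivot_def lessThan_atLeast0 add.commute)
  then show ?thesis by (simp only: prod_path_pivot of_nat_mult)
qed

lemma tree_number_rose:
  assumes kl: "k \<ge> 3" "l \<ge> 3"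
  shows "tree_number (rose k l) = int (k * l)"
proof -
  define a where "a = k - 1"
  define n where "n = a + (l - 1)"
  define b :: "nat \<Rightarrow> rat" where "b i = (if Suc i = a then 0 else - 1)" for i
  have n: "n = k + l - 2" and len: "length [1..<k + l - 1] = n" using kl by (auto simp: n_def a_def)
  have diag: "rose_pivot a i + (case i of 0 \<Rightarrow> 0 | Suc t \<Rightarrow> b t * b t / rose_pivot a t) = 2" for i
    using rose_pivot_block_start[of i a] rose_pivot_Suc[of _ a] by (cases i) (auto simp: b_def)
  have "mat_on [1..<k + l - 1] (lap (rose k l)) = mat n n (\<lambda>(i, j).
    if i = j then rose_pivot a i + (case i of 0 \<Rightarrow> 0 | Suc t \<Rightarrow> b t * b t / rose_pivot a t)
    else if j = Suc i then b i else if i = Suc j then b j else 0)" (is "?L = ?T")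
  proof (rule eq_matI)
    fix i j assume "i < dim_row ?T" "j < dim_col ?T"
    then have ij: "i < n" "j < n" by auto
    then have "deg (rose k l) (Suc i) = 2"
      "Suc j \<in> nbrs (rose k l) (Suc i) \<longleftrightarrow> j = Suc i \<and> Suc i \<noteq> a \<or> i = Suc j \<and> Suc j \<noteq> a"
      using kl by (auto simp: deg_rose nbrs_rose_off_centre n a_def)
    then show "?L $$ (i, j) = ?T $$ (i, j)"
      using ij len diag[of i] by (auto simp: mat_on_def lap_def b_def simp del: upt_Suc)
  qed (use len in simp_all)
  then have "det ?L = (\<Prod>i<n. rose_pivot a i)"
    using det_tridiagonal[of "rose_pivot a" n b b] path_pivot_pos
    by (simp add: rose_pivot_def less_imp_neq[symmetric])
  also have "\<dots> = of_nat (k * l)" using kl unfolding n_def prod_rose_pivot a_def by simp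
  finally have "of_int (det (mat_on [1..<k + l - 1] (lap (rose k l)) :: int mat)) = (of_int (int (k * l)) :: rat)"
    using det_mat_on_of_int[of "[1..<k + l - 1]" "lap (rose k l)", where ?'r = rat] by simp
  moreover have "distinct (0 # [1..<k + l - 1])" "set (0 # [1..<k + l - 1]) = verts (rose k l)"
    using kl by (auto simp: verts_rose)
  ultimately show ?thesis using tree_number_eq[OF simple_graph_rose[OF kl]] by (simp only: of_int_eq_iff)
qed

section \<open>Recognising roses\<close>

definition path_to :: "'a ugraph \<Rightarrow> 'a set \<Rightarrow> 'a \<Rightarrow> 'a list \<Rightarrow> bool" where
  "path_to G W v zs \<longleftrightarrow> distinct zs \<and> set zs \<subseteq> W \<and> zs \<noteq> [] \<and> last zs = v \<and> successively (\<lambda>u w. w \<in> nbrs G u) zs"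

lemma maximal_path_toE:
  assumes "finite W" and zs0: "path_to G W v zs0"
  obtains zs where "path_to G W v zs" "length zs0 \<le> length zs" "nbrs G (hd zs) \<inter> W \<subseteq> set zs"
proof -
  have "length zs < Suc (card W)" if "path_to G W v zs" for zs
    using that distinct_card[of zs] card_mono[OF assms(1), of "set zs"] by (simp add: path_to_def)
  then obtain zs where zs: "path_to G W v zs" "\<And>ys. path_to G W v ys \<Longrightarrow> length ys \<le> length zs"
    using ex_has_greatest_nat[of "path_to G W v" zs0 length "Suc (card W)"] zs0 by auto
  have "y \<in> set zs" if y: "y \<in> nbrs G (hd zs)" "y \<in> W" for y
  proof (rule ccontr)
    assume "y \<notin> set zs"
    then have "path_to G W v (y # zs)"
      using zs(1) y nbrs_sym[OF y(1)] by (simp add: path_to_def successively_Cons)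
    then show False using zs(2) by fastforce
  qed
  then show thesis using that zs zs0 by blast
qed

lemma edges_cycle_of_closed_path:
  assumes "successively (\<lambda>u w. w \<in> nbrs G u) (v # vs)" "v \<in> nbrs G (last (v # vs))"
  shows "edges (cycle_of (v # vs)) \<subseteq> edges G"
proof -
  have "w \<in> nbrs G u"
    if "successively (\<lambda>u w. w \<in> nbrs G u) xs" "xs \<noteq> []" "y \<in> nbrs G (last xs)" "(u, w) \<in> set (zip xs (tl xs @ [y]))"
    for xs y u w
    using that by (induction xs rule: induct_list012) auto
  from this[OF assms(1) _ assms(2)] show ?thesis by (auto simp: edges_cycle_of nbrs_def)
qed

lemma deg_ge_3_if_chord_to_inner_vertex:
  assumes G: "simple_graph G" and path: "successively (\<lambda>u w. w \<in> nbrs G u) (x # ps @ y # qs)" "qs \<noteq> []"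
    and dist: "distinct (z # x # ps @ y # qs)" and chord: "y \<in> nbrs G z"
  shows "deg G y \<ge> 3"
proof -
  have "successively (\<lambda>u w. w \<in> nbrs G u) ((x # ps) @ y # qs)" using path(1) by simp
  then have "y \<in> nbrs G (last (x # ps))" "hd qs \<in> nbrs G y"
    using path(2) unfolding successively_append_iff by (auto simp: successively_Cons)
  then have sub: "{last (x # ps), hd qs, z} \<subseteq> nbrs G y" using nbrs_sym chord by fast
  have "last (x # ps) \<in> set (x # ps)" by (rule last_in_set) simp
  moreover have "hd qs \<in> set qs" using path(2) by simp
  ultimately have "last (x # ps) \<noteq> hd qs" "last (x # ps) \<noteq> z" "hd qs \<noteq> z" using dist by auto
  then have "card {last (x # ps), hd qs, z} = 3" by simp
  then show ?thesis unfolding deg_def using card_mono[OF finite_nbrs[OF G] sub] by simp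
qed

text \<open>A maximal path to \<open>v\<close> can only be blocked by running back into \<open>v\<close>,
  since all its inner vertices already have both of their neighbours on it.\<close>

lemma cycle_through_vertexE:
  assumes H: "simple_graph H" and W: "finite W" "v \<in> W"
    and deg2: "\<And>u. u \<in> W \<Longrightarrow> u \<noteq> v \<Longrightarrow> deg H u = 2 \<and> nbrs H u \<subseteq> W"
    and a: "a \<in> nbrs H v" "a \<in> W"
  obtains xs where "distinct xs" "length xs \<ge> 3" "set xs \<subseteq> W" "v \<in> set xs" "edges (cycle_of xs) \<subseteq> edges H"
proof -
  have "path_to H W v [a, v]"
    using W a nbrs_sym[OF a(1)] nbr_neq[OF H a(1)] by (simp add: path_to_def)
  from maximal_path_toE[OF W(1) this]
  obtain zs where zs: "path_to H W v zs" "2 \<le> length zs" and maximal: "nbrs H (hd zs) \<inter> W \<subseteq> set zs"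
    by (auto simp: numeral_2_eq_2)
  then obtain z x rest where zs_eq: "zs = z # x # rest" by (cases zs rule: remdups_adj.cases) auto
  have path: "distinct (z # x # rest)" "set (z # x # rest) \<subseteq> W" "last (x # rest) = v" "x \<in> nbrs H z"
    "successively (\<lambda>u w. w \<in> nbrs H u) (x # rest)"
    using zs(1) unfolding zs_eq path_to_def by auto
  have "v \<in> set (x # rest)" unfolding path(3)[symmetric] by (rule last_in_set) simp
  then have z: "z \<in> W" "z \<noteq> v" using path(1,2) by auto
  have "card (nbrs H z) = 2" using deg2[OF z] by (simp add: deg_def)
  then obtain y where y: "y \<in> nbrs H z" "y \<noteq> x" using path(4) by (auto simp: card_2_iff)
  have "y \<in> W" "y \<noteq> z" using y(1) deg2[OF z] nbr_neq[OF H] by auto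
  then have "y \<in> set rest" using y maximal unfolding zs_eq by auto
  then obtain ps qs where rest: "rest = ps @ y # qs" using split_list by fast
  have "qs = []"
  proof (rule ccontr)
    assume "qs \<noteq> []"
    then have "y \<noteq> v" using path(1,3) by (auto simp: rest)
    then have "deg H y = 2" using deg2[OF \<open>y \<in> W\<close>] by simp
    moreover have "deg H y \<ge> 3"
      using deg_ge_3_if_chord_to_inner_vertex[OF H path(5)[unfolded rest] \<open>qs \<noteq> []\<close> path(1)[unfolded rest] y(1)] .
    ultimately show False by simp
  qed
  then have "y = v" using path(3) by (simp add: rest)
  then have "edges (cycle_of zs) \<subseteq> edges H"
    using path nbrs_sym[OF y(1)] unfolding zs_eq by (intro edges_cycle_of_closed_path) auto
  moreover have "length zs \<ge> 3" by (simp add: zs_eq rest)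
  moreover have "v \<in> set zs" using \<open>y = v\<close> by (simp add: zs_eq rest)
  ultimately show thesis using that path(1,2) unfolding zs_eq by blast
qed

lemma nbrs_eq_nbrs_cycle_of:
  assumes H: "simple_graph H" and xs: "distinct xs" "length xs \<ge> 3" "edges (cycle_of xs) \<subseteq> edges H"
    and u: "u \<in> set xs" "deg H u = 2"
  shows "nbrs H u = nbrs (cycle_of xs) u"
proof (rule nbrs_eqI[OF H])
  show "nbrs (cycle_of xs) u \<subseteq> nbrs H u" using xs(3) by (auto simp: nbrs_def)
  show "deg H u \<le> card (nbrs (cycle_of xs) u)" using deg_cycle_of[OF xs(1,2) u(1)] u(2) by (simp add: deg_def)
qed

lemma nbr_off_cycleE:
  assumes H: "simple_graph H" and xs: "distinct xs" "length xs \<ge> 3" "edges (cycle_of xs) \<subseteq> edges H"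
    and v: "v \<in> set xs" "deg H v > 2" and deg2: "\<And>u. u \<in> set xs \<Longrightarrow> u \<noteq> v \<Longrightarrow> deg H u = 2"
  obtains b where "b \<in> nbrs H v" "b \<notin> set xs"
proof -
  have "\<not> nbrs H v \<subseteq> set xs"
  proof
    assume sub: "nbrs H v \<subseteq> set xs"
    have "nbrs H v \<subseteq> nbrs (cycle_of xs) v"
    proof
      fix w assume w: "w \<in> nbrs H v"
      then have "w \<in> set xs" "w \<noteq> v" using sub nbr_neq[OF H w] by auto
      then have "nbrs H w = nbrs (cycle_of xs) w" using nbrs_eq_nbrs_cycle_of[OF H xs] deg2 by simp
      then have "v \<in> nbrs (cycle_of xs) w" using nbrs_sym[OF w] by simp
      then show "w \<in> nbrs (cycle_of xs) v" by (rule nbrs_sym)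
    qed
    then have "deg H v \<le> deg (cycle_of xs) v"
      unfolding deg_def by (rule card_mono[OF finite_nbrs[OF simple_graph_cycle_of[OF xs(1,2)]]])
    then show False using v(2) deg_cycle_of[OF xs(1,2) v(1)] by simp
  qed
  then show thesis using that by blast
qed

lemma two_petalsE:
  assumes H: "simple_graph H" and v: "v \<in> verts H" "deg H v = 4"
    and deg2: "\<And>u. u \<in> verts H \<Longrightarrow> u \<noteq> v \<Longrightarrow> deg H u = 2"
  obtains xs ys where "distinct xs" "length xs \<ge> 3" "distinct ys" "length ys \<ge> 3" "set xs \<inter> set ys = {v}"
    "set xs \<subseteq> verts H" "set ys \<subseteq> verts H" "edges (cycle_of xs) \<subseteq> edges H" "edges (cycle_of ys) \<subseteq> edges H"
proof -
  obtain a where "a \<in> nbrs H v" using v(2) by (force simp: deg_def)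
  then obtain xs where xs: "distinct xs" "length xs \<ge> 3" "set xs \<subseteq> verts H" "v \<in> set xs"
      "edges (cycle_of xs) \<subseteq> edges H"
    using cycle_through_vertexE[OF H finite_verts[OF H] v(1)] deg2 nbrs_subset_verts[OF H] by blast
  have on_cycle: "nbrs H u = nbrs (cycle_of xs) u" if "u \<in> set xs" "u \<noteq> v" for u
    using nbrs_eq_nbrs_cycle_of[OF H xs(1,2,5) that(1)] deg2 that xs(3) by blast
  have nbrs_cycle: "nbrs (cycle_of xs) u \<subseteq> set xs" for u
    using nbrs_subset_verts[OF simple_graph_cycle_of[OF xs(1,2)]] by simp
  obtain b where b: "b \<in> nbrs H v" "b \<notin> set xs"
    by (rule nbr_off_cycleE[OF H xs(1,2,5,4)]) (use v(2) deg2 xs(3) in auto)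
  define W where "W = verts H - (set xs - {v})"
  have "nbrs H u \<subseteq> W" if u: "u \<in> W" "u \<noteq> v" for u
  proof
    fix w assume w: "w \<in> nbrs H u"
    have "w \<in> set xs \<Longrightarrow> w \<noteq> v \<Longrightarrow> u \<in> set xs" using on_cycle[of w] nbrs_cycle[of w] nbrs_sym[OF w] by auto
    then show "w \<in> W" using u in_verts_if_nbr(2)[OF H w] by (auto simp: W_def)
  qed
  moreover have "finite W" "v \<in> W" "b \<in> W"
    using finite_verts[OF H] v(1) b in_verts_if_nbr(2)[OF H] by (auto simp: W_def)
  ultimately obtain ys where ys: "distinct ys" "length ys \<ge> 3" "set ys \<subseteq> W" "v \<in> set ys"
      "edges (cycle_of ys) \<subseteq> edges H"
    using cycle_through_vertexE[OF H, of W v b] deg2 b(1) by (auto simp: W_def)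
  then have "set xs \<inter> set ys = {v}" "set ys \<subseteq> verts H" using xs(4) by (auto simp: W_def)
  then show thesis using that xs ys by blast
qed

lemma iso_rose_if_degrees:
  assumes H: "simple_graph H" "graph_connected H" and v: "v \<in> verts H" "deg H v = 4"
    and deg2: "\<And>u. u \<in> verts H \<Longrightarrow> u \<noteq> v \<Longrightarrow> deg H u = 2"
  obtains k l where "3 \<le> k" "k \<le> l" "graph_iso H (rose k l)"
proof -
  obtain xs ys where xs: "distinct xs" "length xs \<ge> 3" and ys: "distinct ys" "length ys \<ge> 3"
    and common: "set xs \<inter> set ys = {v}" and sub: "set xs \<subseteq> verts H" "set ys \<subseteq> verts H"
      "edges (cycle_of xs) \<subseteq> edges H" "edges (cycle_of ys) \<subseteq> edges H"
    using two_petalsE[OF H(1) v deg2] by blast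
  define G where "G = graph_union (cycle_of xs) (cycle_of ys)"
  have rose: "two_rose G" using xs ys common unfolding two_rose_def G_def by blast
  have "graph_iso G H"
  proof (rule graph_iso_if_saturated_embedding[OF two_rose_simple_graph[OF rose] _ H, where f = id])
    show "verts G \<noteq> {}" "id ` verts G \<subseteq> verts H" using common sub by (auto simp: G_def graph_union_def)
    show "id ` e \<in> edges H" if "e \<in> edges G" for e using that sub by (auto simp: G_def graph_union_def)
    show "deg H (id u) \<le> deg G u" if "u \<in> verts G" for u
    proof -
      have "u \<in> set xs \<union> set ys" using that by (simp add: G_def graph_union_def)
      then show ?thesis
        using deg_graph_union_cycles[OF xs ys common] deg2[of u] v(2) sub unfolding G_def by (cases "u = v") auto
    qed
  qed simp
  then show thesis using two_rose_iso_roseE[OF rose] that graph_iso_trans graph_iso_sym by metis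
qed

section \<open>Degree sequences of graphs cospectral with a rose\<close>

context
  fixes k l :: nat and H :: "'a ugraph"
  assumes kl: "k \<ge> 3" "l \<ge> 3" and cosp: "cospectral H (rose k l)"
begin

lemma simple_graph_if_cospectral_rose: "simple_graph H"
  using cosp by (simp add: cospectral_def)

lemma card_verts_cospectral_rose: "int (card (verts H)) = int k + int l - 1"
  using cospectral_card_verts[OF cosp] kl by (simp add: verts_rose of_nat_diff)

lemma tree_number_cospectral_rose: "tree_number H = int (k * l)"
proof -
  have "verts H \<noteq> {}" using card_verts_cospectral_rose kl by auto
  then show ?thesis using cospectral_tree_number[OF cosp] tree_number_rose[OF kl] by simp
qed

lemma connected_if_cospectral_rose: "graph_connected H"
  using graph_connected_if_tree_number_neq_0[OF simple_graph_if_cospectral_rose] tree_number_cospectral_rose kl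
  by simp

lemma sum_deviations_cospectral_rose:
  shows "(\<Sum>u\<in>verts H. int (deg H u) - 2) = 2" and "(\<Sum>u\<in>verts H. (int (deg H u) - 2)\<^sup>2) = 4"
proof -
  note H = simple_graph_if_cospectral_rose and R = simple_graph_rose[OF kl]
  have deg: "(\<Sum>u\<in>verts H. int (deg H u)) = 4 + (int k + int l - 2) * 2"
    using cospectral_lap_moment[OF cosp, of 1] sum_deg_rose[OF kl, of "\<lambda>d. d"]
    by (simp only: lap_moment_1[OF H] lap_moment_1[OF R])
  have "(\<Sum>u\<in>verts H. int (deg H u) ^ 2 + int (deg H u)) = 20 + (int k + int l - 2) * 6"
    using cospectral_lap_moment[OF cosp, of 2] sum_deg_rose[OF kl, of "\<lambda>d. d ^ 2 + d"]
    by (simp add: lap_moment_2[OF H] lap_moment_2[OF R])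
  then have deg_squared: "(\<Sum>u\<in>verts H. int (deg H u) ^ 2) = 16 + (int k + int l - 2) * 4"
    using deg by (simp add: sum.distrib)
  show "(\<Sum>u\<in>verts H. int (deg H u) - 2) = 2"
    using deg card_verts_cospectral_rose by (simp add: sum_subtractf)
  have "(\<Sum>u\<in>verts H. (int (deg H u) - 2)\<^sup>2) = (\<Sum>u\<in>verts H. int (deg H u) ^ 2 - 4 * int (deg H u) + 4)"
    by (intro sum.cong) (auto simp: power2_eq_square algebra_simps)
  then show "(\<Sum>u\<in>verts H. (int (deg H u) - 2)\<^sup>2) = 4"
    using deg deg_squared card_verts_cospectral_rose
    by (simp add: sum_subtractf sum.distrib sum_distrib_left[symmetric])
qed

end

lemma eq_0_if_sum_squares_le:
  fixes x :: "'a \<Rightarrow> 'r :: linordered_idom"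
  assumes V: "finite V" "v \<in> V" and "(\<Sum>u\<in>V. (x u)\<^sup>2) \<le> (x v)\<^sup>2" and u: "u \<in> V" "u \<noteq> v"
  shows "x u = 0"
proof -
  have "(x v)\<^sup>2 + (\<Sum>u\<in>V - {v}. (x u)\<^sup>2) \<le> (x v)\<^sup>2"
    using sum.remove[OF V, of "\<lambda>u. (x u)\<^sup>2"] assms(3) by simp
  moreover have "(\<Sum>u\<in>V - {v}. (x u)\<^sup>2) \<ge> 0" by (intro sum_nonneg) simp
  ultimately have "(\<Sum>u\<in>V - {v}. (x u)\<^sup>2) = 0" by simp
  then show ?thesis using V(1) u by (simp add: sum_nonneg_eq_0_iff)
qed

lemma card_signs_eq_sums:
  fixes x :: "'a \<Rightarrow> int"
  assumes fin: "finite V" and x: "\<forall>u\<in>V. x u \<in> {- 1, 0, 1}"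
  shows "2 * int (card {u \<in> V. x u = 1}) = (\<Sum>u\<in>V. (x u)\<^sup>2) + (\<Sum>u\<in>V. x u)"
    "2 * int (card {u \<in> V. x u = - 1}) = (\<Sum>u\<in>V. (x u)\<^sup>2) - (\<Sum>u\<in>V. x u)"
proof -
  have "(\<Sum>u\<in>V. (x u)\<^sup>2 + x u) = (\<Sum>u\<in>V. if x u = 1 then 2 else 0)"
    "(\<Sum>u\<in>V. (x u)\<^sup>2 - x u) = (\<Sum>u\<in>V. if x u = - 1 then 2 else 0)"
    by (intro sum.cong; use x in force)+
  then show "2 * int (card {u \<in> V. x u = 1}) = (\<Sum>u\<in>V. (x u)\<^sup>2) + (\<Sum>u\<in>V. x u)"
    "2 * int (card {u \<in> V. x u = - 1}) = (\<Sum>u\<in>V. (x u)\<^sup>2) - (\<Sum>u\<in>V. x u)"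
    using fin by (simp_all add: sum.distrib sum_subtractf sum.If_cases Int_def)
qed

definition mate_degrees :: "'a ugraph \<Rightarrow> 'a \<Rightarrow> 'a \<Rightarrow> 'a \<Rightarrow> 'a \<Rightarrow> bool" where
  "mate_degrees H a b c p \<longleftrightarrow> distinct [a, b, c, p] \<and> {a, b, c, p} \<subseteq> verts H \<and>
     deg H a = 3 \<and> deg H b = 3 \<and> deg H c = 3 \<and> deg H p = 1 \<and> (\<forall>u\<in>verts H - {a, b, c, p}. deg H u = 2)"

lemma mate_degreesE:
  assumes fin: "finite (verts H)" and "(\<Sum>u\<in>verts H. int (deg H u) - 2) = 2" "(\<Sum>u\<in>verts H. (int (deg H u) - 2)\<^sup>2) = 4"
    and deg: "\<forall>u\<in>verts H. deg H u \<in> {1, 2, 3}"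
  obtains a b c p where "mate_degrees H a b c p"
proof -
  let ?cubic = "{u \<in> verts H. int (deg H u) - 2 = 1}" and ?pendant = "{u \<in> verts H. int (deg H u) - 2 = - 1}"
  have "\<forall>u\<in>verts H. int (deg H u) - 2 \<in> {- 1, 0, 1}" using deg by auto
  from card_signs_eq_sums[OF fin this] have "card ?cubic = 3" "card ?pendant = 1" unfolding assms(2,3) by simp_all
  then obtain a b c p where cubic: "?cubic = {a, b, c}" "a \<noteq> b" "a \<noteq> c" "b \<noteq> c" and pendant: "?pendant = {p}"
    by (auto simp: card_3_iff card_1_singleton_iff)
  have "{a, b, c} \<subseteq> ?cubic" "{p} \<subseteq> ?pendant" using cubic(1) pendant by simp_all
  moreover have "deg H u = 2" if u: "u \<in> verts H - {a, b, c, p}" for u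
  proof -
    have "u \<notin> ?cubic" "u \<notin> ?pendant" using u cubic(1) pendant by auto
    then show ?thesis using u deg by auto
  qed
  ultimately have "mate_degrees H a b c p" using cubic(2-4) unfolding mate_degrees_def by auto
  then show thesis by (rule that)
qed

lemma cospectral_rose_degrees_cases:
  assumes kl: "k \<ge> 3" "l \<ge> 3" and cosp: "cospectral H (rose k l)"
  obtains (rose) v where "v \<in> verts H" "deg H v = 4" "\<forall>u\<in>verts H - {v}. deg H u = 2"
  | (mate) a b c p where "mate_degrees H a b c p"
proof (cases "\<exists>v\<in>verts H. deg H v \<ge> 4")
  case True
  note H = simple_graph_if_cospectral_rose[OF kl cosp] and sums = sum_deviations_cospectral_rose[OF kl cosp]
  obtain v where v: "v \<in> verts H" "int (deg H v) - 2 \<ge> 2" using True by force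
  have "(\<Sum>u\<in>verts H. (int (deg H u) - 2)\<^sup>2) \<le> (int (deg H v) - 2)\<^sup>2"
    unfolding sums(2) using power_mono[OF v(2), of 2] by simp
  note zero = eq_0_if_sum_squares_le[OF finite_verts[OF H] v(1) this]
  have "(\<Sum>u\<in>verts H - {v}. int (deg H u) - 2) = 0" by (rule sum.neutral) (use zero in auto)
  then have "int (deg H v) - 2 = 2"
    using sums(1) sum.remove[OF finite_verts[OF H] v(1), of "\<lambda>u. int (deg H u) - 2"] by simp
  then show thesis using rose[of v] v(1) zero by force
next
  case False
  note H = simple_graph_if_cospectral_rose[OF kl cosp]
  have "\<forall>u\<in>verts H. deg H u \<in> {1, 2, 3}"
  proof
    fix u assume u: "u \<in> verts H"
    have "card (verts H) \<ge> 2" using card_verts_cospectral_rose[OF kl cosp] kl by linarith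
    then have "deg H u \<ge> 1" by (rule graph_connected_deg_pos[OF H connected_if_cospectral_rose[OF kl cosp] _ u])
    then show "deg H u \<in> {1, 2, 3}" using False u by force
  qed
  from mate_degreesE[OF finite_verts[OF H] sum_deviations_cospectral_rose[OF kl cosp] this]
  show thesis using mate .
qed

lemma sum_over_mate:
  fixes g :: "'a \<Rightarrow> int"
  assumes H: "simple_graph H" and m: "mate_degrees H a b c p"
  shows "(\<Sum>u\<in>verts H. g u) = g a + g b + g c + g p + (\<Sum>u\<in>verts H - {a, b, c, p}. g u)"
proof -
  have "distinct [a, b, c, p]" and sub: "{a, b, c, p} \<subseteq> verts H" using m by (auto simp: mate_degrees_def)
  then show ?thesis using sum.subset_diff[OF sub finite_verts[OF H], of g] by simp
qed

lemma card_verts_mate: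
  assumes H: "simple_graph H" and m: "mate_degrees H a b c p"
  shows "int (card (verts H - {a, b, c, p})) = int (card (verts H)) - 4"
  using sum_over_mate[OF H m, of "\<lambda>_. 1"] by simp

lemma sum_deg_mate:
  fixes f :: "int \<Rightarrow> int"
  assumes H: "simple_graph H" and m: "mate_degrees H a b c p"
  shows "(\<Sum>u\<in>verts H. f (int (deg H u))) = 3 * f 3 + f 1 + (int (card (verts H)) - 4) * f 2"
proof -
  have "(\<Sum>u\<in>verts H - {a, b, c, p}. f (int (deg H u))) = (\<Sum>u\<in>verts H - {a, b, c, p}. f 2)"
    using m by (intro sum.cong) (auto simp: mate_degrees_def)
  then show ?thesis
    using sum_over_mate[OF H m, of "\<lambda>u. f (int (deg H u))"] card_verts_mate[OF H m] m
    by (simp add: mate_degrees_def)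
qed

lemma card_triangles_mate:
  assumes kl: "k \<ge> 3" "l \<ge> 3" and cosp: "cospectral H (rose k l)" and m: "mate_degrees H a b c p"
  shows "card (triangles (rose k l)) = card (triangles H) + 6"
proof -
  note H = simple_graph_if_cospectral_rose[OF kl cosp] and R = simple_graph_rose[OF kl]
  show ?thesis
    using cospectral_lap_moment[OF cosp, of 3]
    unfolding lap_moment_3[OF H] lap_moment_3[OF R] sum_deg_mate[OF H m, of "\<lambda>d. d ^ 3 + 3 * d ^ 2"]
      sum_deg_rose[OF kl, of "\<lambda>d. d ^ 3 + 3 * d ^ 2"] card_verts_cospectral_rose[OF kl cosp]
    by (simp add: algebra_simps)
qed

lemma card_four_cycles_mate:
  assumes l: "l \<ge> 4" and cosp: "cospectral H (rose 3 l)" and m: "mate_degrees H a b c p"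
  shows "triangles H = {}"
    and "int (card (four_cycles H)) + 2 * deviation_form H = int (card (four_cycles (rose 3 l))) + 20"
proof -
  have kl: "3 \<ge> (3::nat)" "l \<ge> 3" using l by auto
  note H = simple_graph_if_cospectral_rose[OF kl cosp] and R = simple_graph_rose[OF kl]
  have "card (triangles (rose 3 l)) = 6"
    using triangles_rose[OF kl] l card_orderings[of 0 1 "2 :: nat"] by simp
  then show no_triangle: "triangles H = {}"
    using card_triangles_mate[OF kl cosp m] finite_triangles[OF H] by simp
  have "(\<Sum>(u, w, z)\<in>triangles (rose 3 l). int (deg (rose 3 l) u) + int (deg (rose 3 l) w)) = 32"
    using triangles_rose[OF kl] l by (simp add: orderings_def deg_rose)
  then show "int (card (four_cycles H)) + 2 * deviation_form H = int (card (four_cycles (rose 3 l))) + 20"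
    using cospectral_lap_moment[OF cosp, of 4]
    unfolding lap_moment_4[OF H] lap_moment_4[OF R]
      sum_deg_mate[OF H m, of "\<lambda>d. d ^ 4 + 4 * d ^ 3 + 10 * d ^ 2 - 9 * d"]
      sum_deg_rose[OF kl, of "\<lambda>d. d ^ 4 + 4 * d ^ 3 + 10 * d ^ 2 - 9 * d"]
      card_verts_cospectral_rose[OF kl cosp] deviation_form_rose[OF kl] no_triangle
    by (simp add: algebra_simps)
qed

lemma deviation_form_mate:
  assumes H: "simple_graph H" and m: "mate_degrees H a b c p"
  shows "deviation_form H = 2 * (of_bool (b \<in> nbrs H a) + of_bool (c \<in> nbrs H b) + of_bool (a \<in> nbrs H c)
    - of_bool (p \<in> nbrs H a) - of_bool (p \<in> nbrs H b) - of_bool (p \<in> nbrs H c))"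
proof -
  let ?x = "\<lambda>u. int (deg H u) - 2" and ?e = "\<lambda>u w. of_bool (w \<in> nbrs H u) :: int"
  have x: "?x a = 1" "?x b = 1" "?x c = 1" "?x p = - 1" "\<And>u. u \<in> verts H - {a, b, c, p} \<Longrightarrow> ?x u = 0"
    using m by (auto simp: mate_degrees_def)
  have sum_x: "(\<Sum>u\<in>verts H. ?x u * g u) = g a + g b + g c - g p" for g
    using sum_over_mate[OF H m, of "\<lambda>u. ?x u * g u"] x by simp
  have sum_nbrs_x: "(\<Sum>w\<in>nbrs H u. ?x u * ?x w) = ?x u * (?e u a + ?e u b + ?e u c - ?e u p)" for u
  proof -
    have "(\<Sum>w\<in>nbrs H u. ?x u * ?x w) = (\<Sum>w\<in>verts H. ?x w * (?x u * ?e u w))"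
      using finite_verts[OF H] nbrs_subset_verts[OF H, of u] by (intro sum.mono_neutral_cong_left) auto
    then show ?thesis unfolding sum_x by (simp add: algebra_simps)
  qed
  have irrefl: "?e u u = 0" for u using not_self_nbr[OF H, of u] by simp
  have sym: "?e u w = ?e w u" for u w by (simp add: nbrs_commute[of u H w])
  have "deviation_form H = (?e a a + ?e a b + ?e a c - ?e a p) + (?e b a + ?e b b + ?e b c - ?e b p)
    + (?e c a + ?e c b + ?e c c - ?e c p) - (?e p a + ?e p b + ?e p c - ?e p p)"
    unfolding deviation_form_def sum_nbrs_x sum_x ..
  then show ?thesis
    by (simp add: irrefl sym[of b a] sym[of c b] sym[of a c] sym[of p a] sym[of p b] sym[of p c])
qed

section \<open>Disjoint 4-cycles\<close>

lemma sum_boundary_harmonic: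
  fixes f :: "'a \<Rightarrow> 'r :: comm_ring_1"
  assumes G: "simple_graph G" and f: "harmonic G f" and S: "S \<subseteq> verts G"
  shows "(\<Sum>u\<in>S. \<Sum>w\<in>nbrs G u - S. f w - f u) = 0"
proof -
  have fin: "finite S" using S finite_verts[OF G] by (rule finite_subset)
  have restrict: "(\<Sum>w\<in>nbrs G u \<inter> S. g w) = (\<Sum>w\<in>S. if w \<in> nbrs G u then g w else 0)" for u and g :: "'a \<Rightarrow> 'r"
    using fin by (simp add: sum.If_cases Int_commute)
  have "(\<Sum>u\<in>S. \<Sum>w\<in>nbrs G u \<inter> S. f w) = (\<Sum>u\<in>S. \<Sum>w\<in>S. if w \<in> nbrs G u then f w else 0)"
    by (simp add: restrict)
  also have "\<dots> = (\<Sum>w\<in>S. \<Sum>u\<in>S. if u \<in> nbrs G w then f w else 0)"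
    by (subst sum.swap) (simp add: nbrs_commute)
  also have "\<dots> = (\<Sum>u\<in>S. \<Sum>w\<in>nbrs G u \<inter> S. f u)" by (simp only: restrict)
  finally have inner: "(\<Sum>u\<in>S. \<Sum>w\<in>nbrs G u \<inter> S. f w - f u) = 0" by (simp add: sum_subtractf)
  have "0 = (\<Sum>u\<in>S. \<Sum>w\<in>nbrs G u. f w - f u)"
    using f S by (intro sum.neutral[symmetric]) (auto simp: harmonic_def)
  also have "\<dots> = (\<Sum>u\<in>S. (\<Sum>w\<in>nbrs G u \<inter> S. f w - f u) + (\<Sum>w\<in>nbrs G u - S. f w - f u))"
    by (intro sum.cong refl sum.Int_Diff finite_nbrs[OF G])
  finally show ?thesis by (simp add: sum.distrib inner)
qed

lemma harmonic_eq_across_bridge: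
  fixes f :: "'a \<Rightarrow> 'r :: comm_ring_1"
  assumes G: "simple_graph G" and f: "harmonic G f" and S: "S \<subseteq> verts G" and st: "s \<in> S" "t \<in> nbrs G s - S"
    and bridge: "\<And>u w. u \<in> S \<Longrightarrow> w \<in> nbrs G u - S \<Longrightarrow> u = s \<and> w = t"
  shows "f s = f t"
proof -
  have fin: "finite S" using S finite_verts[OF G] by (rule finite_subset)
  have "nbrs G s - S = {t}" using st bridge by blast
  moreover have "(\<Sum>u\<in>S - {s}. \<Sum>w\<in>nbrs G u - S. f w - f u) = 0"
    using bridge by (intro sum.neutral ballI) blast
  ultimately have "(\<Sum>u\<in>S. \<Sum>w\<in>nbrs G u - S. f w - f u) = f t - f s"
    using sum.remove[OF fin st(1), of "\<lambda>u. \<Sum>w\<in>nbrs G u - S. f w - f u"] by simp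
  then show ?thesis using sum_boundary_harmonic[OF G f S] by simp
qed

lemma card_le_Suc_card_edges:
  fixes V :: "'a set"
  assumes fin: "finite V" "finite E" and "V \<noteq> {}"
    and cut: "\<And>S. S \<subseteq> V \<Longrightarrow> S \<noteq> {} \<Longrightarrow> S \<noteq> V \<Longrightarrow> \<exists>u\<in>S. \<exists>w\<in>V - S. {u, w} \<in> E"
  shows "card V \<le> Suc (card E)"
proof -
  have "\<exists>S\<subseteq>V. card S = Suc n \<and> n \<le> card {e \<in> E. e \<subseteq> S}" if "Suc n \<le> card V" for n
    using that
  proof (induction n)
    case 0
    obtain v where "v \<in> V" using \<open>V \<noteq> {}\<close> by blast
    then show ?case by (intro exI[of _ "{v}"]) simp
  next
    case (Suc n)
    then obtain S where S: "S \<subseteq> V" "card S = Suc n" "n \<le> card {e \<in> E. e \<subseteq> S}" by auto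
    have "finite S" using S(1) fin(1) by (rule finite_subset)
    have "S \<noteq> {}" "S \<noteq> V" using S Suc.prems by auto
    then obtain u w where uw: "u \<in> S" "w \<in> V - S" "{u, w} \<in> E" using cut S(1) by blast
    have "Suc n \<le> card (insert {u, w} {e \<in> E. e \<subseteq> S})"
      using uw fin S(3) by (subst card_insert_disjoint) auto
    also have "\<dots> \<le> card {e \<in> E. e \<subseteq> insert w S}"
      using uw fin by (intro card_mono) auto
    finally show ?case using S uw \<open>finite S\<close> by (intro exI[of _ "insert w S"]) auto
  qed
  from this[of "card V - 1"] obtain S where "S \<subseteq> V" "card V - 1 \<le> card {e \<in> E. e \<subseteq> S}"
    using \<open>V \<noteq> {}\<close> fin by (auto simp: card_gt_0_iff Suc_le_eq)
  moreover have "card {e \<in> E. e \<subseteq> S} \<le> card E" using fin by (intro card_mono) auto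
  ultimately show ?thesis by linarith
qed

lemma four_cycles_rotate:
  assumes "(u, x, w, y) \<in> four_cycles G"
  shows "(x, w, y, u) \<in> four_cycles G"
  using assms nbrs_sym[of _ G] by (auto simp: four_cycles_def)

lemma four_cyclesD:
  assumes "simple_graph G" "(u, x, w, y) \<in> four_cycles G"
  shows "distinct [u, x, w, y]" "{u, x, w, y} \<subseteq> verts G"
    "x \<in> nbrs G u" "w \<in> nbrs G x" "y \<in> nbrs G w" "u \<in> nbrs G y"
proof -
  show adj: "x \<in> nbrs G u" "w \<in> nbrs G x" "y \<in> nbrs G w" "u \<in> nbrs G y"
    using assms(2) nbrs_sym[of _ G] by (auto simp: four_cycles_def)
  show "distinct [u, x, w, y]"
    using adj[THEN nbr_neq[OF assms(1)]] assms(2) by (auto simp: four_cycles_def)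
  show "{u, x, w, y} \<subseteq> verts G"
    using adj[THEN in_verts_if_nbr(1)[OF assms(1)]] by simp
qed

definition four_cycle_edges :: "'a \<times> 'a \<times> 'a \<times> 'a \<Rightarrow> 'a set set" where
  "four_cycle_edges = (\<lambda>(u, x, w, y). {{u, x}, {x, w}, {w, y}, {y, u}})"

lemma harmonic_four_cycle_corner:
  fixes f :: "'a \<Rightarrow> 'r :: comm_ring_1"
  assumes G: "simple_graph G" and f: "harmonic G f" and C: "(u, x, w, y) \<in> four_cycles G"
    and off: "\<And>t. t \<in> nbrs G u \<Longrightarrow> {u, t} \<notin> four_cycle_edges (u, x, w, y) \<Longrightarrow> f t = f u"
  shows "f x + f y = 2 * f u"
proof -
  note cyc = four_cyclesD[OF G C]
  have "0 = (\<Sum>t\<in>nbrs G u. f t - f u)" using f cyc(2) by (simp add: harmonic_def)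
  also have "\<dots> = (\<Sum>t\<in>{x, y}. f t - f u)"
  proof (rule sum.mono_neutral_right[OF finite_nbrs[OF G]])
    show "{x, y} \<subseteq> nbrs G u" using cyc(3,6) nbrs_sym by fast
    show "\<forall>t\<in>nbrs G u - {x, y}. f t - f u = 0"
      using off cyc(1) by (auto simp: four_cycle_edges_def doubleton_eq_iff)
  qed
  finally show ?thesis using cyc(1) by (simp add: algebra_simps)
qed

lemma harmonic_const_on_four_cycle:
  fixes f :: "'a \<Rightarrow> 'k :: field"
  assumes G: "simple_graph G" and f: "harmonic G f" and two: "(2 :: 'k) \<noteq> 0" and C: "(u, x, w, y) \<in> four_cycles G"
    and off: "\<And>s t. t \<in> nbrs G s \<Longrightarrow> {s, t} \<notin> four_cycle_edges (u, x, w, y) \<Longrightarrow> s \<in> {u, x, w, y} \<Longrightarrow> f t = f s"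
  shows "f x = f u" "f w = f u" "f y = f u"
proof -
  note corner = harmonic_four_cycle_corner[OF G f]
  have rotate: "four_cycle_edges (x, w, y, u) = four_cycle_edges (u, x, w, y)"
    "four_cycle_edges (w, y, u, x) = four_cycle_edges (u, x, w, y)"
    by (auto simp: four_cycle_edges_def)
  have C': "(x, w, y, u) \<in> four_cycles G" "(w, y, u, x) \<in> four_cycles G"
    using C four_cycles_rotate by metis+
  have sums: "f x + f y = 2 * f u" "f w + f u = 2 * f x" "f y + f x = 2 * f w"
    using corner[OF C] corner[OF C'(1)] corner[OF C'(2)] off unfolding rotate by simp_all
  have "2 * f w = 2 * f u" unfolding sums(1,3)[symmetric] by (rule add.commute)
  then show w: "f w = f u" by (rule mult_left_cancel[OF two, THEN iffD1])
  have "2 * f x = 2 * f u" unfolding sums(2)[symmetric] w by (rule mult_2[symmetric])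
  then show x: "f x = f u" by (rule mult_left_cancel[OF two, THEN iffD1])
  show "f y = f u" using sums(1) unfolding x mult_2 by simp
qed

lemma cut_within_edge_setE:
  assumes H: "simple_graph H" "verts H \<noteq> {}" and D: "D \<subseteq> edges H" "Suc (card (edges H)) < card (verts H) + card D"
  obtains S where "S \<subseteq> verts H" "S \<noteq> {}" "S \<noteq> verts H" "\<forall>a\<in>S. \<forall>b\<in>nbrs H a - S. {a, b} \<in> D"
proof -
  note fin = finite_edges[OF H(1)]
  have "card (edges H - D) + card D = card (edges H)"
    using card_Diff_subset[OF finite_subset[OF D(1) fin] D(1)] card_mono[OF fin D(1)] by simp
  then have "Suc (card (edges H - D)) < card (verts H)" using D(2) by linarith
  moreover have "card (verts H) \<le> Suc (card (edges H - D))"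
    if "\<And>S. S \<subseteq> verts H \<Longrightarrow> S \<noteq> {} \<Longrightarrow> S \<noteq> verts H \<Longrightarrow> \<exists>a\<in>S. \<exists>b\<in>verts H - S. {a, b} \<in> edges H - D"
    using card_le_Suc_card_edges[OF finite_verts[OF H(1)] _ H(2) that] fin by auto
  ultimately obtain S where S: "S \<subseteq> verts H" "S \<noteq> {}" "S \<noteq> verts H"
    and no_cut: "\<forall>a\<in>S. \<forall>b\<in>verts H - S. {a, b} \<notin> edges H - D"
    by (meson not_le)
  have "\<forall>a\<in>S. \<forall>b\<in>nbrs H a - S. {a, b} \<in> D"
    using no_cut in_verts_if_nbr(2)[OF H(1)] unfolding nbrs_def by blast
  then show thesis by (rule that[OF S])
qed

lemma four_cycle_edge_within_side:
  assumes H: "simple_graph H" and C: "(u, x, w, y) \<in> four_cycles H"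
    and cut: "\<forall>a\<in>S. \<forall>b\<in>nbrs H a - S. {a, b} \<in> D" and D: "{x, w} \<notin> D" "{w, y} \<notin> D" "{y, u} \<notin> D"
  shows "u \<in> S \<longleftrightarrow> x \<in> S"
proof -
  have same_side: "a \<in> S \<longleftrightarrow> b \<in> S" if ab: "b \<in> nbrs H a" "{a, b} \<notin> D" for a b
  proof -
    have "{b, a} \<notin> D" using ab(2) by (simp add: insert_commute)
    then show ?thesis using cut ab nbrs_sym[OF ab(1)] by blast
  qed
  show ?thesis using same_side[OF _ D(1)] same_side[OF _ D(2)] same_side[OF _ D(3)] four_cyclesD(4-6)[OF H C] by simp
qed

text \<open>Deleting \<open>{s, t}\<close> and one edge of each 4-cycle leaves too few edges for a connected graph, and a
  4-cycle cannot cross the resulting cut exactly once.\<close>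

lemma bridge_off_disjoint_four_cyclesE:
  assumes H: "simple_graph H" and m: "card (edges H) = Suc (card (verts H))"
    and C: "(u, x, w, y) \<in> four_cycles H" and C': "(u', x', w', y') \<in> four_cycles H"
    and disj: "{u, x, w, y} \<inter> {u', x', w', y'} = {}"
    and st: "{s, t} \<in> edges H" "{s, t} \<notin> four_cycle_edges (u, x, w, y)" "{s, t} \<notin> four_cycle_edges (u', x', w', y')"
  obtains S where "S \<subseteq> verts H" "S \<noteq> {}" "S \<noteq> verts H" "\<forall>a\<in>S. \<forall>b\<in>nbrs H a - S. {a, b} = {s, t}"
proof -
  note cyc = four_cyclesD[OF H C] and cyc' = four_cyclesD[OF H C']
  define D where "D = {{s, t}, {u, x}, {u', x'}}"
  have "{u, x} \<noteq> {u', x'}" using disj by (auto simp: doubleton_eq_iff)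
  then have "card D = 3" using st(2,3) unfolding D_def four_cycle_edges_def by auto
  then have "Suc (card (edges H)) < card (verts H) + card D" using m by simp
  moreover have "D \<subseteq> edges H" "verts H \<noteq> {}"
    using st(1) cyc(2,3) cyc'(3) by (auto simp: D_def nbrs_def)
  ultimately obtain S where S: "S \<subseteq> verts H" "S \<noteq> {}" "S \<noteq> verts H"
    and cut: "\<forall>a\<in>S. \<forall>b\<in>nbrs H a - S. {a, b} \<in> D"
    using cut_within_edge_setE[OF H] by metis
  have not_st: "{s, t} \<noteq> e" if "e \<in> four_cycle_edges (u, x, w, y) \<union> four_cycle_edges (u', x', w', y')" for e
    using that st by blast
  have "{x, w} \<notin> D" "{w, y} \<notin> D" "{y, u} \<notin> D"
    using cyc(1) disj not_st[of "{x, w}"] not_st[of "{w, y}"] not_st[of "{y, u}"]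
    by (auto simp: D_def four_cycle_edges_def doubleton_eq_iff)
  then have ux: "u \<in> S \<longleftrightarrow> x \<in> S" by (rule four_cycle_edge_within_side[OF H C cut])
  have "{x', w'} \<notin> D" "{w', y'} \<notin> D" "{y', u'} \<notin> D"
    using cyc'(1) disj not_st[of "{x', w'}"] not_st[of "{w', y'}"] not_st[of "{y', u'}"]
    by (auto simp: D_def four_cycle_edges_def doubleton_eq_iff)
  then have ux': "u' \<in> S \<longleftrightarrow> x' \<in> S" by (rule four_cycle_edge_within_side[OF H C' cut])
  have "\<forall>a\<in>S. \<forall>b\<in>nbrs H a - S. {a, b} = {s, t}"
  proof (intro ballI)
    fix a b assume ab: "a \<in> S" "b \<in> nbrs H a - S"
    then have "{a, b} \<in> D" using cut by blast
    moreover have "{a, b} \<noteq> {u, x}" "{a, b} \<noteq> {u', x'}" using ab ux ux' by (auto simp: doubleton_eq_iff)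
    ultimately show "{a, b} = {s, t}" by (simp add: D_def)
  qed
  then show thesis by (rule that[OF S])
qed

lemma harmonic_eq_off_disjoint_four_cycles:
  fixes f :: "'a \<Rightarrow> 'r :: comm_ring_1"
  assumes H: "simple_graph H" "graph_connected H" and m: "card (edges H) = Suc (card (verts H))"
    and C: "(u, x, w, y) \<in> four_cycles H" and C': "(u', x', w', y') \<in> four_cycles H"
    and disj: "{u, x, w, y} \<inter> {u', x', w', y'} = {}" and f: "harmonic H f"
    and st: "t \<in> nbrs H s" "{s, t} \<notin> four_cycle_edges (u, x, w, y)" "{s, t} \<notin> four_cycle_edges (u', x', w', y')"
  shows "f t = f s"
proof -
  have "{s, t} \<in> edges H" using st(1) by (simp add: nbrs_def)
  from bridge_off_disjoint_four_cyclesE[OF H(1) m C C' disj this st(2,3)]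
  obtain S where S: "S \<subseteq> verts H" "S \<noteq> {}" "S \<noteq> verts H"
    and crossing: "\<forall>a\<in>S. \<forall>b\<in>nbrs H a - S. {a, b} = {s, t}" .
  obtain a b where ab: "a \<in> S" "b \<in> nbrs H a - S"
    using graph_connectedD[OF H(2) S(1,2)] S(3) by blast
  have "f a = f b"
  proof (rule harmonic_eq_across_bridge[OF H(1) f S(1) ab])
    fix c d assume cd: "c \<in> S" "d \<in> nbrs H c - S"
    then have "{c, d} = {a, b}" using crossing ab by metis
    then show "c = a \<and> d = b" using ab cd by (auto simp: doubleton_eq_iff)
  qed
  then show ?thesis using crossing ab by (metis doubleton_eq_iff)
qed

lemma graph_connected_const:
  assumes G: "simple_graph G" "graph_connected G" and edge: "\<And>s t. t \<in> nbrs G s \<Longrightarrow> f t = f s"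
    and "v \<in> verts G" "u \<in> verts G"
  shows "f u = f v"
proof -
  have "{w \<in> verts G. f w = f v} = verts G"
  proof (rule graph_connectedD[OF G(2)])
    show "nbrs G w \<subseteq> {w \<in> verts G. f w = f v}" if "w \<in> {w \<in> verts G. f w = f v}" for w
      using that edge[of _ w] nbrs_subset_verts[OF G(1), of w] by auto
  qed (use assms(4) in auto)
  then show ?thesis using assms(5) by blast
qed

lemma of_int_tree_number_neq_0_if_disjoint_four_cycles:
  assumes H: "simple_graph H" "graph_connected H" and m: "card (edges H) = Suc (card (verts H))"
    and C: "(u, x, w, y) \<in> four_cycles H" and C': "(u', x', w', y') \<in> four_cycles H"
    and disj: "{u, x, w, y} \<inter> {u', x', w', y'} = {}" and two: "(2 :: 'k :: field) \<noteq> 0"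
  shows "(of_int (tree_number H) :: 'k) \<noteq> 0"
proof
  assume zero: "(of_int (tree_number H) :: 'k) = 0"
  have u: "u \<in> verts H" using four_cyclesD(2)[OF H(1) C] by simp
  from zero tree_number_eq_0_iff[OF H(1) u] obtain f :: "'a \<Rightarrow> 'k" and v
    where f: "harmonic H f" and v: "v \<in> verts H" "f v \<noteq> f u" by metis
  note off = harmonic_eq_off_disjoint_four_cycles[OF H m C C' disj f]
  have "{s, t} \<notin> four_cycle_edges (u', x', w', y')" if "s \<in> {u, x, w, y}" for s t
    using that disj by (auto simp: four_cycle_edges_def doubleton_eq_iff)
  then have const: "f x = f u" "f w = f u" "f y = f u"
    using harmonic_const_on_four_cycle[OF H(1) f two C] off by metis+
  have "{s, t} \<notin> four_cycle_edges (u, x, w, y)" if "s \<in> {u', x', w', y'}" for s t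
    using that disj by (auto simp: four_cycle_edges_def doubleton_eq_iff)
  then have const': "f x' = f u'" "f w' = f u'" "f y' = f u'"
    using harmonic_const_on_four_cycle[OF H(1) f two C'] off by metis+
  have "f t = f s" if t: "t \<in> nbrs H s" for s t
  proof (cases "{s, t} \<in> four_cycle_edges (u, x, w, y) \<or> {s, t} \<in> four_cycle_edges (u', x', w', y')")
    case True
    then show ?thesis using const const' by (auto simp: four_cycle_edges_def doubleton_eq_iff)
  next
    case False
    then show ?thesis using off[OF t] by simp
  qed
  then have "f v = f u" by (rule graph_connected_const[OF H _ u v(1)])
  then show False using v(2) by contradiction
qed

lemma not_3_dvd_tree_number_if_disjoint_four_cycles:
  assumes "simple_graph H" "graph_connected H" "card (edges H) = Suc (card (verts H))"
    and "(u, x, w, y) \<in> four_cycles H" "(u', x', w', y') \<in> four_cycles H"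
    and "{u, x, w, y} \<inter> {u', x', w', y'} = {}"
  shows "\<not> 3 dvd tree_number H"
proof
  have "(3 :: Enum.finite_3) = 2 + 1" by (simp only: numeral.simps add_One)
  then have "(3 :: Enum.finite_3) = 0" by (simp add: plus_finite_3_def one_finite_3_def zero_finite_3_def)
  moreover assume "3 dvd tree_number H"
  ultimately have "(of_int (tree_number H) :: Enum.finite_3) = 0" by (auto elim!: dvdE)
  then show False
    using of_int_tree_number_neq_0_if_disjoint_four_cycles[OF assms, where ?'k = Enum.finite_3]
    by (simp add: zero_finite_3_def)
qed

section \<open>Intersecting 4-cycles\<close>

definition diagonals :: "'a \<times> 'a \<times> 'a \<times> 'a \<Rightarrow> 'a set set" where
  "diagonals = (\<lambda>(u, x, w, y). {{u, w}, {x, y}})"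

lemma diagonals_rotate: "diagonals (x, w, y, u) = diagonals (u, x, w, y)"
  by (auto simp: diagonals_def)

lemma diagonals_reflect: "diagonals (u, y, w, x) = diagonals (u, x, w, y)"
  by (simp add: diagonals_def insert_commute)

lemma four_cycles_reflect: "(u, x, w, y) \<in> four_cycles G \<Longrightarrow> (u, y, w, x) \<in> four_cycles G"
  by (auto simp: four_cycles_def)

lemma card_diagonals_fibre:
  assumes G: "simple_graph G" and C: "(u, x, w, y) \<in> four_cycles G"
  shows "card {t \<in> four_cycles G. diagonals t = diagonals (u, x, w, y)} = 8"
proof -
  define R where "R = {(u, x, w, y), (u, y, w, x), (w, x, u, y), (w, y, u, x),
    (x, u, y, w), (x, w, y, u), (y, u, x, w), (y, w, x, u)}"
  note adj = four_cyclesD(3-6)[OF G C]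
  note adj_sym = adj[THEN nbrs_sym]
  have "{t \<in> four_cycles G. diagonals t = diagonals (u, x, w, y)} = R"
  proof (intro equalityI subsetI)
    fix t assume "t \<in> R"
    then show "t \<in> {t \<in> four_cycles G. diagonals t = diagonals (u, x, w, y)}"
      using C adj adj_sym by (auto simp: R_def four_cycles_def diagonals_def)
  next
    fix t assume "t \<in> {t \<in> four_cycles G. diagonals t = diagonals (u, x, w, y)}"
    moreover obtain p q r s where "t = (p, q, r, s)" by (cases t)
    ultimately have t: "t = (p, q, r, s)" "{{p, r}, {q, s}} = {{u, w}, {x, y}}" by (auto simp: diagonals_def)
    from t(2) have "{p, r} = {u, w} \<and> {q, s} = {x, y} \<or> {p, r} = {x, y} \<and> {q, s} = {u, w}"
      by (simp only: doubleton_eq_iff[of "{p, r}"])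
    then show "t \<in> R" unfolding doubleton_eq_iff by (elim disjE conjE) (simp_all add: t(1) R_def)
  qed
  then show ?thesis using four_cyclesD(1)[OF G C] by (simp add: R_def)
qed

lemma finite_four_cycles:
  assumes "simple_graph G"
  shows "finite (four_cycles G)"
proof (rule finite_subset)
  show "four_cycles G \<subseteq> verts G \<times> verts G \<times> verts G \<times> verts G"
    using four_cyclesD(2)[OF assms] by auto
  show "finite (verts G \<times> verts G \<times> verts G \<times> verts G)" by (simp add: finite_verts[OF assms])
qed

lemma card_four_cycles_dvd:
  assumes G: "simple_graph G"
  shows "8 dvd card (four_cycles G)"
proof -
  have "card (four_cycles G) = (\<Sum>D\<in>diagonals ` four_cycles G. card {t \<in> four_cycles G. diagonals t = D})"
    using sum.image_gen[OF finite_four_cycles[OF G], of "\<lambda>_. 1::nat" diagonals] by simp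
  also have "\<dots> = (\<Sum>D\<in>diagonals ` four_cycles G. 8)"
    using card_diagonals_fibre[OF G] by (intro sum.cong refl) auto
  finally show ?thesis by simp
qed

lemma distinct_four_cyclesE:
  assumes G: "simple_graph G" and "card (four_cycles G) > 8"
  obtains u x w y u' x' w' y' where "(u, x, w, y) \<in> four_cycles G" "(u', x', w', y') \<in> four_cycles G"
    "diagonals (u, x, w, y) \<noteq> diagonals (u', x', w', y')"
proof -
  have "four_cycles G \<noteq> {}" using assms(2) by auto
  then obtain u x w y where C: "(u, x, w, y) \<in> four_cycles G" by (auto simp: ex_in_conv[symmetric])
  have "four_cycles G \<noteq> {t \<in> four_cycles G. diagonals t = diagonals (u, x, w, y)}"
    using card_diagonals_fibre[OF G C] assms(2) by force
  then obtain t where "t \<in> four_cycles G" "diagonals t \<noteq> diagonals (u, x, w, y)" by blast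
  moreover obtain u' x' w' y' where "t = (u', x', w', y')" by (cases t)
  ultimately show thesis using that[OF C] by metis
qed

lemma four_cycles_start_atE:
  assumes C: "(u, x, w, y) \<in> four_cycles G" and "a \<in> {u, x, w, y}"
  obtains x1 w1 y1 where "(a, x1, w1, y1) \<in> four_cycles G"
    "diagonals (a, x1, w1, y1) = diagonals (u, x, w, y)"
proof -
  note C1 = four_cycles_rotate[OF C]
  note C2 = four_cycles_rotate[OF C1]
  note C3 = four_cycles_rotate[OF C2]
  consider "a = u" | "a = x" | "a = w" | "a = y" using assms(2) by auto
  then show thesis
  proof cases
    case 1
    then show thesis using that C by simp
  next
    case 2
    then show thesis using that C1 diagonals_rotate[of x w y u] by simp
  next
    case 3
    then show thesis using that C2 diagonals_rotate[of x w y u] diagonals_rotate[of w y u x] by simp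
  next
    case 4
    then show thesis
      using that C3 diagonals_rotate[of x w y u] diagonals_rotate[of w y u x] diagonals_rotate[of y u x w] by simp
  qed
qed

lemma four_cycles_common_edgeE:
  assumes G: "simple_graph G" and C: "(u, x, w, y) \<in> four_cycles G" and C': "(u', x', w', y') \<in> four_cycles G"
    and a: "a \<in> {u, x, w, y}" "a \<in> {u', x', w', y'}" and deg: "deg G a \<le> 3"
  obtains b w1 y1 w2 y2 where "(a, b, w1, y1) \<in> four_cycles G" "(a, b, w2, y2) \<in> four_cycles G"
    "diagonals (a, b, w1, y1) = diagonals (u, x, w, y)" "diagonals (a, b, w2, y2) = diagonals (u', x', w', y')"
proof -
  obtain x1 w1 y1 where C1: "(a, x1, w1, y1) \<in> four_cycles G"
    and d1: "diagonals (a, x1, w1, y1) = diagonals (u, x, w, y)"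
    using four_cycles_start_atE[OF C a(1)] .
  obtain x2 w2 y2 where C2: "(a, x2, w2, y2) \<in> four_cycles G"
    and d2: "diagonals (a, x2, w2, y2) = diagonals (u', x', w', y')"
    using four_cycles_start_atE[OF C' a(2)] .
  have "{x1, y1} \<inter> {x2, y2} \<noteq> {}"
  proof
    assume "{x1, y1} \<inter> {x2, y2} = {}"
    then have "card {x1, y1, x2, y2} = 4" using C1 C2 by (auto simp: four_cycles_def)
    moreover have "{x1, y1, x2, y2} \<subseteq> nbrs G a" using C1 C2 by (auto simp: four_cycles_def)
    then have "card {x1, y1, x2, y2} \<le> deg G a" unfolding deg_def by (rule card_mono[OF finite_nbrs[OF G]])
    ultimately show False using deg by simp
  qed
  then consider "x1 = x2" | "x1 = y2" | "y1 = x2" | "y1 = y2" by blast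
  then show thesis
  proof cases
    case 1
    then show thesis using that C1 C2 d1 d2 by blast
  next
    case 2
    then show thesis using that C1 four_cycles_reflect[OF C2] d1 d2 diagonals_reflect[of a y2 w2 x2] by metis
  next
    case 3
    then show thesis using that four_cycles_reflect[OF C1] C2 d1 d2 diagonals_reflect[of a y1 w1 x1] by metis
  next
    case 4
    then show thesis
      using that four_cycles_reflect[OF C1] four_cycles_reflect[OF C2] d1 d2
        diagonals_reflect[of a y1 w1 x1] diagonals_reflect[of a y2 w2 x2] by metis
  qed
qed

lemma four_cycles_on_common_edge_cases:
  assumes G: "simple_graph G" and no_triangle: "triangles G = {}"
    and C: "(a, b, w, y) \<in> four_cycles G" and C': "(a, b, w', y') \<in> four_cycles G" and neq: "(w, y) \<noteq> (w', y')"
  obtains (k23) u v x y z where "u \<noteq> v" "distinct [x, y, z]" "{x, y, z} \<subseteq> nbrs G u \<inter> nbrs G v"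
  | (ladder) "distinct [a, b, w, y, w', y']"
proof -
  note cyc = four_cyclesD[OF G C] and cyc' = four_cyclesD[OF G C']
  consider "y = y'" "w \<noteq> w'" | "y \<noteq> y'" "w = w'" | "y \<noteq> y'" "w \<noteq> w'" using neq by blast
  then show thesis
  proof cases
    case 1
    have "{a, w, w'} \<subseteq> nbrs G b \<inter> nbrs G y"
      using cyc(3-6) cyc'(3-6) nbrs_sym[OF cyc(3)] nbrs_sym[OF cyc(5)] nbrs_sym[OF cyc'(5)] 1(1) by auto
    then show thesis using k23[of b y a w w'] 1(2) cyc(1) cyc'(1) by auto
  next
    case 2
    have "{b, y, y'} \<subseteq> nbrs G a \<inter> nbrs G w"
      using cyc(3-6) cyc'(3-6) nbrs_sym[OF cyc(4)] nbrs_sym[OF cyc(6)] nbrs_sym[OF cyc'(6)] 2(2) by auto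
    then show thesis using k23[of a w b y y'] 2(1) cyc(1) cyc'(1) by auto
  next
    case 3
    have no_common: "z \<notin> nbrs G b" if "z \<in> nbrs G a" for z
    proof -
      have "(a, b, z) \<notin> triangles G" using no_triangle by simp
      then show ?thesis using that cyc(3) by (simp add: triangles_def)
    qed
    have "y \<notin> nbrs G b" "y' \<notin> nbrs G b"
      using no_common[OF nbrs_sym[OF cyc(6)]] no_common[OF nbrs_sym[OF cyc'(6)]] .
    then have "w \<noteq> y'" "w' \<noteq> y" using cyc(4) cyc'(4) by auto
    then show thesis using ladder 3 cyc(1) cyc'(1) by simp
  qed
qed

lemma two_four_cycles_cases:
  assumes G: "simple_graph G" and deg: "\<forall>u\<in>verts G. deg G u \<le> 3" and no_triangle: "triangles G = {}"
    and card: "card (four_cycles G) > 8"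
  obtains (disjoint) u x w y u' x' w' y' where "(u, x, w, y) \<in> four_cycles G" "(u', x', w', y') \<in> four_cycles G"
    "{u, x, w, y} \<inter> {u', x', w', y'} = {}"
  | (k23) u w x y z where "u \<noteq> w" "distinct [x, y, z]" "{x, y, z} \<subseteq> nbrs G u \<inter> nbrs G w"
  | (ladder) u x w y w' y' where "(u, x, w, y) \<in> four_cycles G" "(u, x, w', y') \<in> four_cycles G"
    "distinct [u, x, w, y, w', y']"
proof -
  obtain u x w y u' x' w' y' where C: "(u, x, w, y) \<in> four_cycles G" and C': "(u', x', w', y') \<in> four_cycles G"
    and neq: "diagonals (u, x, w, y) \<noteq> diagonals (u', x', w', y')"
    using distinct_four_cyclesE[OF G card] .
  show thesis
  proof (cases "{u, x, w, y} \<inter> {u', x', w', y'} = {}")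
    case True
    then show thesis by (rule disjoint[OF C C'])
  next
    case False
    then obtain a where a: "a \<in> {u, x, w, y}" "a \<in> {u', x', w', y'}" by (meson disjoint_iff)
    then have "deg G a \<le> 3" using deg four_cyclesD(2)[OF G C] by blast
    then obtain b w1 y1 w2 y2 where C1: "(a, b, w1, y1) \<in> four_cycles G" and C2: "(a, b, w2, y2) \<in> four_cycles G"
      and "diagonals (a, b, w1, y1) = diagonals (u, x, w, y)" "diagonals (a, b, w2, y2) = diagonals (u', x', w', y')"
      using four_cycles_common_edgeE[OF G C C' a] by blast
    then have "(w1, y1) \<noteq> (w2, y2)" using neq by auto
    from G no_triangle C1 C2 this show thesis
      by (cases rule: four_cycles_on_common_edge_cases) (use k23 ladder[OF C1 C2] in blast)+
  qed
qed

section \<open>The cospectral mates\<close>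

definition edge_list_graph :: "nat \<Rightarrow> (nat \<times> nat) list \<Rightarrow> nat ugraph" where
  "edge_list_graph n es = ({0..<n}, (\<lambda>(i, j). {i, j}) ` set es)"

definition edge_list_on :: "nat \<Rightarrow> (nat \<times> nat) list \<Rightarrow> bool" where
  "edge_list_on n es \<longleftrightarrow> (\<forall>(i, j)\<in>set es. i < n \<and> j < n \<and> i \<noteq> j)"

definition adj_list :: "nat \<Rightarrow> (nat \<times> nat) list \<Rightarrow> nat \<Rightarrow> nat list" where
  "adj_list n es i = filter (\<lambda>j. (i, j) \<in> set es \<or> (j, i) \<in> set es) [0..<n]"

lemma verts_edge_list_graph: "verts (edge_list_graph n es) = {0..<n}"
  by (simp add: edge_list_graph_def)

lemma simple_graph_edge_list_graph: "edge_list_on n es \<Longrightarrow> simple_graph (edge_list_graph n es)"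
  by (auto simp: simple_graph_def edge_list_graph_def edge_list_on_def)

lemma nbrs_edge_list_graph:
  assumes "edge_list_on n es"
  shows "nbrs (edge_list_graph n es) i = set (adj_list n es i)"
  using assms by (fastforce simp: nbrs_def edge_list_graph_def adj_list_def edge_list_on_def doubleton_eq_iff)

lemma deg_edge_list_graph:
  assumes "edge_list_on n es"
  shows "deg (edge_list_graph n es) i = length (adj_list n es i)"
  unfolding deg_def nbrs_edge_list_graph[OF assms] by (rule distinct_card) (simp add: adj_list_def)

lemma graph_iso_edge_list_graph:
  assumes H: "simple_graph H" "graph_connected H" and es: "edge_list_on n es" and n: "0 < n"
    and zs: "length zs = n" "distinct zs" "set zs \<subseteq> verts H"
    and edges: "\<forall>(i, j)\<in>set es. zs ! j \<in> nbrs H (zs ! i)"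
    and deg: "map (deg H) zs = map (length \<circ> adj_list n es) [0..<n]"
  shows "graph_iso H (edge_list_graph n es)"
proof -
  let ?G = "edge_list_graph n es"
  have "graph_iso ?G H"
  proof (rule graph_iso_if_saturated_embedding[OF simple_graph_edge_list_graph[OF es] _ H, where f = "(!) zs"])
    show "inj_on ((!) zs) (verts ?G)"
      by (rule inj_on_nth[OF zs(2)]) (simp add: verts_edge_list_graph zs(1))
    show "verts ?G \<noteq> {}" "(!) zs ` verts ?G \<subseteq> verts H"
      using zs n by (auto simp: verts_edge_list_graph)
    show "(!) zs ` e \<in> edges H" if "e \<in> edges ?G" for e
      using that edges by (auto simp: edge_list_graph_def nbrs_def)
    show "deg H (zs ! i) \<le> deg ?G i" if "i \<in> verts ?G" for i
    proof -
      have i: "i < n" using that by (simp add: verts_edge_list_graph)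
      have "map (deg H) zs ! i = map (length \<circ> adj_list n es) [0..<n] ! i" by (simp only: deg)
      then show ?thesis using i zs(1) by (simp add: deg_edge_list_graph[OF es])
    qed
  qed
  then show ?thesis by (rule graph_iso_sym)
qed

text \<open>The complete bipartite graph \<open>K\<^sub>2\<^sub>,\<^sub>3\<close> and the ladder with two squares, each with a pendant vertex.\<close>

definition mate4_edges :: "(nat \<times> nat) list" where
  "mate4_edges = [(0, 2), (0, 3), (0, 4), (1, 2), (1, 3), (1, 4), (2, 5)]"

definition mate5_edges :: "(nat \<times> nat) list" where
  "mate5_edges = [(0, 1), (1, 2), (2, 3), (3, 0), (1, 4), (4, 5), (5, 0), (2, 6)]"

definition mate4 :: "nat ugraph" where
  "mate4 = edge_list_graph 6 mate4_edges"

definition mate5 :: "nat ugraph" where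
  "mate5 = edge_list_graph 7 mate5_edges"

lemma edge_list_on_mates: "edge_list_on 6 mate4_edges" "edge_list_on 7 mate5_edges"
  by (simp_all add: edge_list_on_def mate4_edges_def mate5_edges_def)

lemma mate_degree_lists: "map (length \<circ> adj_list 6 mate4_edges) [0..<6] = [3, 3, 3, 2, 2, 1]"
  "map (length \<circ> adj_list 7 mate5_edges) [0..<7] = [3, 3, 3, 2, 2, 2, 1]"
  by code_simp+

lemma graph_iso_mate4:
  assumes H: "simple_graph H" "graph_connected H"
    and zs: "distinct [u, w, x, y, z, p]" "{u, w, x, y, z, p} \<subseteq> verts H"
    and edges: "{x, y, z} \<subseteq> nbrs H u" "{x, y, z} \<subseteq> nbrs H w" "p \<in> nbrs H x"
    and deg: "map (deg H) [u, w, x, y, z, p] = [3, 3, 3, 2, 2, 1]"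
  shows "graph_iso H mate4"
  unfolding mate4_def
proof (rule graph_iso_edge_list_graph[OF H edge_list_on_mates(1) _ _ zs(1)])
  show "\<forall>(i, j)\<in>set mate4_edges. [u, w, x, y, z, p] ! j \<in> nbrs H ([u, w, x, y, z, p] ! i)"
    using edges by (simp add: mate4_edges_def)
  show "map (deg H) [u, w, x, y, z, p] = map (length \<circ> adj_list 6 mate4_edges) [0..<6]"
    unfolding deg mate_degree_lists ..
qed (use zs(2) in simp_all)

lemma graph_iso_mate5:
  assumes H: "simple_graph H" "graph_connected H"
    and zs: "distinct [u, x, w, y, w', y', p]" "{u, x, w, y, w', y', p} \<subseteq> verts H"
    and edges: "x \<in> nbrs H u" "w \<in> nbrs H x" "y \<in> nbrs H w" "u \<in> nbrs H y"
      "w' \<in> nbrs H x" "y' \<in> nbrs H w'" "u \<in> nbrs H y'" "p \<in> nbrs H w"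
    and deg: "map (deg H) [u, x, w, y, w', y', p] = [3, 3, 3, 2, 2, 2, 1]"
  shows "graph_iso H mate5"
  unfolding mate5_def
proof (rule graph_iso_edge_list_graph[OF H edge_list_on_mates(2) _ _ zs(1)])
  show "\<forall>(i, j)\<in>set mate5_edges. [u, x, w, y, w', y', p] ! j \<in> nbrs H ([u, x, w, y, w', y', p] ! i)"
    using edges by (simp add: mate5_edges_def)
  show "map (deg H) [u, x, w, y, w', y', p] = map (length \<circ> adj_list 7 mate5_edges) [0..<7]"
    unfolding deg mate_degree_lists ..
qed (use zs(2) in simp_all)

text \<open>The last assumption is what the fourth moment leaves of the deviation form.\<close>

locale triangle_free_mate =
  fixes H :: "'a ugraph" and a b c p :: 'a
  assumes simple: "simple_graph H" and connected: "graph_connected H"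
    and degrees: "mate_degrees H a b c p" and no_triangle: "triangles H = {}"
    and deviation: "deviation_form H mod 4 = 2"
begin

lemma deg_le_3: "u \<in> verts H \<Longrightarrow> deg H u \<le> 3"
  using degrees unfolding mate_degrees_def by (cases "u \<in> {a, b, c, p}") auto

lemma pendant_in_verts: "p \<in> verts H"
  using degrees by (simp add: mate_degrees_def)

lemma nbrs_eq_if_three_nbrs:
  assumes "distinct [x, y, z]" "{x, y, z} \<subseteq> nbrs H u"
  shows "nbrs H u = {x, y, z}"
  using assms in_verts_if_nbr(1)[OF simple, of x u] deg_le_3[of u] by (intro nbrs_eqI[OF simple]) auto

lemma deg_eq_3_if_three_nbrs:
  assumes "distinct [x, y, z]" "{x, y, z} \<subseteq> nbrs H u"
  shows "deg H u = 3"
  unfolding deg_def nbrs_eq_if_three_nbrs[OF assms] using assms(1) by simp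

lemma neq_pendant_if_two_nbrs:
  assumes "r \<noteq> s" "{r, s} \<subseteq> nbrs H v"
  shows "v \<noteq> p"
proof
  assume "v = p"
  then have "card (nbrs H v) = 1" using degrees by (simp add: mate_degrees_def deg_def)
  then show False using assms by (auto simp: card_1_singleton_iff)
qed

lemma mate_degrees_if_cubic:
  assumes "distinct [u, w, x]" "deg H u = 3" "deg H w = 3" "deg H x = 3"
  shows "mate_degrees H u w x p"
proof -
  have cubic: "v \<in> {a, b, c}" if "deg H v = 3" for v
  proof -
    have "nbrs H v \<noteq> {}" using that by (auto simp: deg_def)
    then have "v \<in> verts H" using in_verts_if_nbr(1)[OF simple] by blast
    then show ?thesis using degrees that unfolding mate_degrees_def by (cases "v \<in> {a, b, c, p}") auto
  qed
  have "{u, w, x} \<subseteq> {a, b, c}" using assms(2-4)[THEN cubic] by simp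
  moreover have "card {u, w, x} = 3" "card {a, b, c} = 3" using assms(1) degrees by (auto simp: mate_degrees_def)
  ultimately have "{u, w, x} = {a, b, c}" using card_subset_eq[of "{a, b, c}" "{u, w, x}"] by simp
  then have eq: "{u, w, x, p} = {a, b, c, p}" by blast
  have "p \<notin> {u, w, x}" using assms(2-4) degrees by (auto simp: mate_degrees_def)
  then have "distinct [u, w, x, p]" using assms(1) by auto
  moreover have "deg H p = 1" "{u, w, x, p} \<subseteq> verts H" "\<forall>v\<in>verts H - {u, w, x, p}. deg H v = 2"
    using degrees unfolding eq mate_degrees_def by blast+
  ultimately show ?thesis using assms(2-4) unfolding mate_degrees_def by blast
qed

lemma deg_eq_2_if_two_nbrs:
  assumes "mate_degrees H u w x p" "v \<notin> {u, w, x}" "r \<noteq> s" "{r, s} \<subseteq> nbrs H v"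
  shows "deg H v = 2"
  using assms in_verts_if_nbr(1)[OF simple, of r v] neq_pendant_if_two_nbrs[OF assms(3,4)]
  by (auto simp: mate_degrees_def)

lemma pendant_nbr_of_third_cubic:
  assumes "mate_degrees H u w x p" "w \<notin> nbrs H u" "x \<in> nbrs H w" "u \<in> nbrs H x" "p \<notin> nbrs H u" "p \<notin> nbrs H w"
  shows "p \<in> nbrs H x"
proof (rule ccontr)
  assume "p \<notin> nbrs H x"
  then have "deviation_form H = 4" using deviation_form_mate[OF simple assms(1)] assms by simp
  then show False using deviation by simp
qed

lemma outer_nbrE:
  assumes S: "S \<subseteq> verts H" "S \<noteq> {}" "p \<notin> S"
  obtains r q where "r \<in> S" "q \<in> nbrs H r" "q \<notin> S"
proof -
  have "S \<noteq> verts H" using pendant_in_verts S(3) by blast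
  then show thesis using graph_connectedD[OF connected S(1,2)] that by blast
qed

lemma iso_mate4_if_outer_nbr:
  assumes uw: "u \<noteq> w" and xyz: "distinct [x, y, z]" "{x, y, z} \<subseteq> nbrs H u" "{x, y, z} \<subseteq> nbrs H w"
    and q: "q \<in> nbrs H x" "q \<notin> {u, w, x, y, z}"
  shows "graph_iso H mate4"
proof -
  have hub_nbrs: "{u, w} \<subseteq> nbrs H v" if "v \<in> {x, y, z}" for v
    using that xyz(2,3) nbrs_sym[of v H u] nbrs_sym[of v H w] by auto
  have outside: "u \<notin> {x, y, z}" "w \<notin> {x, y, z}" using xyz(2,3) not_self_nbr[OF simple] by auto
  have Nu: "nbrs H u = {x, y, z}" and Nw: "nbrs H w = {x, y, z}" and Nx: "nbrs H x = {u, w, q}"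
    using nbrs_eq_if_three_nbrs[OF xyz(1,2)] nbrs_eq_if_three_nbrs[OF xyz(1,3)] nbrs_eq_if_three_nbrs[of u w q x]
      uw q hub_nbrs[of x] by auto
  have deg: "deg H u = 3" "deg H w = 3" "deg H x = 3"
    using deg_eq_3_if_three_nbrs[OF xyz(1,2)] deg_eq_3_if_three_nbrs[OF xyz(1,3)]
      deg_eq_3_if_three_nbrs[of u w q x] uw q hub_nbrs[of x] by auto
  have m: "mate_degrees H u w x p" using mate_degrees_if_cubic[of u w x] uw outside deg by auto
  have deg2: "deg H y = 2" "deg H z = 2"
    using deg_eq_2_if_two_nbrs[OF m _ uw, of y] deg_eq_2_if_two_nbrs[OF m _ uw, of z] outside xyz(1) hub_nbrs by auto
  have "p \<notin> {x, y, z}" using neq_pendant_if_two_nbrs[OF uw hub_nbrs] by auto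
  then have p: "p \<in> nbrs H x" using pendant_nbr_of_third_cubic[OF m] Nu Nw Nx outside by auto
  have sub: "{u, w, x, y, z, p} \<subseteq> verts H"
    using pendant_in_verts in_verts_if_nbr[OF simple] xyz(2,3) m by (auto simp: mate_degrees_def)
  have "distinct [u, w, x, y, z, p]" using uw xyz(1) outside \<open>p \<notin> {x, y, z}\<close> m by (auto simp: mate_degrees_def)
  then show ?thesis
    by (rule graph_iso_mate4[OF simple connected _ sub xyz(2,3) p]) (use deg deg2 m in \<open>simp add: mate_degrees_def\<close>)
qed

lemma iso_mate4_if_K23:
  assumes uw: "u \<noteq> w" and xyz: "distinct [x, y, z]" "{x, y, z} \<subseteq> nbrs H u" "{x, y, z} \<subseteq> nbrs H w"
  shows "graph_iso H mate4"
proof -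
  have hub_nbrs: "{u, w} \<subseteq> nbrs H v" if "v \<in> {x, y, z}" for v
    using that xyz(2,3) nbrs_sym[of v H u] nbrs_sym[of v H w] by auto
  have "{u, w, x, y, z} \<subseteq> verts H" using in_verts_if_nbr[OF simple] xyz(2,3) by auto
  moreover have "p \<notin> {u, w, x, y, z}"
    using neq_pendant_if_two_nbrs[OF uw hub_nbrs] neq_pendant_if_two_nbrs[of x y u]
      neq_pendant_if_two_nbrs[of x y w] xyz by auto
  ultimately obtain r q where r: "r \<in> {u, w, x, y, z}" "q \<in> nbrs H r" "q \<notin> {u, w, x, y, z}"
    using outer_nbrE[of "{u, w, x, y, z}"] by auto
  moreover have "r \<noteq> u" "r \<noteq> w" using r(2,3)
    nbrs_eq_if_three_nbrs[OF xyz(1,2)] nbrs_eq_if_three_nbrs[OF xyz(1,3)] by auto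
  ultimately consider "r = x" | "r = y" | "r = z" by blast
  then show ?thesis
  proof cases
    case 1
    then show ?thesis using iso_mate4_if_outer_nbr[OF uw xyz] r by auto
  next
    case 2
    then show ?thesis using iso_mate4_if_outer_nbr[of u w y x z q] uw xyz r by auto
  next
    case 3
    then show ?thesis using iso_mate4_if_outer_nbr[of u w z x y q] uw xyz r by auto
  qed
qed

lemma pendant_notin_four_cycle:
  assumes "(u, x, w, y) \<in> four_cycles H"
  shows "p \<notin> {u, x, w, y}"
proof -
  note cyc = four_cyclesD[OF simple assms]
  note sym = cyc(3-6)[THEN nbrs_sym]
  show ?thesis
    using neq_pendant_if_two_nbrs[of x y u] neq_pendant_if_two_nbrs[of u w x]
      neq_pendant_if_two_nbrs[of x y w] neq_pendant_if_two_nbrs[of u w y]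
      cyc(1,3-6) sym by auto
qed

lemma iso_mate5_if_outer_nbr:
  assumes C: "(u, x, w, y) \<in> four_cycles H" and C': "(u, x, w', y') \<in> four_cycles H"
    and d: "distinct [u, x, w, y, w', y']" and q: "q \<in> nbrs H w" "q \<notin> {u, x, w, y, w', y'}"
  shows "graph_iso H mate5"
proof -
  note cyc = four_cyclesD[OF simple C] and cyc' = four_cyclesD[OF simple C']
  note sym = cyc(3-6)[THEN nbrs_sym] cyc'(3-6)[THEN nbrs_sym]
  have three: "{x, y, y'} \<subseteq> nbrs H u" "{u, w, w'} \<subseteq> nbrs H x" "{x, y, q} \<subseteq> nbrs H w"
    using cyc(3-6) cyc'(3-6) sym q(1) by auto
  have distinct: "distinct [x, y, y']" "distinct [u, w, w']" "distinct [x, y, q]" using d q(2) by auto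
  have Nu: "nbrs H u = {x, y, y'}" and Nx: "nbrs H x = {u, w, w'}" and Nw: "nbrs H w = {x, y, q}"
    using nbrs_eq_if_three_nbrs[OF distinct(1) three(1)] nbrs_eq_if_three_nbrs[OF distinct(2) three(2)]
      nbrs_eq_if_three_nbrs[OF distinct(3) three(3)] .
  have deg: "deg H u = 3" "deg H x = 3" "deg H w = 3"
    using deg_eq_3_if_three_nbrs[OF distinct(1) three(1)] deg_eq_3_if_three_nbrs[OF distinct(2) three(2)]
      deg_eq_3_if_three_nbrs[OF distinct(3) three(3)] .
  have m: "mate_degrees H u w x p" using mate_degrees_if_cubic[of u w x] d deg by auto
  have deg2: "deg H y = 2" "deg H w' = 2" "deg H y' = 2"
    using deg_eq_2_if_two_nbrs[OF m, of y u w] deg_eq_2_if_two_nbrs[OF m, of w' x y']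
      deg_eq_2_if_two_nbrs[OF m, of y' u w'] d cyc(3-6) cyc'(3-6) sym by auto
  have not_p: "p \<notin> {u, x, w, y, w', y'}"
    using pendant_notin_four_cycle[OF C] pendant_notin_four_cycle[OF C'] by auto
  have p: "p \<in> nbrs H w"
  proof (rule ccontr)
    assume "p \<notin> nbrs H w"
    then have "p \<in> nbrs H x" using pendant_nbr_of_third_cubic[OF m] Nu Nw Nx not_p d by auto
    then show False using Nx not_p by auto
  qed
  have "{u, x, w, y, w', y', p} \<subseteq> verts H" using cyc(2) cyc'(2) pendant_in_verts by simp
  moreover have "distinct [u, x, w, y, w', y', p]" using d not_p by auto
  ultimately show ?thesis
    using graph_iso_mate5[OF simple connected _ _ cyc(3-6) cyc'(4-6) p] deg deg2 m
    by (simp add: mate_degrees_def)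
qed

lemma iso_mate5_if_ladder:
  assumes C: "(u, x, w, y) \<in> four_cycles H" and C': "(u, x, w', y') \<in> four_cycles H"
    and d: "distinct [u, x, w, y, w', y']"
  shows "graph_iso H mate5"
proof -
  note cyc = four_cyclesD[OF simple C] and cyc' = four_cyclesD[OF simple C']
  note sym = cyc(3-6)[THEN nbrs_sym] cyc'(3-6)[THEN nbrs_sym]
  have N: "nbrs H u = {x, y, y'}" "nbrs H x = {u, w, w'}"
    using nbrs_eq_if_three_nbrs[of x y y' u] nbrs_eq_if_three_nbrs[of u w w' x] d cyc(3-6) cyc'(3-6) sym by auto
  have "{u, x, w, y, w', y'} \<subseteq> verts H" "p \<notin> {u, x, w, y, w', y'}"
    using cyc(2) cyc'(2) pendant_notin_four_cycle[OF C] pendant_notin_four_cycle[OF C'] by auto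
  then obtain r q where r: "r \<in> {u, x, w, y, w', y'}" "q \<in> nbrs H r" "q \<notin> {u, x, w, y, w', y'}"
    using outer_nbrE[of "{u, x, w, y, w', y'}"] by auto
  have flip: "(x, u, y, w) \<in> four_cycles H" "(x, u, y', w') \<in> four_cycles H"
    using C C' four_cycles_rotate four_cycles_reflect by metis+
  have "r \<noteq> u" "r \<noteq> x" using r(2,3) N by auto
  then consider "r = w" | "r = y" | "r = w'" | "r = y'" using r(1) by blast
  then show ?thesis
  proof cases
    case 1
    then show ?thesis using iso_mate5_if_outer_nbr[OF C C' d] r by auto
  next
    case 2
    then show ?thesis using iso_mate5_if_outer_nbr[OF flip] d r by auto
  next
    case 3
    then show ?thesis using iso_mate5_if_outer_nbr[OF C' C] d r by auto
  next
    case 4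
    then show ?thesis using iso_mate5_if_outer_nbr[OF flip(2,1)] d r by auto
  qed
qed

end

section \<open>Spectra of the mates\<close>

definition edge_list_lap :: "nat \<Rightarrow> (nat \<times> nat) list \<Rightarrow> nat \<Rightarrow> nat \<Rightarrow> int" where
  "edge_list_lap n es i j = (if i = j then int (length (adj_list n es i)) else 0)
    - (if j \<in> set (adj_list n es i) then 1 else 0)"

lemma lap_edge_list_graph: "edge_list_on n es \<Longrightarrow> lap (edge_list_graph n es) = edge_list_lap n es"
  by (intro ext) (simp add: lap_def edge_list_lap_def nbrs_edge_list_graph deg_edge_list_graph)

lemma cospectral_edge_list_graphs:
  fixes P Q :: "int list list" and d :: int
  assumes es: "edge_list_on n es" and fs: "edge_list_on n fs" and d: "d \<noteq> 0"
    and intertwining: "\<forall>i\<in>set [0..<n]. \<forall>j\<in>set [0..<n].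
      (\<Sum>z\<in>set [0..<n]. edge_list_lap n es i z * P ! z ! j) = (\<Sum>z\<in>set [0..<n]. P ! i ! z * edge_list_lap n fs z j)"
    and inverse: "\<forall>i\<in>set [0..<n]. \<forall>j\<in>set [0..<n]. (\<Sum>z\<in>set [0..<n]. P ! i ! z * Q ! z ! j) = (if i = j then d else 0)"
  shows "cospectral (edge_list_graph n es) (edge_list_graph n fs)"
proof (rule cospectral_if_intertwining[OF simple_graph_edge_list_graph[OF es]
      simple_graph_edge_list_graph[OF fs] _ d])
  show "(\<Sum>z\<in>verts (edge_list_graph n es). lap (edge_list_graph n es) i z * P ! z ! j)
      = (\<Sum>z\<in>verts (edge_list_graph n es). P ! i ! z * lap (edge_list_graph n fs) z j)"
    if "i \<in> verts (edge_list_graph n es)" "j \<in> verts (edge_list_graph n es)" for i j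
    using that intertwining by (simp add: verts_edge_list_graph lap_edge_list_graph es fs)
  show "(\<Sum>z\<in>verts (edge_list_graph n es). P ! i ! z * Q ! z ! j) = (if i = j then d else 0)"
    if "i \<in> verts (edge_list_graph n es)" "j \<in> verts (edge_list_graph n es)" for i j
    using that inverse by (simp add: verts_edge_list_graph)
qed (simp add: verts_edge_list_graph)

definition rose_edges :: "nat \<Rightarrow> nat \<Rightarrow> (nat \<times> nat) list" where
  "rose_edges k l = map (\<lambda>i. (i, Suc i)) (filter (\<lambda>i. Suc i \<noteq> k) [0..<k + l - 2])
    @ [(0, k - 1), (0, k), (0, k + l - 2)]"

lemma edge_list_on_rose_edges: "k \<ge> 3 \<Longrightarrow> l \<ge> 3 \<Longrightarrow> edge_list_on (k + l - 1) (rose_edges k l)"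
  by (auto simp: edge_list_on_def rose_edges_def)

lemma rose_eq_edge_list_graph:
  assumes kl: "k \<ge> 3" "l \<ge> 3"
  shows "rose k l = edge_list_graph (k + l - 1) (rose_edges k l)"
proof (rule prod_eqI)
  have "{i. Suc i < k + l - 1 \<and> Suc i \<noteq> k} = set (filter (\<lambda>i. Suc i \<noteq> k) [0..<k + l - 2])" using kl by auto
  then show "edges (rose k l) = edges (edge_list_graph (k + l - 1) (rose_edges k l))"
    unfolding edges_rose[OF kl] by (simp add: edge_list_graph_def rose_edges_def image_Un image_image)
qed (simp add: verts_rose[OF kl] verts_edge_list_graph)

text \<open>Integer matrices intertwining the Laplacians of \<open>R(3, 4)\<close> and \<open>mate4\<close>, and of \<open>R(3, 5)\<close> and \<open>mate5\<close>.
  Their inverses are \<open>intertwiner4\<^sup>T / 4\<close> and \<open>intertwiner5_inv / 2\<close>.\<close>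

definition intertwiner4 :: "int list list" where
  "intertwiner4 = [[- 1, 0, 1, 1, 1, 0], [1, 1, 1, 0, 0, - 1], [1, 0, - 1, 1, 1, 0],
    [0, 1, 0, 1, - 1, 1], [1, - 1, 1, 0, 0, 1], [0, 1, 0, - 1, 1, 1]]"

definition intertwiner5 :: "int list list" where
  "intertwiner5 = [[- 2, 2, - 2, 1, - 1, 1, 0], [0, - 1, 0, 0, 1, 0, - 1], [1, 0, 0, - 1, 0, 0, - 1],
    [1, - 1, 0, 0, 0, - 1, 0], [- 1, 0, 1, 0, - 1, 0, 0], [0, 0, - 1, 0, 0, - 1, 1], [0, - 1, 1, - 1, 0, 0, 0]]"

definition intertwiner5_inv :: "int list list" where
  "intertwiner5_inv = [[0, - 1, 0, 1, - 1, - 1, 0], [- 1, 0, 1, - 2, 1, 1, - 2], [- 1, 0, 0, - 1, 1, 0, - 1],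
    [0, 0, - 1, 1, 0, - 1, - 1], [- 1, 1, 0, - 2, 0, 1, - 1], [1, - 1, - 1, 1, - 2, - 2, 2],
    [0, - 1, - 1, 0, - 1, 0, 1]]"

lemma cospectral_mate4: "cospectral (rose 3 4) mate4"
proof -
  have "cospectral (edge_list_graph 6 (rose_edges 3 4)) mate4"
    unfolding mate4_def
  proof (rule cospectral_edge_list_graphs[where P = intertwiner4 and Q = "List.transpose intertwiner4" and d = 4])
    show "edge_list_on 6 (rose_edges 3 4)" using edge_list_on_rose_edges[of 3 4] by simp
    show "edge_list_on 6 mate4_edges" by (rule edge_list_on_mates)
  qed (simp, code_simp, code_simp)
  then show ?thesis using rose_eq_edge_list_graph[of 3 4] by simp
qed

lemma cospectral_mate5: "cospectral (rose 3 5) mate5"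
proof -
  have "cospectral (edge_list_graph 7 (rose_edges 3 5)) mate5"
    unfolding mate5_def
  proof (rule cospectral_edge_list_graphs[where P = intertwiner5 and Q = intertwiner5_inv and d = 2])
    show "edge_list_on 7 (rose_edges 3 5)" using edge_list_on_rose_edges[of 3 5] by simp
    show "edge_list_on 7 mate5_edges" by (rule edge_list_on_mates)
  qed (simp, code_simp, code_simp)
  then show ?thesis using rose_eq_edge_list_graph[of 3 5] by simp
qed

lemma not_iso_rose_if_deg_le_3:
  assumes K: "simple_graph K" "\<And>u. u \<in> verts K \<Longrightarrow> deg K u \<le> 3" and kl: "k \<ge> 3" "l \<ge> 3"
  shows "\<not> graph_iso K (rose k l)"
proof
  have zero: "0 \<in> verts (rose k l)" using kl by (simp add: verts_rose)
  assume "graph_iso K (rose k l)"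
  then have "graph_iso (rose k l) K" by (rule graph_iso_sym)
  then obtain f where f: "bij_betw f (verts (rose k l)) (verts K)"
    and deg: "deg K (f 0) = deg (rose k l) 0"
    using graph_iso_degE[OF _ simple_graph_rose[OF kl] K(1)] zero by metis
  have "f 0 \<in> verts K" "deg K (f 0) = 4" using f zero deg deg_rose[OF kl, of 0] kl by (auto simp: bij_betw_def)
  then show False using K(2)[of "f 0"] by simp
qed

lemma not_iso_rose_edge_list_graph:
  assumes es: "edge_list_on n es" and "\<forall>d\<in>set (map (length \<circ> adj_list n es) [0..<n]). d \<le> 3" and kl: "k \<ge> 3" "l \<ge> 3"
  shows "\<not> graph_iso (edge_list_graph n es) (rose k l)"
proof (rule not_iso_rose_if_deg_le_3[OF simple_graph_edge_list_graph[OF es] _ kl])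
  fix i assume "i \<in> verts (edge_list_graph n es)"
  then show "deg (edge_list_graph n es) i \<le> 3"
    using assms(2) by (simp add: verts_edge_list_graph deg_edge_list_graph[OF es])
qed

section \<open>Classification\<close>

lemma not_mate_degrees_cospectral_rose_3_3:
  assumes cosp: "cospectral H (rose 3 3)"
  shows "\<not> mate_degrees H a b c p"
proof
  assume m: "mate_degrees H a b c p"
  have H: "simple_graph H" using cosp by (simp add: cospectral_def)
  have card_V: "card (verts H) = 5" using cospectral_card_verts[OF cosp] by (simp add: verts_rose)
  have "distinct [0, 1, 2 :: nat]" "distinct [0, 3, Suc 3]" "orderings 0 1 2 \<inter> orderings 0 3 (Suc 3) = {}"
    by (simp_all add: orderings_def)
  then have "card (triangles (rose 3 3)) = 12"
    by (simp add: triangles_rose card_Un_disjoint card_orderings orderings_def)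
  then have card_T: "card (triangles H) = 6" using card_triangles_mate[OF _ _ cosp m] by simp
  obtain r where r: "nbrs H p = {r}" using m by (auto simp: mate_degrees_def deg_def card_1_singleton_iff)
  have full: "nbrs H x = verts H - {p, x}" if x: "x \<in> {a, b, c}" "x \<noteq> r" for x
  proof (rule card_subset_eq)
    show "nbrs H x \<subseteq> verts H - {p, x}"
      using nbrs_subset_verts[OF H] not_self_nbr[OF H, of x] nbrs_sym[of p H x] r x(2) by auto
    have "deg H x = 3" "{p, x} \<subseteq> verts H" "p \<noteq> x" using m x(1) by (auto simp: mate_degrees_def)
    then show "card (nbrs H x) = card (verts H - {p, x})" using card_V by (simp add: card_Diff_subset deg_def)
  qed (simp add: finite_verts[OF H])
  have "a \<noteq> b" "a \<noteq> c" "b \<noteq> c" using m by (simp_all add: mate_degrees_def)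
  then obtain x y where xy: "{x, y} \<subseteq> {a, b, c} - {r}" "x \<noteq> y"
    by (cases "r = a"; cases "r = b") auto
  then have "{p, x, y} \<subseteq> verts H" "card {p, x, y} = 3" using m by (auto simp: mate_degrees_def)
  then have "card (verts H - {p, x, y}) = 2" using card_V by (simp add: card_Diff_subset)
  then obtain z z' where z: "verts H - {p, x, y} = {z, z'}" "z \<noteq> z'" by (auto simp: card_2_iff)
  have N: "nbrs H x = insert y {z, z'}" "nbrs H y = insert x {z, z'}"
    using full[of x] full[of y] xy m unfolding z(1)[symmetric] by (auto simp: mate_degrees_def)
  have "insert (x, y, z') (orderings x y z) \<subseteq> triangles H"
    using N orderings_subset_triangles[of y H x z] by (simp add: triangles_def)
  from card_mono[OF finite_triangles[OF H] this] have "card (insert (x, y, z') (orderings x y z)) \<le> 6"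
    by (simp add: card_T)
  moreover have "distinct [x, y, z]" "(x, y, z') \<notin> orderings x y z" using z xy(2) by (auto simp: orderings_def)
  ultimately show False using card_orderings[of x y z] by (simp add: orderings_def)
qed

lemma deviation_form_mate_le_4:
  assumes H: "simple_graph H" and m: "mate_degrees H a b c p" and no_triangle: "triangles H = {}"
  shows "deviation_form H \<le> 4"
proof -
  have "(a, b, c) \<notin> triangles H" using no_triangle by simp
  then have "\<not> (b \<in> nbrs H a \<and> c \<in> nbrs H b \<and> a \<in> nbrs H c)"
    using nbrs_sym[of a H c] by (auto simp: triangles_def)
  then show ?thesis unfolding deviation_form_mate[OF H m] by auto
qed

lemma mate_four_cycles:
  assumes l: "l \<ge> 4" and cosp: "cospectral H (rose 3 l)" and m: "mate_degrees H a b c p"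
  shows "deviation_form H mod 4 = 2" "card (four_cycles H) > 8"
proof -
  have H: "simple_graph H" and R: "simple_graph (rose 3 l)" using cosp by (auto simp: cospectral_def)
  note moment = card_four_cycles_mate[OF l cosp m]
  obtain i j where "card (four_cycles H) = 8 * i" "card (four_cycles (rose 3 l)) = 8 * j"
    using card_four_cycles_dvd[OF H] card_four_cycles_dvd[OF R] by (auto elim!: dvdE)
  then have form: "deviation_form H = 10 + 4 * (int j - int i)" using moment(2) by simp
  then show dev_mod: "deviation_form H mod 4 = 2" by presburger
  have "deviation_form H \<le> 2" using deviation_form_mate_le_4[OF H m moment(1)] dev_mod by presburger
  then show "card (four_cycles H) > 8" using moment(2) by linarith
qed

lemma cospectral_rose_3_mate_cases:
  assumes l: "l \<ge> 4" and cosp: "cospectral H (rose 3 l)" and m: "mate_degrees H a b c p"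
  shows "graph_iso H mate4 \<or> graph_iso H mate5"
proof -
  have kl: "3 \<ge> (3 :: nat)" "l \<ge> 3" using l by auto
  note H = simple_graph_if_cospectral_rose[OF kl cosp] and conn = connected_if_cospectral_rose[OF kl cosp]
  note no_triangle = card_four_cycles_mate(1)[OF l cosp m] and four = mate_four_cycles[OF l cosp m]
  interpret triangle_free_mate H a b c p
    by unfold_locales (use H conn m no_triangle four in auto)
  have "\<forall>u\<in>verts H. deg H u \<le> 3" using deg_le_3 by blast
  with H show ?thesis using no_triangle four(2)
  proof (cases rule: two_four_cycles_cases)
    case (disjoint u x w y u' x' w' y')
    have "(\<Sum>v\<in>verts H. int (deg H v)) = 2 * int (card (verts H)) + 2"
      using sum_deg_mate[OF H m, of "\<lambda>d. d"] by simp
    then have "card (edges H) = Suc (card (verts H))" using sum_deg[OF H] by (simp flip: of_nat_sum)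
    then have "\<not> 3 dvd tree_number H"
      using not_3_dvd_tree_number_if_disjoint_four_cycles[OF H conn _ disjoint] by simp
    then show ?thesis using tree_number_cospectral_rose[OF kl cosp] by simp
  next
    case (k23 u w x y z)
    then show ?thesis using iso_mate4_if_K23[of u w x y z] by simp
  next
    case (ladder u x w y w' y')
    then show ?thesis using iso_mate5_if_ladder by blast
  qed
qed

lemma cospectral_mate_classification:
  assumes kl: "3 \<le> k" "k \<le> l" and cosp: "cospectral H (rose k l)" and m: "mate_degrees H a b c p"
  shows "k = 3 \<and> (l = 4 \<and> graph_iso H mate4 \<or> l = 5 \<and> graph_iso H mate5)"
proof -
  have l3: "l \<ge> 3" using kl by simp
  have "triangles (rose k l) \<noteq> {}" using card_triangles_mate[OF kl(1) l3 cosp m] by force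
  then have k: "k = 3" using triangles_rose[OF kl(1) l3] kl by (auto split: if_splits)
  have "l \<noteq> 3" using not_mate_degrees_cospectral_rose_3_3[of H a b c p] cosp m k by blast
  then have "l \<ge> 4" using l3 by simp
  from cospectral_rose_3_mate_cases[OF this _ m] have "graph_iso H mate4 \<or> graph_iso H mate5"
    using cosp k by simp
  moreover have "card (verts H) = l + 2" using cospectral_card_verts[OF cosp] l3 k by (simp add: verts_rose)
  moreover have "card (verts mate4) = 6" "card (verts mate5) = 7"
    by (simp_all add: mate4_def mate5_def verts_edge_list_graph)
  ultimately show ?thesis using k graph_iso_card_verts[of H mate4] graph_iso_card_verts[of H mate5] by force
qed

lemma sum_prod_eq_imp_eq:
  fixes k l k' l' :: nat
  assumes "k + l = k' + l'" "k * l = k' * l'" "k \<le> l" "k' \<le> l'"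
  shows "k = k'" "l = l'"
proof -
  have "(int k - int k') * (int k - int l') = int (k' * l') - int k * (int k' + int l' - int k)"
    by (simp add: algebra_simps)
  also have "int k' + int l' - int k = int l" using assms(1) by linarith
  finally have "(int k - int k') * (int k - int l') = 0" by (simp flip: assms(2))
  then have "k = k' \<or> k = l'" by auto
  then show "k = k'" using assms by auto
  then show "l = l'" using assms(1) by simp
qed

lemma rose_cospectral_rose_imp_eq:
  assumes kl: "3 \<le> k" "k \<le> l" and kl': "3 \<le> k'" "k' \<le> l'" and cosp: "cospectral (rose k' l') (rose k l)"
  shows "k = k'" "l = l'"
proof -
  have l: "3 \<le> l" "3 \<le> l'" using kl kl' by auto
  have "k + l = k' + l'" using cospectral_card_verts[OF cosp] kl kl' l by (simp add: verts_rose)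
  moreover have "k * l = k' * l'"
    using tree_number_cospectral_rose[OF kl(1) l(1) cosp] tree_number_rose[OF kl'(1) l(2)]
    by (metis of_nat_eq_iff)
  ultimately show "k = k'" "l = l'" using sum_prod_eq_imp_eq kl(2) kl'(2) by metis+
qed

lemma cospectral_rose_classification:
  assumes kl: "3 \<le> k" "k \<le> l" and cosp: "cospectral H (rose k l)"
  shows "graph_iso H (rose k l) \<or> k = 3 \<and> (l = 4 \<and> graph_iso H mate4 \<or> l = 5 \<and> graph_iso H mate5)"
proof -
  have l3: "l \<ge> 3" using kl by simp
  note H = simple_graph_if_cospectral_rose[OF kl(1) l3 cosp]
  from kl(1) l3 cosp show ?thesis
  proof (cases rule: cospectral_rose_degrees_cases)
    case (rose v)
    then have "deg H u = 2" if "u \<in> verts H" "u \<noteq> v" for u using that by blast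
    from iso_rose_if_degrees[OF H connected_if_cospectral_rose[OF kl(1) l3 cosp] rose(1,2) this]
    obtain k' l' where kl': "3 \<le> k'" "k' \<le> l'" and iso: "graph_iso H (rose k' l')" .
    have R': "simple_graph (rose k' l')" using kl' by (intro simple_graph_rose) auto
    have "cospectral (rose k' l') (rose k l)"
      using cosp R' graph_iso_laplacian_spectrum[OF iso H R'] by (simp add: cospectral_def)
    from rose_cospectral_rose_imp_eq[OF kl kl' this] show ?thesis using iso by simp
  next
    case (mate a b c p)
    then show ?thesis using cospectral_mate_classification[OF kl cosp] by blast
  qed
qed

lemma two_rose_determined_by_laplacian_spectrum:
  fixes G :: "'a ugraph"
  assumes G: "two_rose G" "\<not> graph_iso G (rose 3 4)" "\<not> graph_iso G (rose 3 5)"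
  shows "determined_by_laplacian_spectrum TYPE('b) G"
  unfolding determined_by_laplacian_spectrum_def
proof (intro allI impI, elim conjE)
  fix H :: "'b ugraph"
  assume H: "simple_graph H" and spec: "laplacian_spectrum H = laplacian_spectrum G"
  obtain k l where kl: "3 \<le> k" "k \<le> l" and iso: "graph_iso G (rose k l)"
    using two_rose_iso_roseE[OF G(1)] .
  have R: "simple_graph (rose k l)" using kl by (intro simple_graph_rose) auto
  have "cospectral H (rose k l)"
    using H R spec graph_iso_laplacian_spectrum[OF iso two_rose_simple_graph[OF G(1)] R] by (simp add: cospectral_def)
  from cospectral_rose_classification[OF kl this] have "graph_iso H (rose k l)" using G(2,3) iso by auto
  then show "graph_iso H G" using graph_iso_trans graph_iso_sym[OF iso] by blast
qed

lemma laplacian_cospectral_mate_iff: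
  "simple_graph G \<Longrightarrow> laplacian_cospectral_mate G H \<longleftrightarrow> cospectral H G \<and> \<not> graph_iso H G"
  by (auto simp: laplacian_cospectral_mate_def cospectral_def)

lemma laplacian_cospectral_mates:
  "laplacian_cospectral_mate (rose 3 4) mate4" "laplacian_cospectral_mate (rose 3 5) mate5"
proof -
  have "\<not> graph_iso mate4 (rose 3 4)" "\<not> graph_iso mate5 (rose 3 5)"
    unfolding mate4_def mate5_def
    by (rule not_iso_rose_edge_list_graph[OF edge_list_on_mates(1)]
        not_iso_rose_edge_list_graph[OF edge_list_on_mates(2)]; simp only: mate_degree_lists; simp)+
  then show "laplacian_cospectral_mate (rose 3 4) mate4" "laplacian_cospectral_mate (rose 3 5) mate5"
    using cospectral_mate4 cospectral_mate5 by (simp_all add: cospectral_def laplacian_cospectral_mate_def)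
qed

lemma laplacian_cospectral_mate_unique:
  "laplacian_cospectral_mate (rose 3 4) H \<Longrightarrow> graph_iso H mate4"
  "laplacian_cospectral_mate (rose 3 5) H \<Longrightarrow> graph_iso H mate5"
  using cospectral_rose_classification[of 3 4 H] cospectral_rose_classification[of 3 5 H]
    simple_graph_rose[of 3 4] simple_graph_rose[of 3 5]
  by (simp_all add: laplacian_cospectral_mate_iff)

theorem theorem6p1:
  shows "(\<forall>G :: 'a ugraph. two_rose G \<and> \<not> graph_iso G (rose 3 4) \<and> \<not> graph_iso G (rose 3 5) \<longrightarrow>
            determined_by_laplacian_spectrum TYPE('b) G) \<and>
         (\<forall>l\<in>{4, 5}. \<exists>H :: nat ugraph. laplacian_cospectral_mate (rose 3 l) H \<and>
            (\<forall>H' :: 'b ugraph. laplacian_cospectral_mate (rose 3 l) H' \<longrightarrow> graph_iso H' H))"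
proof (intro conjI allI impI ballI)
  fix G :: "'a ugraph"
  assume "two_rose G \<and> \<not> graph_iso G (rose 3 4) \<and> \<not> graph_iso G (rose 3 5)"
  then show "determined_by_laplacian_spectrum TYPE('b) G"
    by (simp add: two_rose_determined_by_laplacian_spectrum)
next
  fix l :: nat
  assume "l \<in> {4, 5}"
  then show "\<exists>H :: nat ugraph. laplacian_cospectral_mate (rose 3 l) H \<and>
      (\<forall>H' :: 'b ugraph. laplacian_cospectral_mate (rose 3 l) H' \<longrightarrow> graph_iso H' H)"
    using laplacian_cospectral_mates laplacian_cospectral_mate_unique by blast
qed

end
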